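(* Let $n\ge1$, $s\in(0,1)$, and let $\Omega\subset\mathbb{R}^n$ be a bounded open set with Lipschitz boundary. Let $A\subset\Omega$ be an open set and $\psi\in L^\infty(A)$. Then there exists a constant $\Theta=\Theta(n,s)>1$, depending only on $n$ and $s$, such that for every $\varphi:\mathbb{R}^n\to\mathbb{R}$ with $\varphi\in L^\infty(\Omega_{\Theta\,\mathrm{diam}(\Omega)}\setminus\Omega)$ there exists a unique function $u\in\mathcal{W}^s_{\varphi,\psi}(\Omega,A)$ that solves the obstacle problem in $\Omega$ with exterior data $\varphi$ and obstacle $\psi$ in $A$. Moreover, $$\|u\|_{L^\infty(\Omega)}\le\mathrm{diam}(\Omega)+\max\big\{\|\varphi\|_{L^\infty(\Omega_{\Theta\,\mathrm{diam}(\Omega)}\setminus\Omega)},\ \|\psi\|_{L^\infty(A)}\big\}.$$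
   Context: For $\delta\in\mathbb{R}$, $\Omega_\delta:=\{x\in\mathbb{R}^n:\bar d_\Omega(x)<\delta\}$, where $\bar d_\Omega(x)=d(x,\Omega)-d(x,\mathbb{R}^n\setminus\Omega)$ is the signed distance from $\partial\Omega$, negative inside $\Omega$. Obstacle problem. Set $g_s(t)=(1+t^2)^{-\frac{n+1+s}{2}}$, $G_s(t)=\int_0^t g_s(\tau)\,d\tau$, $\mathcal{G}_s(t)=\int_0^tG_s(\tau)\,d\tau$, and $Q(\Omega)=\mathbb{R}^{2n}\setminus(\mathbb{R}^n\setminus\Omega)^2$. Functions are measurable and identified when equal a.e. $\mathcal{W}^s(\Omega)$ is the set of $u:\mathbb{R}^n\to\mathbb{R}$ with $u|_\Omega\in W^{s,1}(\Omega)$, i.e. $\|u\|_{L^1(\Omega)}+\int_\Omega\int_\Omega\frac{|u(x)-u(y)|}{|x-y|^{n+s}}\,dx\,dy<\infty$. For $A\subset\Omega$ open and $\psi\in L^\infty(A)$, $$\mathcal{W}^s_{\varphi,\psi}(\Omega,A):=\{u\in\mathcal{W}^s(\Omega):u=\varphi\text{ on }\mathbb{R}^n\setminus\Omega,\ u\ge\psi\text{ a.e. in }A\}.$$ A function $u$ solves the obstacle problem (in $\Omega$, with exterior data $\varphi$ and obstacle $\psi$ in $A$) if $u\in\mathcal{W}^s_{\varphi,\psi}(\Omega,A)$ and for every $v\in\mathcal{W}^s_{\varphi,\psi}(\Omega,A)$ $$\iint_{Q(\Omega)}\left\{\mathcal{G}_s\Big(\tfrac{u(x)-u(y)}{|x-y|}\Big)-\mathcal{G}_s\Big(\tfrac{v(x)-v(y)}{|x-y|}\Big)\right\}\frac{dx\,dy}{|x-y|^{n-1+s}}\le0.$$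 *)

theory Defs
  imports "HOL-Analysis.Analysis" "HOL-Probability.Essential_Supremum"
begin

definition signed_dist :: "'a::euclidean_space set \<Rightarrow> 'a \<Rightarrow> real" where
  "signed_dist \<Omega> x = infdist x \<Omega> - infdist x (- \<Omega>)"

definition enlargement :: "'a::euclidean_space set \<Rightarrow> real \<Rightarrow> 'a set" where
  "enlargement \<Omega> \<delta> = {x. signed_dist \<Omega> x < \<delta>}"

(* Near each boundary point, \<Omega> is the strict subgraph, in some direction e, of a Lipschitz
   function on the hyperplane orthogonal to e. *)
definition lipschitz_boundary :: "'a::euclidean_space set \<Rightarrow> bool" where
  "lipschitz_boundary \<Omega> \<longleftrightarrow>
     (\<forall>p \<in> frontier \<Omega>. \<exists>r>0. \<exists>e \<gamma> L. norm e = 1 \<and> L-lipschitz_on {w. w \<bullet> e = 0} \<gamma> \<and>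
        \<Omega> \<inter> ball p r = {x \<in> ball p r. x \<bullet> e < \<gamma> (x - (x \<bullet> e) *\<^sub>R e)})"

(* The essential supremum is taken in ennreal, so that it is 0 (not -\<infinity>) on null sets. *)
definition Linf_norm :: "'a::euclidean_space set \<Rightarrow> ('a \<Rightarrow> real) \<Rightarrow> ennreal" where
  "Linf_norm S f = esssup (lebesgue_on S) (\<lambda>x. ennreal \<bar>f x\<bar>)"

definition Linf :: "'a::euclidean_space set \<Rightarrow> ('a \<Rightarrow> real) set" where
  "Linf S = {f. f \<in> borel_measurable (lebesgue_on S) \<and> Linf_norm S f < \<infinity>}"

definition g_s :: "nat \<Rightarrow> real \<Rightarrow> real \<Rightarrow> real" where
  "g_s n s t = (1 + t\<^sup>2) powr (- (real n + 1 + s) / 2)"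

definition G_s :: "nat \<Rightarrow> real \<Rightarrow> real \<Rightarrow> real" where
  "G_s n s t = (LBINT \<tau>=ereal 0..ereal t. g_s n s \<tau>)"

definition calG_s :: "nat \<Rightarrow> real \<Rightarrow> real \<Rightarrow> real" where
  "calG_s n s t = (LBINT \<tau>=ereal 0..ereal t. G_s n s \<tau>)"

definition Q_region :: "'a set \<Rightarrow> ('a \<times> 'a) set" where
  "Q_region \<Omega> = UNIV - (- \<Omega>) \<times> (- \<Omega>)"

definition W_s_norm :: "real \<Rightarrow> (real ^ 'n) set \<Rightarrow> (real ^ 'n \<Rightarrow> real) \<Rightarrow> ennreal" where
  "W_s_norm s \<Omega> u =
     set_nn_integral lebesgue \<Omega> (\<lambda>x. ennreal \<bar>u x\<bar>) +
     set_nn_integral lebesgue (\<Omega> \<times> \<Omega>)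
       (\<lambda>(x, y). ennreal (\<bar>u x - u y\<bar> / norm (x - y) powr (real CARD('n) + s)))"

definition W_s :: "real \<Rightarrow> (real ^ 'n) set \<Rightarrow> (real ^ 'n \<Rightarrow> real) set" where
  "W_s s \<Omega> = {u. u \<in> borel_measurable lebesgue \<and> W_s_norm s \<Omega> u < \<infinity>}"

definition W_s_obst ::
  "real \<Rightarrow> (real ^ 'n) set \<Rightarrow> (real ^ 'n) set \<Rightarrow> (real ^ 'n \<Rightarrow> real) \<Rightarrow> (real ^ 'n \<Rightarrow> real) \<Rightarrow>
   (real ^ 'n \<Rightarrow> real) set" where
  "W_s_obst s \<Omega> A \<phi> \<psi> =
     {u \<in> W_s s \<Omega>. (AE x in lebesgue. x \<notin> \<Omega> \<longrightarrow> u x = \<phi> x) \<and> (AE x in lebesgue. x \<in> A \<longrightarrow> \<psi> x \<le> u x)}"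

definition energy_diff ::
  "real \<Rightarrow> (real ^ 'n \<Rightarrow> real) \<Rightarrow> (real ^ 'n \<Rightarrow> real) \<Rightarrow> (real ^ 'n) \<times> (real ^ 'n) \<Rightarrow> real" where
  "energy_diff s u v = (\<lambda>(x, y).
     (calG_s CARD('n) s ((u x - u y) / norm (x - y)) - calG_s CARD('n) s ((v x - v y) / norm (x - y)))
       / norm (x - y) powr (real CARD('n) - 1 + s))"

(* Integrability is required explicitly because the Bochner integral of a non-integrable
   function is 0 by convention, which would make the inequality hold vacuously. *)
definition solves_obstacle ::
  "real \<Rightarrow> (real ^ 'n) set \<Rightarrow> (real ^ 'n) set \<Rightarrow> (real ^ 'n \<Rightarrow> real) \<Rightarrow> (real ^ 'n \<Rightarrow> real) \<Rightarrow>
   (real ^ 'n \<Rightarrow> real) \<Rightarrow> bool" where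
  "solves_obstacle s \<Omega> A \<phi> \<psi> u \<longleftrightarrow>
     u \<in> W_s_obst s \<Omega> A \<phi> \<psi> \<and>
     (\<forall>v \<in> W_s_obst s \<Omega> A \<phi> \<psi>.
        set_integrable lebesgue (Q_region \<Omega>) (energy_diff s u v) \<and>
        set_lebesgue_integral lebesgue (Q_region \<Omega>) (energy_diff s u v) \<le> 0)"

end

theory Submission
  imports Defs
begin

text \<open>
The difficulty is that the exterior data are bounded only near \<open>\<Omega>\<close>, so the full energy may be
infinite and only differences of energies make sense. As the energy density has linear growth,
the difference of the energies of \<open>u\<close> and \<open>v\<close> is dominated by the interaction of \<open>u - v\<close> with
itself, which is supported in \<open>\<Omega>\<close>. Its integrability amounts to a fractional Hardy inequality:
the integral of \<open>\<bar>u x\<bar>\<close> against the mass of the kernel in the complement is finite for every \<open>u\<close> in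
the space (\<open>fractional_hardy\<close>). This is the only use of the Lipschitz boundary. The proof compares
a boundary layer of width \<open>\<delta>\<close> with \<open>N\<close> disjoint inward translates of it. The mass of the layer is at
most \<open>1 / N\<close> times the mass of a layer wider by a factor of order \<open>N\<close>, up to an error controlled by
the Gagliardo energy. The weight \<open>\<delta> powr - s\<close> grows only by a factor of order \<open>N powr s\<close> between the
two, so for large \<open>N\<close> the main term is absorbed.

The bound on the solution comes from truncation at the level \<open>M\<close>, the right-hand side of the claimed
estimate (\<open>energy_truncation_le\<close>). Inside \<open>\<Omega>\<close>
truncation is a contraction. Exterior points at distance between one and two diameters have data
below \<open>M\<close> by a full diameter, so they gain energy at a definite rate. Points farther than \<open>\<Theta>\<close>
diameters, where the data are arbitrary, cost at most the Lipschitz constant of the density times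
the tail of the kernel. Gain and cost scale in the same way, so a constant \<open>\<Theta>\<close> depending only on
\<open>n\<close> and \<open>s\<close> makes truncation favourable.

Hence it suffices to minimise among functions bounded by \<open>M\<close> (\<open>bounded_minimizer_exists\<close>). Among them
the relative energy is convex and bounded below. Choosing nearly
minimal elements that in addition nearly minimise the \<open>L\<^sup>2\<close> norm gives, by the parallelogram
law, a Cauchy sequence in \<open>L\<^sup>2\<close>, and Fatou's lemma passes to an almost everywhere limit.

Uniqueness is strict convexity, together with the fact that all competitors agree outside \<open>\<Omega>\<close>
(\<open>minimizers_eq_AE\<close>).
\<close>

section \<open>The convex nonlinearity\<close>

lemma continuous_g_s: "continuous_on S (g_s n s)"
  unfolding g_s_def by (intro continuous_intros) (auto simp: add_nonneg_eq_0_iff)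

lemma g_s_pos: "0 < g_s n s t"
  by (auto simp: g_s_def add_nonneg_eq_0_iff)

lemma g_s_le_arctan_deriv:
  assumes "1 \<le> n" "0 \<le> s" shows "g_s n s t \<le> inverse (1 + t\<^sup>2)"
proof -
  have "(1 + t\<^sup>2) powr (- (real n + 1 + s) / 2) \<le> (1 + t\<^sup>2) powr (-1)"
    using assms by (intro powr_mono) auto
  then show ?thesis by (simp add: g_s_def powr_minus add_nonneg_eq_0_iff)
qed

lemma interval_integral_has_real_derivative:
  fixes f :: "real \<Rightarrow> real"
  assumes "continuous_on UNIV f"
  shows "((\<lambda>t. LBINT y=ereal 0..ereal t. f y) has_real_derivative f t) (at t)"
proof -
  define r where "r = \<bar>t\<bar> + 1"
  have "((\<lambda>u. LBINT y=0..u. f y) has_vector_derivative (f t)) (at t within {-r..r})"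
    using interval_integral_FTC2[of "-r" 0 r f t] continuous_on_subset[OF assms subset_UNIV]
    by (simp add: r_def zero_ereal_def)
  moreover have "at t within {-r..r} = at t"
    by (rule at_within_interior) (auto simp: r_def)
  ultimately show ?thesis
    by (simp add: has_real_derivative_iff_has_vector_derivative zero_ereal_def)
qed

lemma G_s_deriv: "(G_s n s has_real_derivative g_s n s t) (at t)"
  using interval_integral_has_real_derivative[OF continuous_g_s] by (simp add: G_s_def[abs_def])

lemma continuous_G_s: "continuous_on S (G_s n s)"
  using G_s_deriv by (meson DERIV_isCont continuous_at_imp_continuous_on)

lemma calG_s_deriv: "(calG_s n s has_real_derivative G_s n s t) (at t)"
  using interval_integral_has_real_derivative[OF continuous_G_s] by (simp add: calG_s_def[abs_def])

lemma continuous_calG_s: "continuous_on S (calG_s n s)"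
  using calG_s_deriv by (meson DERIV_isCont continuous_at_imp_continuous_on)

lemma borel_measurable_calG_s [measurable]: "calG_s n s \<in> borel_measurable borel"
  by (intro borel_measurable_continuous_onI continuous_calG_s)

lemma G_s_0 [simp]: "G_s n s 0 = 0" and calG_s_0 [simp]: "calG_s n s 0 = 0"
  by (simp_all add: G_s_def calG_s_def)

lemma G_s_strict_mono: "a < b \<Longrightarrow> G_s n s a < G_s n s b"
  using DERIV_pos_imp_increasing[of a b "G_s n s"] G_s_deriv g_s_pos by blast

lemma G_s_mono: "a \<le> b \<Longrightarrow> G_s n s a \<le> G_s n s b"
  using G_s_strict_mono[of a b] by (cases "a = b") (auto intro: less_imp_le)

lemma G_s_pos: "0 < t \<Longrightarrow> 0 < G_s n s t"
  using G_s_strict_mono[of 0 t] by simp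

lemma G_s_minus: "G_s n s (- t) = - G_s n s t"
proof -
  have "((\<lambda>t. G_s n s t + G_s n s (- t)) has_real_derivative 0) (at t)" for t
    by (rule derivative_eq_intros G_s_deriv DERIV_chain'[where g="G_s n s"] refl)+
       (simp add: g_s_def)
  then have "G_s n s t + G_s n s (- t) = G_s n s 0 + G_s n s (- 0)"
    by (intro DERIV_isconst_all[rule_format]) auto
  then show ?thesis by simp
qed

lemma calG_s_minus [simp]: "calG_s n s (- t) = calG_s n s t"
proof -
  have "((\<lambda>t. calG_s n s t - calG_s n s (- t)) has_real_derivative 0) (at t)" for t
    by (rule derivative_eq_intros calG_s_deriv DERIV_chain'[where g="calG_s n s"] refl)+
       (simp add: G_s_minus)
  then have "calG_s n s t - calG_s n s (- t) = calG_s n s 0 - calG_s n s (- 0)"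
    by (intro DERIV_isconst_all[rule_format]) auto
  then show ?thesis by simp
qed

lemma abs_G_s_le:
  assumes "1 \<le> n" "0 \<le> s" shows "\<bar>G_s n s t\<bar> \<le> 2"
proof -
  have pos: "G_s n s t \<le> 2" if "0 \<le> t" for t
  proof -
    have "G_s n s t - arctan t \<le> G_s n s 0 - arctan 0"
    proof (rule DERIV_nonpos_imp_nonincreasing[OF that])
      fix x :: real
      show "\<exists>y. ((\<lambda>t. G_s n s t - arctan t) has_real_derivative y) (at x) \<and> y \<le> 0"
        using g_s_le_arctan_deriv[OF assms, of x]
        by (intro exI[of _ "g_s n s x - inverse (1 + x\<^sup>2)"] conjI DERIV_diff G_s_deriv DERIV_arctan) simp
    qed
    then show ?thesis using arctan_ubound[of t] pi_less_4 by simp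
  qed
  have nonneg: "0 \<le> G_s n s t" if "0 \<le> t" for t using G_s_mono[OF that] by simp
  show ?thesis
  proof (cases "0 \<le> t")
    case True then show ?thesis using pos nonneg by simp
  next
    case False
    then have "0 \<le> - t" by simp
    from pos[OF this] nonneg[OF this] show ?thesis by (simp add: G_s_minus)
  qed
qed

lemma calG_s_tangent_strict:
  assumes "a \<noteq> b" shows "calG_s n s a + G_s n s a * (b - a) < calG_s n s b"
proof (cases "a < b")
  case True
  then obtain z where z: "a < z" "z < b" "calG_s n s b - calG_s n s a = (b - a) * G_s n s z"
    using MVT2[OF True, of "calG_s n s" "G_s n s"] calG_s_deriv by auto
  have "(b - a) * G_s n s a < (b - a) * G_s n s z"
    using z True G_s_strict_mono[of a z] by (simp add: mult_strict_left_mono)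
  with z show ?thesis by (simp add: algebra_simps)
next
  case False
  with assms have "b < a" by simp
  then obtain z where z: "b < z" "z < a" "calG_s n s a - calG_s n s b = (a - b) * G_s n s z"
    using MVT2[of b a "calG_s n s" "G_s n s"] calG_s_deriv by auto
  have "(a - b) * G_s n s z < (a - b) * G_s n s a"
    using z G_s_strict_mono[of z a] by (simp add: mult_strict_left_mono)
  with z show ?thesis by (simp add: algebra_simps)
qed

lemma calG_s_tangent: "calG_s n s a + G_s n s a * (b - a) \<le> calG_s n s b"
  using calG_s_tangent_strict[of a b n s] by (cases "a = b") auto

lemma calG_s_midpoint_strict:
  assumes "a \<noteq> b" shows "2 * calG_s n s ((a + b) / 2) < calG_s n s a + calG_s n s b"
proof -
  let ?m = "(a + b) / 2"
  have "calG_s n s ?m + G_s n s ?m * (a - ?m) < calG_s n s a"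
    using assms by (intro calG_s_tangent_strict) (auto simp: field_simps)
  moreover have "calG_s n s ?m + G_s n s ?m * (b - ?m) < calG_s n s b"
    using assms by (intro calG_s_tangent_strict) (auto simp: field_simps)
  moreover have "G_s n s ?m * (a - ?m) + G_s n s ?m * (b - ?m) = 0"
    by (simp add: field_simps)
  ultimately show ?thesis by linarith
qed

lemma calG_s_midpoint: "2 * calG_s n s ((a + b) / 2) \<le> calG_s n s a + calG_s n s b"
  using calG_s_midpoint_strict[of a b n s] by (cases "a = b") auto

lemma calG_s_nonneg [simp]: "0 \<le> calG_s n s t"
  using calG_s_tangent[of n s 0 t] by simp

lemma calG_s_lipschitz:
  assumes "1 \<le> n" "0 \<le> s" shows "\<bar>calG_s n s a - calG_s n s b\<bar> \<le> 2 * \<bar>a - b\<bar>"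
proof -
  have *: "calG_s n s b - calG_s n s a \<le> 2 * \<bar>a - b\<bar>" for a b
  proof -
    have "calG_s n s b - calG_s n s a \<le> - (G_s n s b * (a - b))"
      using calG_s_tangent[of n s b a] by simp
    also have "\<dots> \<le> \<bar>G_s n s b\<bar> * \<bar>a - b\<bar>" by (metis abs_ge_minus_self abs_mult)
    also have "\<dots> \<le> 2 * \<bar>a - b\<bar>" using abs_G_s_le[OF assms] by (intro mult_right_mono) auto
    finally show ?thesis .
  qed
  show ?thesis using *[of a b] *[of b a] by (simp add: abs_minus_commute abs_le_iff)
qed

text \<open>Linear growth of the energy density is what makes sublevel sets bounded in the Gagliardo
  seminorm.\<close>

lemma calG_s_linear_growth: "G_s n s 1 * (\<bar>t\<bar> - 1) \<le> calG_s n s t"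
proof -
  have "calG_s n s 1 + G_s n s 1 * (\<bar>t\<bar> - 1) \<le> calG_s n s \<bar>t\<bar>" by (rule calG_s_tangent)
  moreover have "calG_s n s \<bar>t\<bar> = calG_s n s t" by (cases "0 \<le> t") auto
  ultimately show ?thesis using calG_s_nonneg[of n s 1] by linarith
qed

lemma calG_s_mono_abs:
  assumes "\<bar>a\<bar> \<le> \<bar>b\<bar>" shows "calG_s n s a \<le> calG_s n s b"
proof -
  have "calG_s n s \<bar>a\<bar> \<le> calG_s n s \<bar>b\<bar>"
    using calG_s_tangent[of n s "\<bar>a\<bar>" "\<bar>b\<bar>"] G_s_mono[of 0 "\<bar>a\<bar>" n s] assms
    by (smt (verit) G_s_0 abs_ge_zero mult_nonneg_nonneg)
  moreover have "calG_s n s \<bar>t\<bar> = calG_s n s t" for t by (cases "0 \<le> t") auto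
  ultimately show ?thesis by simp
qed

section \<open>Integrals of the homogeneous kernel\<close>

abbreviation annulus :: "real \<Rightarrow> 'a::euclidean_space set" where
  "annulus R \<equiv> {z. R \<le> norm z \<and> norm z < 2 * R}"

lemma kernel_annulus_le:
  assumes "0 < R" "0 \<le> p"
  shows "(\<integral>\<^sup>+z. ennreal (norm (z::'a::euclidean_space) powr - p) * indicator (annulus R) z \<partial>lborel)
    \<le> ennreal (unit_ball_vol DIM('a) * 2 ^ DIM('a) * R powr (real DIM('a) - p))"
proof -
  have "(\<integral>\<^sup>+z. ennreal (norm (z::'a) powr - p) * indicator (annulus R) z \<partial>lborel)
      \<le> (\<integral>\<^sup>+z. ennreal (R powr - p) * indicator (ball (0::'a) (2 * R)) z \<partial>lborel)"
    using assms
    by (intro nn_integral_mono) (auto simp: indicator_def powr_mono2' intro!: ennreal_leI)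
  also have "\<dots> = ennreal (R powr - p) * ennreal (unit_ball_vol DIM('a) * (2 * R) ^ DIM('a))"
    using assms by (simp add: nn_integral_cmult_indicator emeasure_ball)
  also have "\<dots> = ennreal (unit_ball_vol DIM('a) * 2 ^ DIM('a) * (R powr - p * R powr real DIM('a)))"
    using assms by (simp add: ennreal_mult'[symmetric] power_mult_distrib powr_realpow mult_ac)
  also have "R powr - p * R powr real DIM('a) = R powr (real DIM('a) - p)"
    by (simp add: powr_add[symmetric])
  finally show ?thesis .
qed

lemma kernel_dyadic_le:
  fixes S :: "'a::euclidean_space set" and r :: "nat \<Rightarrow> real"
  assumes r: "\<And>k. 0 < r k" and p: "0 \<le> p" and S: "S \<subseteq> insert 0 (\<Union>k. annulus (r k))"
  shows "(\<integral>\<^sup>+z. ennreal (norm z powr - p) * indicator S z \<partial>lborel)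
    \<le> (\<Sum>k. ennreal (unit_ball_vol DIM('a) * 2 ^ DIM('a) * r k powr (real DIM('a) - p)))"
proof -
  have "(\<integral>\<^sup>+z. ennreal (norm z powr - p) * indicator S z \<partial>lborel)
      \<le> (\<integral>\<^sup>+z. (\<Sum>k. ennreal (norm (z::'a) powr - p) * indicator (annulus (r k)) z) \<partial>lborel)"
  proof (rule nn_integral_mono)
    fix z :: 'a
    show "ennreal (norm z powr - p) * indicator S z
        \<le> (\<Sum>k. ennreal (norm z powr - p) * indicator (annulus (r k)) z)"
    proof (cases "z \<in> S \<and> z \<noteq> 0")
      case True
      then obtain k where "z \<in> annulus (r k)" using S by auto
      then have "ennreal (norm z powr - p) * indicator S z
          = (\<Sum>k\<in>{k}. ennreal (norm z powr - p) * indicator (annulus (r k)) z)"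
        using True by simp
      also have "\<dots> \<le> (\<Sum>k. ennreal (norm z powr - p) * indicator (annulus (r k)) z)"
        by (intro sum_le_suminf) auto
      finally show ?thesis .
    qed (auto simp: indicator_def)
  qed
  also have "\<dots> = (\<Sum>k. \<integral>\<^sup>+z. ennreal (norm (z::'a) powr - p) * indicator (annulus (r k)) z \<partial>lborel)"
    by (intro nn_integral_suminf) measurable
  also have "\<dots> \<le> (\<Sum>k. ennreal (unit_ball_vol DIM('a) * 2 ^ DIM('a) * r k powr (real DIM('a) - p)))"
    using r p by (intro suminf_le kernel_annulus_le) auto
  finally show ?thesis .
qed

lemma dyadic_bracket:
  assumes "1 \<le> (x::real)" shows "\<exists>k. 2 ^ k \<le> x \<and> x < 2 * 2 ^ k"
proof -
  obtain m where m: "x < 2 ^ m" using real_arch_pow[of 2 x] by auto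
  define l where "l = (LEAST m. x < 2 ^ m)"
  have l: "x < 2 ^ l" unfolding l_def using m by (rule LeastI)
  then obtain k where k: "l = Suc k" using assms by (cases l) auto
  have "\<not> x < 2 ^ k" using not_less_Least[of k "\<lambda>m. x < 2 ^ m"] k l_def by auto
  with l k show ?thesis by (intro exI[of _ k]) auto
qed

lemma suminf_geometric_ennreal:
  assumes "0 \<le> c" "0 \<le> q" "q < 1"
  shows "(\<Sum>k. ennreal (c * q ^ k)) = ennreal (c / (1 - q))"
  using assms by (subst suminf_ennreal2) (auto simp: suminf_mult suminf_geometric summable_mult)

text \<open>On each dyadic annulus the kernel is comparable to a constant, so the integral over the annulus
of radius \<open>r\<close> is of order \<open>r powr (n - p)\<close>. Summing these bounds gives a geometric series, which
converges away from the origin when \<open>p > n\<close>, and near the origin when \<open>p < n\<close>. Only the dependence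
on the radius matters later, where it makes every estimate scale like a power of the distance.\<close>

lemma kernel_tail_le:
  assumes "real DIM('a) < p"
  obtains C where "0 < C"
    "\<And>R. 0 < R \<Longrightarrow> (\<integral>\<^sup>+z. ennreal (norm (z::'a::euclidean_space) powr - p) * indicator {z. R \<le> norm z} z \<partial>lborel)
      \<le> ennreal (C * R powr (real DIM('a) - p))"
proof
  let ?q = "2 powr (real DIM('a) - p)" and ?V = "unit_ball_vol DIM('a) * 2 ^ DIM('a)"
  have q: "0 < ?q" "?q < 1" using assms by (auto simp: powr_less_one)
  show "0 < ?V / (1 - ?q)" using q by simp
  fix R :: real assume R: "0 < R"
  have cover: "{z. R \<le> norm z} \<subseteq> insert (0::'a) (\<Union>k. annulus (2 ^ k * R))"
  proof
    fix z :: 'a assume "z \<in> {z. R \<le> norm z}"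
    then have "1 \<le> norm z / R" using R by (simp add: field_simps)
    from dyadic_bracket[OF this] obtain k where "2 ^ k \<le> norm z / R" "norm z / R < 2 * 2 ^ k" by auto
    then have "z \<in> annulus (2 ^ k * R)" using R by (simp add: field_simps)
    then show "z \<in> insert (0::'a) (\<Union>k. annulus (2 ^ k * R))" by blast
  qed
  have scale: "(2 ^ k * R) powr (real DIM('a) - p) = R powr (real DIM('a) - p) * ?q ^ k" for k :: nat
    using R by (simp add: powr_mult powr_realpow[symmetric] powr_powr mult.commute)
  have "(\<integral>\<^sup>+z. ennreal (norm (z::'a) powr - p) * indicator {z. R \<le> norm z} z \<partial>lborel)
      \<le> (\<Sum>k. ennreal (?V * (2 ^ k * R) powr (real DIM('a) - p)))"
    using R assms by (intro kernel_dyadic_le cover) auto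
  also have "\<dots> = (\<Sum>k. ennreal ((?V * R powr (real DIM('a) - p)) * ?q ^ k))"
    unfolding scale by (simp add: mult_ac)
  also have "\<dots> = ennreal (?V * R powr (real DIM('a) - p) / (1 - ?q))"
    using q by (intro suminf_geometric_ennreal) auto
  finally show "(\<integral>\<^sup>+z. ennreal (norm (z::'a) powr - p) * indicator {z. R \<le> norm z} z \<partial>lborel)
      \<le> ennreal (?V / (1 - ?q) * R powr (real DIM('a) - p))" by (simp add: field_simps)
qed

lemma kernel_local_finite:
  assumes "0 \<le> p" "p < real DIM('a)" "0 < R"
  shows "(\<integral>\<^sup>+z. ennreal (norm (z::'a::euclidean_space) powr - p) * indicator {z. norm z < R} z \<partial>lborel) < \<infinity>"
proof -
  let ?q = "(1/2) powr (real DIM('a) - p)" and ?V = "unit_ball_vol DIM('a) * 2 ^ DIM('a)"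
  have q: "0 < ?q" "?q < 1" using assms by (auto simp: powr01_less_one)
  have cover: "{z. norm z < R} \<subseteq> insert (0::'a) (\<Union>k. annulus ((1/2) ^ k * R))"
  proof
    fix z :: 'a assume z: "z \<in> {z. norm z < R}"
    show "z \<in> insert (0::'a) (\<Union>k. annulus ((1/2) ^ k * R))"
    proof (cases "z = 0")
      case False
      then have "1 \<le> R / norm z" using z by (simp add: field_simps)
      from dyadic_bracket[OF this] obtain k where k: "2 ^ k \<le> R / norm z" "R / norm z < 2 * 2 ^ k" by auto
      show ?thesis
      proof (cases "2 ^ k = R / norm z")
        case True
        then have "norm z = (1/2) ^ k * R" using False assms by (auto simp: field_simps)
        then have "z \<in> annulus ((1/2) ^ k * R)" using assms by simp
        then show ?thesis by blast
      next
        case False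
        then have "z \<in> annulus ((1/2) ^ Suc k * R)"
          using k \<open>z \<noteq> 0\<close> by (auto simp: field_simps)
        then show ?thesis by blast
      qed
    qed simp
  qed
  have scale: "((1/2) ^ k * R) powr (real DIM('a) - p) = R powr (real DIM('a) - p) * ?q ^ k" for k :: nat
    using assms by (simp add: powr_mult powr_realpow[symmetric] powr_powr powr_power mult.commute)
  have "(\<integral>\<^sup>+z. ennreal (norm (z::'a) powr - p) * indicator {z. norm z < R} z \<partial>lborel)
      \<le> (\<Sum>k. ennreal (?V * ((1/2) ^ k * R) powr (real DIM('a) - p)))"
    using assms by (intro kernel_dyadic_le cover) auto
  also have "\<dots> = (\<Sum>k. ennreal ((?V * R powr (real DIM('a) - p)) * ?q ^ k))"
    unfolding scale by (simp add: mult_ac)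
  also have "\<dots> = ennreal (?V * R powr (real DIM('a) - p) / (1 - ?q))"
    using q by (intro suminf_geometric_ennreal) auto
  finally show ?thesis by (simp add: order_le_less_trans)
qed

lemma kernel_annulus_ge:
  assumes d: "0 < d" and p: "0 \<le> p"
  shows "ennreal (unit_ball_vol DIM('a) * 2 powr - p * d powr (real DIM('a) - p))
    \<le> (\<integral>\<^sup>+z. ennreal (norm (z::'a::euclidean_space) powr - p) * indicator {z. d < norm z \<and> norm z < 2 * d} z \<partial>lborel)"
proof -
  let ?A = "ball (0::'a) (2 * d) - cball 0 d"
  let ?V = "unit_ball_vol (real DIM('a))"
  have "emeasure lborel ?A = ennreal (?V * (2 * d) ^ DIM('a)) - ennreal (?V * d ^ DIM('a))"
    using d by (subst emeasure_Diff) (auto simp: emeasure_ball emeasure_cball)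
  also have "\<dots> = ennreal (?V * (2 * d) ^ DIM('a) - ?V * d ^ DIM('a))"
    using d by (simp add: ennreal_minus)
  also have "\<dots> \<ge> ennreal (?V * d ^ DIM('a))"
  proof (rule ennreal_leI)
    have "2 ^ 1 \<le> (2::real) ^ DIM('a)" by (intro power_increasing) (auto simp: Suc_leI)
    then have "d ^ DIM('a) \<le> (2 ^ DIM('a) - 1) * d ^ DIM('a)" using d by simp
    then have "?V * d ^ DIM('a) \<le> ?V * ((2 ^ DIM('a) - 1) * d ^ DIM('a))" by (intro mult_left_mono) auto
    then show "?V * d ^ DIM('a) \<le> ?V * (2 * d) ^ DIM('a) - ?V * d ^ DIM('a)"
      by (simp add: algebra_simps)
  qed
  finally have vol: "ennreal (?V * d ^ DIM('a)) \<le> emeasure lborel ?A" .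
  have "?V * 2 powr - p * d powr (real DIM('a) - p) = (2 * d) powr - p * (?V * d ^ DIM('a))"
    using d by (simp add: powr_mult powr_diff powr_minus powr_realpow field_simps)
  then have "ennreal (?V * 2 powr - p * d powr (real DIM('a) - p))
      = ennreal ((2 * d) powr - p) * ennreal (?V * d ^ DIM('a))"
    by (simp only: ennreal_mult' powr_ge_zero)
  also have "\<dots> \<le> ennreal ((2 * d) powr - p) * emeasure lborel ?A"
    using vol by (rule mult_left_mono) simp
  also have "\<dots> = (\<integral>\<^sup>+z. ennreal ((2 * d) powr - p) * indicator ?A z \<partial>lborel)"
    by (simp add: nn_integral_cmult_indicator)
  also have "\<dots> \<le> (\<integral>\<^sup>+z. ennreal (norm (z::'a) powr - p) * indicator {z. d < norm z \<and> norm z < 2 * d} z \<partial>lborel)"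
    using d p by (intro nn_integral_mono) (auto simp: indicator_def intro!: ennreal_leI powr_mono2')
  finally show ?thesis .
qed

lemma nn_integral_translate:
  fixes f :: "'a::euclidean_space \<Rightarrow> ennreal"
  assumes [measurable]: "f \<in> borel_measurable borel"
  shows "(\<integral>\<^sup>+x. f (c + x) \<partial>lborel) = (\<integral>\<^sup>+x. f x \<partial>lborel)"
proof -
  have "(\<integral>\<^sup>+x. f x \<partial>lborel) = (\<integral>\<^sup>+x. f x \<partial>distr lborel borel ((+) c))"
    by (simp add: lborel_distr_plus)
  also have "\<dots> = (\<integral>\<^sup>+x. f (c + x) \<partial>lborel)" by (subst nn_integral_distr) auto
  finally show ?thesis by simp
qed

lemma lborel_distr_reflect: "distr lborel borel (\<lambda>y. c - y) = (lborel :: 'a::euclidean_space measure)"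
  by (subst (2) lborel_affine[of "-1" c]) (auto simp: density_1)

lemma nn_integral_reflect:
  fixes f :: "'a::euclidean_space \<Rightarrow> ennreal"
  assumes [measurable]: "f \<in> borel_measurable borel"
  shows "(\<integral>\<^sup>+x. f (c - x) \<partial>lborel) = (\<integral>\<^sup>+x. f x \<partial>lborel)"
proof -
  have "(\<integral>\<^sup>+x. f x \<partial>lborel) = (\<integral>\<^sup>+x. f x \<partial>distr lborel borel (\<lambda>x. c - x))"
    by (simp add: lborel_distr_reflect)
  also have "\<dots> = (\<integral>\<^sup>+x. f (c - x) \<partial>lborel)" by (subst nn_integral_distr) auto
  finally show ?thesis by simp
qed

section \<open>A fractional Hardy inequality on Lipschitz domains\<close>

subsection \<open>Boundary charts\<close>

definition boundary_layer :: "'a::metric_space set \<Rightarrow> real \<Rightarrow> 'a set" where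
  "boundary_layer \<Omega> \<delta> = {x \<in> \<Omega>. \<exists>y. y \<notin> \<Omega> \<and> dist x y < \<delta>}"

lemma open_boundary_layer: "open \<Omega> \<Longrightarrow> open (boundary_layer \<Omega> \<delta>)"
proof -
  assume "open \<Omega>"
  moreover have "boundary_layer \<Omega> \<delta> = \<Omega> \<inter> (\<Union>y\<in>-\<Omega>. ball y \<delta>)"
    by (auto simp: boundary_layer_def dist_commute)
  ultimately show ?thesis by auto
qed

lemma boundary_layer_subset: "boundary_layer \<Omega> \<delta> \<subseteq> \<Omega>"
  by (auto simp: boundary_layer_def)

lemma boundary_layer_mono: "\<delta> \<le> \<epsilon> \<Longrightarrow> boundary_layer \<Omega> \<delta> \<subseteq> boundary_layer \<Omega> \<epsilon>"
  by (force simp: boundary_layer_def)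

text \<open>The function \<open>\<rho>\<close> is the height below the graph, measured in the fixed direction \<open>e\<close>. It replaces the
distance to the boundary: it is Lipschitz, hence bounded by a multiple of that distance, and it
increases at unit speed along inward translation, which the distance does not. Asking for the
description of \<open>\<Omega>\<close> on balls of one common radius \<open>r\<close> around all points of \<open>U\<close> lets points of \<open>U\<close> be
translated by a fixed amount without leaving the chart.\<close>

definition boundary_chart ::
  "'a::euclidean_space set \<Rightarrow> real \<Rightarrow> real \<Rightarrow> 'a set \<Rightarrow> 'a \<Rightarrow> ('a \<Rightarrow> real) \<Rightarrow> bool" where
  "boundary_chart \<Omega> L r U e \<rho> \<longleftrightarrow>
     norm e = 1 \<and> (\<forall>x y. \<bar>\<rho> x - \<rho> y\<bar> \<le> L * dist x y) \<and> (\<forall>x t. \<rho> (x - t *\<^sub>R e) = \<rho> x + t) \<and>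
     open U \<and> (\<forall>x\<in>U. \<forall>y\<in>ball x r. y \<in> \<Omega> \<longleftrightarrow> 0 < \<rho> y)"

lemma boundary_chart_mono:
  assumes "boundary_chart \<Omega> L r U e \<rho>" "L \<le> L'" "r' \<le> r"
  shows "boundary_chart \<Omega> L' r' U e \<rho>"
proof -
  have "L * dist x y \<le> L' * dist x y" for x y using assms(2) by (intro mult_right_mono) auto
  then show ?thesis using assms unfolding boundary_chart_def
    by (smt (verit) mem_ball)
qed

lemma lipschitz_boundary_chart_at:
  assumes "lipschitz_boundary \<Omega>" "p \<in> frontier \<Omega>"
  obtains L r U e \<rho> where "0 < r" "p \<in> U" "boundary_chart \<Omega> L r U e \<rho>"
proof -
  obtain r e \<gamma> L where r: "0 < r" and e: "norm e = 1"
    and \<gamma>: "L-lipschitz_on {w. w \<bullet> e = 0} \<gamma>"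
    and \<Omega>: "\<Omega> \<inter> ball p r = {x \<in> ball p r. x \<bullet> e < \<gamma> (x - (x \<bullet> e) *\<^sub>R e)}"
    using assms unfolding lipschitz_boundary_def by blast
  define pr where "pr x = x - (x \<bullet> e) *\<^sub>R e" for x
  \<comment> \<open>The Lipschitz constant of this height is one more than that of the graph.\<close>
  define \<rho> where "\<rho> x = \<gamma> (pr x) - x \<bullet> e" for x
  have ee: "e \<bullet> e = 1" using e by (simp add: norm_eq_1)
  have pr_diff: "pr x - pr y = pr (x - y)" for x y by (simp add: pr_def inner_diff_left algebra_simps)
  have pr_orth: "pr x \<bullet> e = 0" for x by (simp add: pr_def inner_diff_left ee)
  have pr_norm: "norm (pr x) \<le> norm x" for x
  proof -
    have "pr x \<bullet> pr x = x \<bullet> x - (x \<bullet> e)\<^sup>2"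
      by (simp add: pr_def inner_diff_left inner_diff_right ee inner_commute power2_eq_square)
    then have "pr x \<bullet> pr x \<le> x \<bullet> x" by simp
    then show ?thesis by (simp add: norm_le)
  qed
  have L0: "0 \<le> L" using \<gamma> by (rule lipschitz_on_nonneg)
  have lip: "\<bar>\<rho> x - \<rho> y\<bar> \<le> (L + 1) * dist x y" for x y
  proof -
    have "\<bar>\<gamma> (pr x) - \<gamma> (pr y)\<bar> \<le> L * dist (pr x) (pr y)"
      using lipschitz_onD[OF \<gamma>, of "pr x" "pr y"] pr_orth by (simp add: dist_real_def)
    also have "\<dots> \<le> L * dist x y" using L0 pr_norm[of "x - y"] pr_diff[of x y]
      by (intro mult_left_mono) (auto simp: dist_norm)
    finally have 1: "\<bar>\<gamma> (pr x) - \<gamma> (pr y)\<bar> \<le> L * dist x y" .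
    have "\<bar>(x - y) \<bullet> e\<bar> \<le> norm (x - y) * norm e" by (rule Cauchy_Schwarz_ineq2)
    then have 2: "\<bar>x \<bullet> e - y \<bullet> e\<bar> \<le> dist x y" using e by (simp add: inner_diff_left dist_norm)
    show ?thesis using 1 2 unfolding \<rho>_def by (simp add: algebra_simps)
  qed
  have shift: "\<rho> (x - t *\<^sub>R e) = \<rho> x + t" for x t
  proof -
    have "pr (x - t *\<^sub>R e) = pr x" by (simp add: pr_def inner_diff_left ee algebra_simps)
    then show ?thesis by (simp add: \<rho>_def inner_diff_left ee)
  qed
  have "y \<in> \<Omega> \<longleftrightarrow> 0 < \<rho> y" if "x \<in> ball p (r/2)" "y \<in> ball x (r/2)" for x y
  proof -
    have "y \<in> ball p r" using that dist_triangle[of p y x] by simp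
    then have "y \<in> \<Omega> \<longleftrightarrow> y \<bullet> e < \<gamma> (y - (y \<bullet> e) *\<^sub>R e)" using \<Omega> by blast
    then show ?thesis by (simp add: \<rho>_def pr_def)
  qed
  then have "boundary_chart \<Omega> (L + 1) (r/2) (ball p (r/2)) e \<rho>"
    unfolding boundary_chart_def using e lip shift by blast
  then show ?thesis using that[of "r/2" "ball p (r/2)"] r by simp
qed

text \<open>Compactness of the boundary yields finitely many charts, so that one Lipschitz constant and one
radius serve for all of them. What the charts leave uncovered is a compact part of \<open>\<Omega>\<close>, at
positive distance from the complement, so a thin boundary layer is covered.\<close>

lemma finite_boundary_atlas:
  fixes \<Omega> :: "'a::euclidean_space set"
  assumes "bounded \<Omega>" "open \<Omega>" "lipschitz_boundary \<Omega>"
  obtains C :: "'a set" and L r U e \<rho> \<delta>\<^sub>0 where "finite C" "1 \<le> L" "0 < r" "0 < \<delta>\<^sub>0"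
    "\<And>c. c \<in> C \<Longrightarrow> boundary_chart \<Omega> L r (U c) (e c) (\<rho> c)"
    "boundary_layer \<Omega> \<delta>\<^sub>0 \<subseteq> (\<Union>c\<in>C. U c)"
proof -
  have "\<forall>p\<in>frontier \<Omega>. \<exists>L r U e \<rho>. 0 < r \<and> p \<in> U \<and> boundary_chart \<Omega> L r U e \<rho>"
    using lipschitz_boundary_chart_at[OF assms(3)] by metis
  then obtain L r U e \<rho> where ch:
    "\<And>p. p \<in> frontier \<Omega> \<Longrightarrow> 0 < r p \<and> p \<in> U p \<and> boundary_chart \<Omega> (L p) (r p) (U p) (e p) (\<rho> p)"
    by metis
  have cpt: "compact (frontier \<Omega>)" using assms(1) by (simp add: compact_frontier_bounded)
  obtain C where C: "C \<subseteq> frontier \<Omega>" "finite C" "frontier \<Omega> \<subseteq> (\<Union>c\<in>C. U c)"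
    using compactE_image[OF cpt, of "frontier \<Omega>" U] ch unfolding boundary_chart_def by blast
  define V where "V = (\<Union>c\<in>C. U c)"
  have V: "open V" unfolding V_def using ch C(1) by (intro open_UN) (auto simp: boundary_chart_def)
  have cl: "compact (closure \<Omega> - V)" using assms(1) V
    by (intro compact_diff) (auto simp: compact_closure)
  moreover have "(closure \<Omega> - V) \<inter> (- \<Omega>) = {}"
    using C(3) assms(2) by (auto simp: V_def frontier_def interior_open)
  ultimately obtain \<delta>\<^sub>0 where \<delta>\<^sub>0: "0 < \<delta>\<^sub>0" "\<And>x y. x \<in> closure \<Omega> - V \<Longrightarrow> y \<in> - \<Omega> \<Longrightarrow> \<delta>\<^sub>0 \<le> dist x y"
    using separate_compact_closed[of "closure \<Omega> - V" "- \<Omega>"] assms(2) by blast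
  define L' where "L' = Max (insert 1 (L ` C))"
  define r' where "r' = Min (insert 1 (r ` C))"
  have L': "1 \<le> L'" "\<And>c. c \<in> C \<Longrightarrow> L c \<le> L'" using C(2) by (auto simp: L'_def)
  have r': "0 < r'" "\<And>c. c \<in> C \<Longrightarrow> r' \<le> r c" using C ch by (auto simp: r'_def)
  show ?thesis
  proof (rule that)
    show "boundary_chart \<Omega> L' r' (U c) (e c) (\<rho> c)" if "c \<in> C" for c
      using ch[of c] that C(1) L'(2)[OF that] r'(2)[OF that] boundary_chart_mono by blast
    show "boundary_layer \<Omega> \<delta>\<^sub>0 \<subseteq> (\<Union>c\<in>C. U c)"
    proof
      fix x assume "x \<in> boundary_layer \<Omega> \<delta>\<^sub>0"
      then obtain y where "x \<in> \<Omega>" "y \<notin> \<Omega>" "dist x y < \<delta>\<^sub>0" by (auto simp: boundary_layer_def)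
      then have "x \<in> V" using \<delta>\<^sub>0(2)[of x y] closure_subset[of \<Omega>] by force
      then show "x \<in> (\<Union>c\<in>C. U c)" by (simp add: V_def)
    qed
  qed (use C L' r' \<delta>\<^sub>0 in auto)
qed

subsection \<open>Comparing a layer with its inward translates\<close>

text \<open>The Gagliardo energy with exponent \<open>p\<close>, restricted to pairs of points whose distance lies in \<open>T\<close>;
the whole seminorm is the case \<open>T = UNIV\<close>.\<close>

definition ring_energy ::
  "'a::euclidean_space set \<Rightarrow> real \<Rightarrow> ('a \<Rightarrow> real) \<Rightarrow> real set \<Rightarrow> ennreal" where
  "ring_energy \<Omega> p u T = (\<integral>\<^sup>+x. \<integral>\<^sup>+y. ennreal (\<bar>u x - u y\<bar> * norm (x - y) powr - p) *
     (indicator \<Omega> x * indicator \<Omega> y * indicator T (norm (x - y))) \<partial>lborel \<partial>lborel)"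

text \<open>The basic geometric fact. A point of the layer of width \<open>\<delta>\<close> has height between \<open>0\<close> and \<open>h = L * \<delta>\<close>.
Translating it inward by \<open>2 * j * h\<close> moves this range of heights by the same amount, and a further
perturbation by less than \<open>\<delta> / 2\<close> changes heights by less than \<open>h / 2\<close>. The resulting intervals of
heights have length \<open>2 * h\<close> and are therefore disjoint for different \<open>j\<close>. The perturbation is
needed because the Gagliardo energy sees only averages over balls, not single differences.\<close>

lemma inward_translate_in_layer:
  fixes \<Omega> :: "'a::euclidean_space set" and N j :: nat
  assumes ch: "boundary_chart \<Omega> L r U e \<rho>" and L: "1 \<le> L" and \<delta>: "0 < \<delta>"
    and small: "(2 * real N + 2) * L * \<delta> \<le> r" and j: "1 \<le> j" "j \<le> N"
    and x: "x \<in> U" "x \<in> boundary_layer \<Omega> \<delta>" and w: "norm w < \<delta> / 2"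
  defines "y \<equiv> x - (2 * real j * (L * \<delta>)) *\<^sub>R e + w"
  shows "y \<in> boundary_layer \<Omega> ((2 * real N + 2) * L * \<delta>)"
    and "L * \<delta> \<le> norm (x - y)" and "norm (x - y) \<le> (2 * real N + 1) * (L * \<delta>)"
    and "\<rho> y \<in> {2 * real j * (L * \<delta>) - L * \<delta> / 2 <..< 2 * real j * (L * \<delta>) + 3 * (L * \<delta>) / 2}"
proof -
  define h where "h = L * \<delta>"
  have h: "\<delta> \<le> h" "0 < h" using L \<delta> by (auto simp: h_def)
  have e: "norm e = 1" and lip: "\<And>x y. \<bar>\<rho> x - \<rho> y\<bar> \<le> L * dist x y"
    and shift: "\<And>x t. \<rho> (x - t *\<^sub>R e) = \<rho> x + t"
    and gr: "\<And>z. z \<in> ball x r \<Longrightarrow> z \<in> \<Omega> \<longleftrightarrow> 0 < \<rho> z"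
    using ch x(1) unfolding boundary_chart_def by auto
  have jh: "2 * h \<le> 2 * real j * h" "2 * real j * h \<le> 2 * real N * h" using j h by auto
  have small': "(2 * real N + 2) * h \<le> r" using small by (simp add: h_def mult_ac)
  have "2 * h \<le> (2 * real N + 2) * h" using h by (intro mult_right_mono) auto
  then have rh: "2 * h \<le> r" using small' by simp
  obtain z where z: "x \<in> \<Omega>" "z \<notin> \<Omega>" "dist x z < \<delta>" using x by (auto simp: boundary_layer_def)
  have "\<rho> z \<le> 0" using gr[of z] z h rh by (simp add: not_less)
  moreover have "\<bar>\<rho> x - \<rho> z\<bar> < h" using lip[of x z] z(3) L
    by (smt (verit) h_def mult_strict_left_mono)
  ultimately have \<rho>x: "\<rho> x < h" "0 < \<rho> x" using gr[of x] z h rh by auto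
  have "\<bar>\<rho> y - \<rho> (x - (2 * real j * h) *\<^sub>R e)\<bar> \<le> L * norm w"
    using lip[of y "x - (2 * real j * h) *\<^sub>R e"] by (simp add: y_def h_def dist_norm)
  also have "L * norm w < L * (\<delta> / 2)" using w L by (intro mult_strict_left_mono) auto
  also have "\<dots> = h / 2" by (simp add: h_def)
  finally have \<rho>y: "\<bar>\<rho> y - (\<rho> x + 2 * real j * h)\<bar> < h / 2" by (simp add: shift)
  then show "\<rho> y \<in> {2 * real j * (L * \<delta>) - L * \<delta> / 2 <..< 2 * real j * (L * \<delta>) + 3 * (L * \<delta>) / 2}"
    using \<rho>x unfolding h_def[symmetric] greaterThanLessThan_iff by linarith
  have xy: "x - y = (2 * real j * h) *\<^sub>R e - w" by (simp add: y_def h_def)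
  have nt: "norm ((2 * real j * h) *\<^sub>R e) = 2 * real j * h" using e h by simp
  have lo: "h \<le> norm (x - y)" using norm_triangle_ineq2[of "(2 * real j * h) *\<^sub>R e" w] nt w h jh
    unfolding xy by linarith
  then show "L * \<delta> \<le> norm (x - y)" by (simp add: h_def)
  have up: "norm (x - y) \<le> 2 * real N * h + h"
    using norm_triangle_ineq4[of "(2 * real j * h) *\<^sub>R e" w] nt w h jh unfolding xy by linarith
  then show "norm (x - y) \<le> (2 * real N + 1) * (L * \<delta>)" by (simp add: h_def algebra_simps)
  have "dist x y < r" using up small' h by (simp add: dist_norm algebra_simps)
  moreover have "0 < \<rho> y" using \<rho>y \<rho>x jh h by linarith
  ultimately have "y \<in> \<Omega>" using gr[of y] by simp
  moreover have "dist y z < 2 * real N * h + 2 * h"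
    using dist_triangle[of y z x] up z(3) h by (simp add: dist_norm norm_minus_commute)
  ultimately show "y \<in> boundary_layer \<Omega> ((2 * real N + 2) * L * \<delta>)"
    using z(2) by (auto simp: boundary_layer_def h_def algebra_simps)
qed

lemma sum_of_bool_exclusive_le:
  assumes "finite J" "\<And>j k. j \<in> J \<Longrightarrow> k \<in> J \<Longrightarrow> P j \<Longrightarrow> P k \<Longrightarrow> j = k" "\<And>j. j \<in> J \<Longrightarrow> P j \<Longrightarrow> Q"
  shows "(\<Sum>j\<in>J. of_bool (P j) :: ennreal) \<le> of_bool Q"
proof (cases "\<exists>j\<in>J. P j")
  case True
  then obtain j where j: "j \<in> J" "P j" by blast
  have "(\<Sum>j\<in>J. of_bool (P j) :: ennreal) = (\<Sum>i\<in>J. if i = j then 1 else 0)"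
    using j assms(2) by (intro sum.cong) auto
  then show ?thesis using j assms(1) assms(3)[OF j] by simp
qed auto

text \<open>The translates of the layer are disjoint and all lie in a layer that is wider by a factor
proportional to their number. So the mass of \<open>N\<close> translates is at most the mass of the wider layer,
which is where the gain \<open>1 / N\<close> in the Hardy inequality comes from.\<close>

lemma translates_mass_le:
  fixes \<Omega> :: "'a::euclidean_space set" and N :: nat
  assumes ch: "boundary_chart \<Omega> L r U e \<rho>" and L: "1 \<le> L" and \<delta>: "0 < \<delta>"
    and \<Omega>: "open \<Omega>" and small: "(2 * real N + 2) * L * \<delta> \<le> r"
    and u[measurable]: "u \<in> borel_measurable borel" and w: "norm w < \<delta> / 2"
  defines "S \<equiv> U \<inter> boundary_layer \<Omega> \<delta>"
  shows "(\<Sum>j=1..N. \<integral>\<^sup>+x. ennreal \<bar>u (x - (2 * real j * (L * \<delta>)) *\<^sub>R e + w)\<bar> * indicator S x \<partial>lborel)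
    \<le> (\<integral>\<^sup>+x. ennreal \<bar>u x\<bar> * indicator (boundary_layer \<Omega> ((2 * real N + 2) * L * \<delta>)) x \<partial>lborel)"
proof -
  let ?B = "boundary_layer \<Omega> ((2 * real N + 2) * L * \<delta>)"
  define \<tau> where "\<tau> j = w - (2 * real j * (L * \<delta>)) *\<^sub>R e" for j :: nat
  have "open U" using ch by (simp add: boundary_chart_def)
  then have [measurable]: "S \<in> sets borel" "?B \<in> sets borel"
    unfolding S_def using \<Omega> open_boundary_layer[OF \<Omega>] by (auto intro!: borel_open)
  have "(\<integral>\<^sup>+x. ennreal \<bar>u (x - (2 * real j * (L * \<delta>)) *\<^sub>R e + w)\<bar> * indicator S x \<partial>lborel)
      = (\<integral>\<^sup>+y. ennreal \<bar>u y\<bar> * indicator S (y - \<tau> j) \<partial>lborel)" for j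
  proof -
    have "(\<integral>\<^sup>+x. ennreal \<bar>u (\<tau> j + x)\<bar> * indicator S ((\<tau> j + x) - \<tau> j) \<partial>lborel)
        = (\<integral>\<^sup>+y. ennreal \<bar>u y\<bar> * indicator S (y - \<tau> j) \<partial>lborel)"
      by (rule nn_integral_translate) measurable
    then show ?thesis by (simp add: \<tau>_def algebra_simps)
  qed
  then have "(\<Sum>j=1..N. \<integral>\<^sup>+x. ennreal \<bar>u (x - (2 * real j * (L * \<delta>)) *\<^sub>R e + w)\<bar> * indicator S x \<partial>lborel)
      = (\<integral>\<^sup>+y. (\<Sum>j=1..N. ennreal \<bar>u y\<bar> * indicator S (y - \<tau> j)) \<partial>lborel)"
    by (subst nn_integral_sum) auto
  also have "\<dots> \<le> (\<integral>\<^sup>+y. ennreal \<bar>u y\<bar> * indicator ?B y \<partial>lborel)"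
  proof (rule nn_integral_mono)
    fix y :: 'a
    have geo: "y \<in> ?B \<and> \<rho> y \<in> {2 * real j * (L * \<delta>) - L * \<delta> / 2 <..< 2 * real j * (L * \<delta>) + 3 * (L * \<delta>) / 2}"
      if "j \<in> {1..N}" "y - \<tau> j \<in> S" for j
      using inward_translate_in_layer[OF ch L \<delta> small, of j "y - \<tau> j" w] that w
      by (auto simp: S_def \<tau>_def algebra_simps)
    \<comment> \<open>The heights of the translates lie in disjoint intervals, so \<open>y\<close> belongs to at most one.\<close>
    have "j = k" if jk: "j \<in> {1..N}" "k \<in> {1..N}" "y - \<tau> j \<in> S" "y - \<tau> k \<in> S" for j k
    proof -
      have no: "\<not> i < l" if "i \<in> {1..N}" "l \<in> {1..N}" "y - \<tau> i \<in> S" "y - \<tau> l \<in> S" for i l :: nat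
      proof
        assume "i < l"
        then have "real i + 1 \<le> real l" by simp
        then have "2 * (real i + 1) * (L * \<delta>) \<le> 2 * real l * (L * \<delta>)"
          using L \<delta> by (intro mult_right_mono) auto
        then show False using geo[of i] geo[of l] that by (auto simp: algebra_simps)
      qed
      show ?thesis using no[of j k] no[of k j] jk by auto
    qed
    then have "(\<Sum>j=1..N. of_bool (y - \<tau> j \<in> S) :: ennreal) \<le> of_bool (y \<in> ?B)"
      using geo by (intro sum_of_bool_exclusive_le) auto
    then have "(\<Sum>j=1..N. indicator S (y - \<tau> j) :: ennreal) \<le> indicator ?B y"
      by (simp add: indicator_def of_bool_def)
    then show "(\<Sum>j=1..N. ennreal \<bar>u y\<bar> * indicator S (y - \<tau> j)) \<le> ennreal \<bar>u y\<bar> * indicator ?B y"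
      by (simp only: sum_distrib_left[symmetric] mult_left_mono zero_le)
  qed
  finally show ?thesis .
qed

text \<open>The pairs compared here are at distance comparable to \<open>\<delta>\<close>, so the kernel can be inserted at the
cost of the constant \<open>((2 * N + 1) * L * \<delta>) powr p\<close>. Integrating over the perturbation \<open>w\<close> turns the
difference with a translate into the double integral of the Gagliardo energy.\<close>

lemma translates_difference_le:
  fixes \<Omega> :: "'a::euclidean_space set" and N j :: nat
  assumes ch: "boundary_chart \<Omega> L r U e \<rho>" and L: "1 \<le> L" and \<delta>: "0 < \<delta>" and p: "0 \<le> p"
    and \<Omega>: "open \<Omega>" and small: "(2 * real N + 2) * L * \<delta> \<le> r" and j: "j \<in> {1..N}"
    and u[measurable]: "u \<in> borel_measurable borel"
  defines "S \<equiv> U \<inter> boundary_layer \<Omega> \<delta>"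
  shows "(\<integral>\<^sup>+w. (\<integral>\<^sup>+x. ennreal \<bar>u x - u (x - (2 * real j * (L * \<delta>)) *\<^sub>R e + w)\<bar> * indicator S x \<partial>lborel)
      * indicator (ball 0 (\<delta>/2)) w \<partial>lborel)
    \<le> ennreal (((2 * real N + 1) * (L * \<delta>)) powr p) *
       ring_energy \<Omega> p u {L * \<delta> .. (2 * real N + 1) * (L * \<delta>)}"
proof -
  define \<tau> where "\<tau> = - ((2 * real j * (L * \<delta>)) *\<^sub>R e)"
  let ?T = "{L * \<delta> .. (2 * real N + 1) * (L * \<delta>)}"
  let ?K = "((2 * real N + 1) * (L * \<delta>)) powr p"
  define F where "F x y = ennreal ?K * (ennreal (\<bar>u x - u y\<bar> * norm (x - y) powr - p) *
     (indicator \<Omega> x * indicator \<Omega> y * indicator ?T (norm (x - y))))" for x y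
  have "open U" using ch by (simp add: boundary_chart_def)
  then have [measurable]: "S \<in> sets borel" "\<Omega> \<in> sets borel"
    unfolding S_def using \<Omega> open_boundary_layer[OF \<Omega>] by (auto intro!: borel_open)
  have F[measurable]: "case_prod F \<in> borel_measurable (borel \<Otimes>\<^sub>M borel)"
    unfolding F_def by measurable
  have le: "ennreal \<bar>u x - u (x + \<tau> + w)\<bar> * indicator S x * indicator (ball 0 (\<delta>/2)) w
      \<le> F x (x + \<tau> + w)" for x w
  proof (cases "x \<in> S \<and> norm w < \<delta> / 2")
    case True
    let ?y = "x + \<tau> + w"
    have y: "?y \<in> boundary_layer \<Omega> ((2 * real N + 2) * L * \<delta>)"
      and d: "L * \<delta> \<le> norm (x - ?y)" "norm (x - ?y) \<le> (2 * real N + 1) * (L * \<delta>)"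
      using inward_translate_in_layer(1-3)[OF ch L \<delta> small, of j x w] True j
      by (auto simp: S_def \<tau>_def)
    have pos: "0 < norm (x - ?y)" using d L \<delta> by (smt (verit) mult_pos_pos)
    have "1 = norm (x - ?y) powr p * norm (x - ?y) powr - p"
      using pos by (simp add: powr_add[symmetric])
    also have "\<dots> \<le> ?K * norm (x - ?y) powr - p"
      using d p by (intro mult_right_mono powr_mono2) auto
    finally have "\<bar>u x - u ?y\<bar> * 1 \<le> \<bar>u x - u ?y\<bar> * (?K * norm (x - ?y) powr - p)"
      by (rule mult_left_mono) simp
    then have "ennreal \<bar>u x - u ?y\<bar> \<le> ennreal (?K * (\<bar>u x - u ?y\<bar> * norm (x - ?y) powr - p))"
      by (intro ennreal_leI) (simp add: mult_ac)
    also have "\<dots> = F x ?y"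
      using y d boundary_layer_subset[of \<Omega>] True
      by (auto simp: F_def S_def ennreal_mult' indicator_def)
    finally show ?thesis using True by (simp add: indicator_def)
  qed (auto simp: indicator_def)
  have "(\<integral>\<^sup>+w. (\<integral>\<^sup>+x. ennreal \<bar>u x - u (x + \<tau> + w)\<bar> * indicator S x \<partial>lborel)
      * indicator (ball 0 (\<delta>/2)) w \<partial>lborel) =
     (\<integral>\<^sup>+w. (\<integral>\<^sup>+x. ennreal \<bar>u x - u (x + \<tau> + w)\<bar> * indicator S x * indicator (ball 0 (\<delta>/2)) w \<partial>lborel) \<partial>lborel)"
    by (intro nn_integral_cong nn_integral_multc[symmetric]) measurable
  also have "\<dots> \<le> (\<integral>\<^sup>+w. (\<integral>\<^sup>+x. F x (x + \<tau> + w) \<partial>lborel) \<partial>lborel)"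
    by (intro nn_integral_mono le)
  also have "\<dots> = (\<integral>\<^sup>+x. (\<integral>\<^sup>+w. F x (x + \<tau> + w) \<partial>lborel) \<partial>lborel)"
    by (rule lborel_pair.Fubini') measurable
  also have "\<dots> = (\<integral>\<^sup>+x. (\<integral>\<^sup>+y. F x y \<partial>lborel) \<partial>lborel)"
    by (intro nn_integral_cong nn_integral_translate) measurable
  also have "\<dots> = ennreal ?K * ring_energy \<Omega> p u ?T"
    unfolding F_def ring_energy_def by (simp add: nn_integral_cmult)
  finally show ?thesis by (simp add: \<tau>_def)
qed

text \<open>The triangle inequality \<open>\<bar>u x\<bar> \<le> \<bar>u y\<bar> + \<bar>u x - u y\<bar>\<close>, with \<open>y\<close> running over the perturbed translates
of \<open>x\<close>, summed over the \<open>N\<close> translates and averaged over the ball of perturbations.\<close>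

lemma chart_layer_mass_le:
  fixes \<Omega> :: "'a::euclidean_space set" and N :: nat
  assumes ch: "boundary_chart \<Omega> L r U e \<rho>" and L: "1 \<le> L" and \<delta>: "0 < \<delta>" and p: "0 \<le> p"
    and \<Omega>: "open \<Omega>" and small: "(2 * real N + 2) * L * \<delta> \<le> r" and N: "1 \<le> N"
    and u[measurable]: "u \<in> borel_measurable borel"
  shows "(\<integral>\<^sup>+x. ennreal \<bar>u x\<bar> * indicator (U \<inter> boundary_layer \<Omega> \<delta>) x \<partial>lborel)
    \<le> ennreal (1 / real N) *
        (\<integral>\<^sup>+x. ennreal \<bar>u x\<bar> * indicator (boundary_layer \<Omega> ((2 * real N + 2) * L * \<delta>)) x \<partial>lborel)
      + ennreal (((2 * real N + 1) * L) powr p * 2 ^ DIM('a) / unit_ball_vol DIM('a)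
          * \<delta> powr (p - real DIM('a))) *
        ring_energy \<Omega> p u {L * \<delta> .. (2 * real N + 1) * (L * \<delta>)}"
proof -
  define S where "S = U \<inter> boundary_layer \<Omega> \<delta>"
  let ?B = "boundary_layer \<Omega> ((2 * real N + 2) * L * \<delta>)"
  let ?G = "ring_energy \<Omega> p u {L * \<delta> .. (2 * real N + 1) * (L * \<delta>)}"
  let ?K = "((2 * real N + 1) * (L * \<delta>)) powr p"
  define \<beta> where "\<beta> = unit_ball_vol (real DIM('a)) * (\<delta>/2) ^ DIM('a)"
  have \<beta>: "0 < \<beta>" using \<delta> by (simp add: \<beta>_def)
  have vol: "emeasure lborel (ball (0::'a) (\<delta>/2)) = ennreal \<beta>" using \<delta> by (simp add: emeasure_ball \<beta>_def)
  define m where "m = (\<integral>\<^sup>+x. ennreal \<bar>u x\<bar> * indicator S x \<partial>lborel)"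
  define m' where "m' = (\<integral>\<^sup>+x. ennreal \<bar>u x\<bar> * indicator ?B x \<partial>lborel)"
  define y where "y j w x = x - (2 * real j * (L * \<delta>)) *\<^sub>R e + w" for j :: nat and w x :: 'a
  define A where "A j w = (\<integral>\<^sup>+x. ennreal \<bar>u (y j w x)\<bar> * indicator S x \<partial>lborel)" for j w
  define D where "D j w = (\<integral>\<^sup>+x. ennreal \<bar>u x - u (y j w x)\<bar> * indicator S x \<partial>lborel)" for j w
  have "open U" using ch by (simp add: boundary_chart_def)
  then have [measurable]: "S \<in> sets borel" "?B \<in> sets borel"
    unfolding S_def using \<Omega> open_boundary_layer[OF \<Omega>] by (auto intro!: borel_open)
  have [measurable]: "ball (0::'a) (\<delta>/2) \<in> sets borel" by simp
  have D_meas[measurable]: "D j \<in> borel_measurable borel" for j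
    unfolding D_def y_def by measurable
  have split: "of_nat N * m \<le> m' + (\<Sum>j=1..N. D j w)" if w: "norm w < \<delta> / 2" for w
  proof -
    have "m \<le> A j w + D j w" for j
    proof -
      have "m \<le> (\<integral>\<^sup>+x. ennreal \<bar>u (y j w x)\<bar> * indicator S x + ennreal \<bar>u x - u (y j w x)\<bar> * indicator S x \<partial>lborel)"
        unfolding m_def by (intro nn_integral_mono)
          (auto simp: indicator_def ennreal_plus[symmetric] simp del: ennreal_plus intro!: ennreal_leI)
      also have "\<dots> = A j w + D j w"
        unfolding A_def D_def y_def by (intro nn_integral_add) measurable
      finally show ?thesis .
    qed
    then have "(\<Sum>j=1..N. m) \<le> (\<Sum>j=1..N. A j w + D j w)" by (intro sum_mono)
    also have "\<dots> = (\<Sum>j=1..N. A j w) + (\<Sum>j=1..N. D j w)" by (rule sum.distrib)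
    also have "(\<Sum>j=1..N. A j w) \<le> m'"
      unfolding A_def m'_def y_def S_def by (rule translates_mass_le[OF ch L \<delta> \<Omega> small u w])
    finally show ?thesis by (simp add: add_right_mono)
  qed
  have "of_nat N * m * ennreal \<beta> = (\<integral>\<^sup>+w. of_nat N * m * indicator (ball 0 (\<delta>/2)) (w::'a) \<partial>lborel)"
    by (simp add: nn_integral_cmult_indicator vol)
  also have "\<dots> \<le> (\<integral>\<^sup>+w. m' * indicator (ball 0 (\<delta>/2)) w + (\<Sum>j=1..N. D j w * indicator (ball 0 (\<delta>/2)) w) \<partial>lborel)"
    using split by (intro nn_integral_mono) (auto simp: indicator_def)
  also have "\<dots> = (\<integral>\<^sup>+w. m' * indicator (ball (0::'a) (\<delta>/2)) w \<partial>lborel)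
      + (\<integral>\<^sup>+w. (\<Sum>j=1..N. D j w * indicator (ball 0 (\<delta>/2)) w) \<partial>lborel)"
    by (rule nn_integral_add) measurable
  also have "(\<integral>\<^sup>+w. m' * indicator (ball (0::'a) (\<delta>/2)) w \<partial>lborel) = m' * ennreal \<beta>"
    by (simp add: nn_integral_cmult_indicator vol)
  also have "(\<integral>\<^sup>+w. (\<Sum>j=1..N. D j w * indicator (ball 0 (\<delta>/2)) w) \<partial>lborel)
      = (\<Sum>j=1..N. \<integral>\<^sup>+w. D j w * indicator (ball 0 (\<delta>/2)) w \<partial>lborel)"
    by (rule nn_integral_sum) measurable
  also have "m' * ennreal \<beta> + (\<Sum>j=1..N. \<integral>\<^sup>+w. D j w * indicator (ball 0 (\<delta>/2)) w \<partial>lborel)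
      \<le> m' * ennreal \<beta> + (\<Sum>j=1..N. ennreal ?K * ?G)"
    unfolding D_def y_def S_def
    by (intro add_left_mono sum_mono translates_difference_le[OF ch L \<delta> p \<Omega> small _ u])
  also have "\<dots> = m' * ennreal \<beta> + of_nat N * (ennreal ?K * ?G)" by simp
  finally have main: "of_nat N * m * ennreal \<beta> \<le> m' * ennreal \<beta> + of_nat N * (ennreal ?K * ?G)" .
  have Nb: "ennreal (1 / (real N * \<beta>)) * of_nat N = ennreal (1 / \<beta>)"
    "ennreal (1 / (real N * \<beta>)) * ennreal \<beta> = ennreal (1 / real N)"
    "ennreal (1 / \<beta>) * ennreal \<beta> = 1"
    using N \<beta> by (simp_all add: ennreal_of_nat_eq_real_of_nat ennreal_mult'[symmetric])
  have "m = (ennreal (1 / (real N * \<beta>)) * of_nat N) * ennreal \<beta> * m"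
    unfolding Nb by simp
  also have "\<dots> = ennreal (1 / (real N * \<beta>)) * (of_nat N * m * ennreal \<beta>)" by (simp only: mult_ac)
  also have "\<dots> \<le> ennreal (1 / (real N * \<beta>)) * (m' * ennreal \<beta> + of_nat N * (ennreal ?K * ?G))"
    using main by (rule mult_left_mono) simp
  also have "\<dots> = (ennreal (1 / (real N * \<beta>)) * ennreal \<beta>) * m'
      + (ennreal (1 / (real N * \<beta>)) * of_nat N) * ennreal ?K * ?G" by (simp only: mult_ac distrib_left)
  also have "\<dots> = ennreal (1 / real N) * m' + ennreal (?K / \<beta>) * ?G"
    unfolding Nb using \<beta> by (simp add: ennreal_mult'[symmetric])
  also have "?K / \<beta> = ((2 * real N + 1) * L) powr p * 2 ^ DIM('a) / unit_ball_vol DIM('a)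
          * \<delta> powr (p - real DIM('a))"
  proof -
    have K: "?K = ((2 * real N + 1) * L) powr p * \<delta> powr p"
      using L \<delta> by (simp add: powr_mult[symmetric] mult.assoc)
    show ?thesis unfolding K \<beta>_def using \<delta> by (simp add: powr_diff powr_realpow power_divide)
  qed
  finally show ?thesis unfolding m_def m'_def S_def .
qed

subsection \<open>Absorption and the Hardy inequality\<close>

lemma layer_mass_step:
  fixes \<Omega> :: "'a::euclidean_space set" and N :: nat and C :: "'b set"
  assumes fin: "finite C" and ch: "\<And>c. c \<in> C \<Longrightarrow> boundary_chart \<Omega> L r (U c) (e c) (\<rho> c)"
    and cover: "boundary_layer \<Omega> \<delta> \<subseteq> (\<Union>c\<in>C. U c)"
    and L: "1 \<le> L" and \<delta>: "0 < \<delta>" and p: "0 \<le> p"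
    and \<Omega>: "open \<Omega>" and small: "(2 * real N + 2) * L * \<delta> \<le> r" and N: "1 \<le> N"
    and u[measurable]: "u \<in> borel_measurable borel"
  shows "(\<integral>\<^sup>+x. ennreal \<bar>u x\<bar> * indicator (boundary_layer \<Omega> \<delta>) x \<partial>lborel)
    \<le> ennreal (real (card C) / real N) *
        (\<integral>\<^sup>+x. ennreal \<bar>u x\<bar> * indicator (boundary_layer \<Omega> ((2 * real N + 2) * L * \<delta>)) x \<partial>lborel)
      + ennreal (real (card C) * (((2 * real N + 1) * L) powr p * 2 ^ DIM('a) / unit_ball_vol DIM('a))
          * \<delta> powr (p - real DIM('a))) *
        ring_energy \<Omega> p u {L * \<delta> .. (2 * real N + 1) * (L * \<delta>)}"
proof -
  let ?m' = "\<integral>\<^sup>+x. ennreal \<bar>u x\<bar> * indicator (boundary_layer \<Omega> ((2 * real N + 2) * L * \<delta>)) x \<partial>lborel"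
  let ?G = "ring_energy \<Omega> p u {L * \<delta> .. (2 * real N + 1) * (L * \<delta>)}"
  let ?D = "((2 * real N + 1) * L) powr p * 2 ^ DIM('a) / unit_ball_vol DIM('a) * \<delta> powr (p - real DIM('a))"
  have [measurable]: "U c \<inter> boundary_layer \<Omega> \<delta> \<in> sets borel" if "c \<in> C" for c
    using ch[OF that] open_boundary_layer[OF \<Omega>] by (auto simp: boundary_chart_def)
  have "(\<integral>\<^sup>+x. ennreal \<bar>u x\<bar> * indicator (boundary_layer \<Omega> \<delta>) x \<partial>lborel)
      \<le> (\<integral>\<^sup>+x. (\<Sum>c\<in>C. ennreal \<bar>u x\<bar> * indicator (U c \<inter> boundary_layer \<Omega> \<delta>) x) \<partial>lborel)"
  proof (rule nn_integral_mono)
    fix x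
    show "ennreal \<bar>u x\<bar> * indicator (boundary_layer \<Omega> \<delta>) x
        \<le> (\<Sum>c\<in>C. ennreal \<bar>u x\<bar> * indicator (U c \<inter> boundary_layer \<Omega> \<delta>) x)"
    proof (cases "x \<in> boundary_layer \<Omega> \<delta>")
      case True
      then obtain c where c: "c \<in> C" "x \<in> U c" using cover by auto
      then have "ennreal \<bar>u x\<bar> * indicator (boundary_layer \<Omega> \<delta>) x
          = ennreal \<bar>u x\<bar> * indicator (U c \<inter> boundary_layer \<Omega> \<delta>) x" by (simp add: indicator_def)
      also have "\<dots> \<le> (\<Sum>c\<in>C. ennreal \<bar>u x\<bar> * indicator (U c \<inter> boundary_layer \<Omega> \<delta>) x)"
        using c(1) fin by (intro member_le_sum) auto
      finally show ?thesis .
    qed simp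
  qed
  also have "\<dots> = (\<Sum>c\<in>C. \<integral>\<^sup>+x. ennreal \<bar>u x\<bar> * indicator (U c \<inter> boundary_layer \<Omega> \<delta>) x \<partial>lborel)"
    by (intro nn_integral_sum) auto
  also have "\<dots> \<le> (\<Sum>c\<in>C. ennreal (1 / real N) * ?m' + ennreal ?D * ?G)"
    using ch by (intro sum_mono chart_layer_mass_le[OF _ L \<delta> p \<Omega> small N u])
  also have "\<dots> = ennreal (real (card C)) * (ennreal (1 / real N) * ?m' + ennreal ?D * ?G)"
    by (simp add: ennreal_of_nat_eq_real_of_nat)
  also have "\<dots> = ennreal (real (card C) / real N) * ?m' + ennreal (real (card C) * ?D) * ?G"
    by (subst distrib_left) (simp only: mult.assoc[symmetric] ennreal_mult'[symmetric] of_nat_0_le_iff times_divide_eq_right mult_1_right)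
  finally show ?thesis by (simp only: times_divide_eq_right times_divide_eq_left mult.assoc)
qed

lemma ring_energy_sum_le:
  fixes T :: "nat \<Rightarrow> real set" and \<Omega> :: "'a::euclidean_space set"
  assumes [measurable]: "u \<in> borel_measurable borel" "\<Omega> \<in> sets borel" "\<And>k. T k \<in> sets borel"
    and disj: "disjoint_family T"
  shows "(\<Sum>k<K. ring_energy \<Omega> p u (T k)) \<le> ring_energy \<Omega> p u UNIV"
proof -
  let ?f = "\<lambda>x y T. ennreal (\<bar>u x - u y\<bar> * norm (x - y) powr - p) *
     (indicator \<Omega> x * indicator \<Omega> y * indicator T (norm (x - y)))"
  have "(\<Sum>k<K. ring_energy \<Omega> p u (T k)) = (\<integral>\<^sup>+x. \<integral>\<^sup>+y. (\<Sum>k<K. ?f x y (T k)) \<partial>lborel \<partial>lborel)"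
    unfolding ring_energy_def by (simp add: nn_integral_sum)
  also have "\<dots> \<le> (\<integral>\<^sup>+x. \<integral>\<^sup>+y. ?f x y UNIV \<partial>lborel \<partial>lborel)"
  proof (intro nn_integral_mono)
    fix x y :: 'a
    have "(\<Sum>k<K. of_bool (norm (x - y) \<in> T k) :: ennreal) \<le> of_bool True"
    proof (rule sum_of_bool_exclusive_le)
      fix j k assume "norm (x - y) \<in> T j" "norm (x - y) \<in> T k"
      then show "j = k" using disj unfolding disjoint_family_on_def by blast
    qed auto
    then have "(\<Sum>k<K. indicator (T k) (norm (x - y)) :: ennreal) \<le> 1"
      by (simp add: indicator_def of_bool_def)
    then show "(\<Sum>k<K. ?f x y (T k)) \<le> ?f x y UNIV"
      by (simp only: sum_distrib_left[symmetric], intro mult_left_mono) simp_all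
  qed
  finally show ?thesis unfolding ring_energy_def .
qed

lemma geometric_rings_disjoint:
  fixes a b \<Lambda> :: real
  assumes "0 < a" "1 < \<Lambda>" "b < \<Lambda> * a"
  shows "disjoint_family (\<lambda>k::nat. {a / \<Lambda> ^ k .. b / \<Lambda> ^ k})"
proof -
  have "{a / \<Lambda> ^ j .. b / \<Lambda> ^ j} \<inter> {a / \<Lambda> ^ k .. b / \<Lambda> ^ k} = {}" if "j < k" for j k :: nat
  proof -
    have "b / \<Lambda> ^ k < \<Lambda> * a / \<Lambda> ^ k" using assms by (intro divide_strict_right_mono) auto
    also have "\<dots> \<le> \<Lambda> * a / \<Lambda> ^ Suc j"
      using assms that by (intro divide_left_mono power_increasing) auto
    also have "\<dots> = a / \<Lambda> ^ j" using assms by simp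
    finally show ?thesis by auto
  qed
  then show ?thesis unfolding disjoint_family_on_def by (metis Int_commute nat_neq_iff)
qed

text \<open>A recursion with contraction factor one half is summed without knowing beforehand that
  the sum is finite.\<close>

lemma ennreal_absorb:
  fixes b g :: "nat \<Rightarrow> ennreal"
  assumes "\<And>k. 2 * b (Suc k) \<le> b k + g (Suc k)"
  shows "(\<Sum>k\<le>K. b k) + b K \<le> 2 * b 0 + (\<Sum>k\<le>K. g k)"
proof (induction K)
  case (Suc K)
  have "(\<Sum>k\<le>Suc K. b k) + b (Suc K) = (\<Sum>k\<le>K. b k) + 2 * b (Suc K)"
    by (simp add: mult_2 add_ac)
  also have "\<dots> \<le> (\<Sum>k\<le>K. b k) + b K + g (Suc K)"
    using assms[of K] by (simp add: add.assoc add_left_mono)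
  also have "\<dots> \<le> 2 * b 0 + (\<Sum>k\<le>K. g k) + g (Suc K)" using Suc by (rule add_right_mono)
  finally show ?case by (simp add: add.assoc)
qed (simp add: mult_2)

lemma ennreal_double_combine:
  assumes "0 \<le> a" "0 \<le> q" "0 \<le> t"
  shows "2 * (ennreal a * (ennreal q * M + ennreal t * G)) = ennreal (2 * a * q) * M + ennreal (2 * a * t) * G"
  using assms by (simp add: ennreal_mult distrib_left mult_ac)

text \<open>The number \<open>N\<close> of translates gains a factor \<open>1 / N\<close>, while the weight loses \<open>\<Lambda> powr s\<close> with \<open>\<Lambda>\<close>
proportional to \<open>N\<close>. As \<open>s < 1\<close>, the gain wins; the factor \<open>c\<close> is the number of charts.\<close>

lemma exists_translate_count:
  assumes "0 < s" "s < 1" "1 \<le> L" "0 \<le> c"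
  shows "\<exists>N\<ge>(1::nat). c / real N * ((2 * real N + 2) * L) powr s \<le> 1 / 2"
proof -
  define M where "M = 2 * c * (4 * L) powr s"
  obtain N :: nat where N: "M powr (1 / (1 - s)) + 1 \<le> real N" using real_arch_simple by blast
  have M0: "0 \<le> M" using assms by (simp add: M_def)
  have N1: "1 \<le> real N" using N powr_ge_zero[of M "1 / (1 - s)"] by linarith
  have "M = (M powr (1 / (1 - s))) powr (1 - s)" using M0 assms by (simp add: powr_powr)
  also have "\<dots> \<le> real N powr (1 - s)" using N assms by (intro powr_mono2) auto
  finally have MN: "M \<le> real N powr (1 - s)" .
  have "c / real N * ((2 * real N + 2) * L) powr s \<le> c / real N * (4 * L * real N) powr s"
    using assms N1 by (intro mult_left_mono powr_mono2) (auto simp: algebra_simps)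
  also have "\<dots> = M / 2 * (real N powr s / real N)"
    using assms N1 by (simp add: powr_mult M_def)
  also have "\<dots> \<le> real N powr (1 - s) / 2 * (real N powr s / real N)"
    using MN N1 by (intro mult_right_mono) auto
  also have "\<dots> = 1 / 2" using N1 by (simp add: powr_add[symmetric])
  finally show ?thesis using N1 by (intro exI[of _ N]) auto
qed

text \<open>Along the widths \<open>\<delta> / \<Lambda> ^ k\<close> the wider layer of one step is the layer of the preceding step. The
comparison therefore becomes a recursion for the weighted masses, with contraction factor one half
and with an error term given by the energy in a ring of distances. These rings are disjoint, so
the errors add up to at most the full Gagliardo energy.\<close>

lemma weighted_layers_finite:
  fixes \<Omega> :: "'a::euclidean_space set"
  assumes \<Omega>: "bounded \<Omega>" "open \<Omega>" "lipschitz_boundary \<Omega>" and s: "0 < s" "s < 1"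
  obtains \<Lambda> \<delta> where "1 < \<Lambda>" "0 < \<delta>"
    "\<And>u. \<lbrakk>u \<in> borel_measurable borel; (\<integral>\<^sup>+x. ennreal \<bar>u x\<bar> * indicator \<Omega> x \<partial>lborel) < \<infinity>;
      ring_energy \<Omega> (real DIM('a) + s) u UNIV < \<infinity>\<rbrakk> \<Longrightarrow>
      (\<Sum>k. ennreal ((\<delta> / \<Lambda> ^ k) powr - s) *
         (\<integral>\<^sup>+x. ennreal \<bar>u x\<bar> * indicator (boundary_layer \<Omega> (\<delta> / \<Lambda> ^ k)) x \<partial>lborel)) < \<infinity>"
proof -
  obtain C :: "'a set" and L r U e \<rho> \<delta>\<^sub>0 where C: "finite C" and L: "1 \<le> L" and r: "0 < r" and \<delta>\<^sub>0: "0 < \<delta>\<^sub>0"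
    and ch: "\<And>c. c \<in> C \<Longrightarrow> boundary_chart \<Omega> L r (U c) (e c) (\<rho> c)"
    and cover: "boundary_layer \<Omega> \<delta>\<^sub>0 \<subseteq> (\<Union>c\<in>C. U c)"
    using finite_boundary_atlas[OF \<Omega>] by metis
  obtain N :: nat where N: "1 \<le> N" and
    small: "real (card C) / real N * ((2 * real N + 2) * L) powr s \<le> 1 / 2"
    using exists_translate_count[OF s L, of "real (card C)"] by auto
  define \<Lambda> where "\<Lambda> = (2 * real N + 2) * L"
  have "2 * real N + 2 \<le> \<Lambda>" using L mult_left_mono[of 1 L "2 * real N + 2"] by (simp add: \<Lambda>_def)
  then have \<Lambda>: "2 * real N + 1 < \<Lambda>" "1 < \<Lambda>" using N by auto
  \<comment> \<open>Layers up to this width are covered by charts, and their translates stay inside the charts.\<close>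
  define \<delta> where "\<delta> = min \<delta>\<^sub>0 r"
  have \<delta>: "0 < \<delta>" "\<delta> \<le> \<delta>\<^sub>0" "\<delta> \<le> r" using \<delta>\<^sub>0 r by (auto simp: \<delta>_def)
  define d where "d k = \<delta> / \<Lambda> ^ k" for k :: nat
  have d: "0 < d k" "d k \<le> \<delta>" "d k = \<Lambda> * d (Suc k)" for k
    using \<delta> \<Lambda> by (auto simp: d_def divide_le_eq mult_le_cancel_left1 one_le_power)
  show ?thesis
  proof (rule that[OF \<Lambda>(2) \<delta>(1)])
    fix u :: "'a \<Rightarrow> real"
    assume u[measurable]: "u \<in> borel_measurable borel"
      and mass: "(\<integral>\<^sup>+x. ennreal \<bar>u x\<bar> * indicator \<Omega> x \<partial>lborel) < \<infinity>"
      and gag: "ring_energy \<Omega> (real DIM('a) + s) u UNIV < \<infinity>"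
    let ?p = "real DIM('a) + s"
    define m where "m \<epsilon> = (\<integral>\<^sup>+x. ennreal \<bar>u x\<bar> * indicator (boundary_layer \<Omega> \<epsilon>) x \<partial>lborel)" for \<epsilon>
    define b where "b k = ennreal (d k powr - s) * m (d k)" for k
    define D where "D = real (card C) * (((2 * real N + 1) * L) powr ?p * 2 ^ DIM('a) / unit_ball_vol DIM('a))"
    have D: "0 \<le> D" by (auto simp: D_def intro!: divide_nonneg_pos)
    define T where "T k = {L * d k .. (2 * real N + 1) * (L * d k)}" for k
    define g where "g k = ennreal (2 * D) * ring_energy \<Omega> ?p u (T k)" for k
    have rec: "2 * b (Suc k) \<le> b k + g (Suc k)" for k
    proof -
      have dS: "\<Lambda> * d (Suc k) = d k" using d(3)[of k] by simp
      have "m (d (Suc k)) \<le> ennreal (real (card C) / real N) * m (\<Lambda> * d (Suc k))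
          + ennreal (D * d (Suc k) powr (?p - real DIM('a))) * ring_energy \<Omega> ?p u (T (Suc k))"
        unfolding m_def \<Lambda>_def D_def T_def
      proof (rule layer_mass_step[OF C ch _ L d(1) _ \<Omega>(2) _ N u])
        show "boundary_layer \<Omega> (d (Suc k)) \<subseteq> (\<Union>c\<in>C. U c)"
          using cover boundary_layer_mono[of "d (Suc k)" \<delta>\<^sub>0 \<Omega>] d(2)[of "Suc k"] \<delta> by auto
        show "(2 * real N + 2) * L * d (Suc k) \<le> r"
          using d(2)[of k] dS \<delta> by (simp add: \<Lambda>_def)
      qed (use s in auto)
      then have "2 * b (Suc k) \<le> 2 * (ennreal (d (Suc k) powr - s) * (ennreal (real (card C) / real N) * m (d k)
          + ennreal (D * d (Suc k) powr s) * ring_energy \<Omega> ?p u (T (Suc k))))"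
        unfolding b_def dS by (intro mult_left_mono) auto
      also have "\<dots> = ennreal (2 * (d (Suc k) powr - s) * (real (card C) / real N)) * m (d k)
          + ennreal (2 * (d (Suc k) powr - s) * (D * d (Suc k) powr s)) * ring_energy \<Omega> ?p u (T (Suc k))"
        using D by (intro ennreal_double_combine) auto
      also have "\<dots> \<le> ennreal (d k powr - s) * m (d k) + g (Suc k)"
      proof (rule add_mono)
        have "2 * (d (Suc k) powr - s) * (real (card C) / real N)
            = d k powr - s * (2 * (real (card C) / real N * \<Lambda> powr s))"
          using d(1)[of "Suc k"] \<Lambda> unfolding dS[symmetric]
          by (simp add: powr_mult powr_minus field_simps)
        also have "\<dots> \<le> d k powr - s * 1"
        proof (rule mult_left_mono)
          show "2 * (real (card C) / real N * \<Lambda> powr s) \<le> 1" using small unfolding \<Lambda>_def by linarith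
        qed simp
        finally show "ennreal (2 * (d (Suc k) powr - s) * (real (card C) / real N)) * m (d k)
            \<le> ennreal (d k powr - s) * m (d k)" by (intro mult_right_mono ennreal_leI) auto
        have "2 * (d (Suc k) powr - s) * (D * d (Suc k) powr s) = 2 * D"
          using d(1)[of "Suc k"] by (simp add: powr_minus field_simps)
        then show "ennreal (2 * (d (Suc k) powr - s) * (D * d (Suc k) powr s)) * ring_energy \<Omega> ?p u (T (Suc k))
            \<le> g (Suc k)" unfolding g_def by (simp only: order_refl)
      qed
      finally show ?thesis by (simp add: b_def)
    qed
    have disj: "disjoint_family T"
    proof -
      have "(2 * real N + 1) * (L * \<delta>) < \<Lambda> * (L * \<delta>)"
        using \<Lambda>(1) L \<delta>(1) by (intro mult_strict_right_mono) auto
      then have "disjoint_family (\<lambda>k. {(L * \<delta>) / \<Lambda> ^ k .. ((2 * real N + 1) * (L * \<delta>)) / \<Lambda> ^ k})"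
        using L \<delta>(1) \<Lambda> by (intro geometric_rings_disjoint) auto
      then show ?thesis by (simp add: T_def[abs_def] d_def)
    qed
    have bound: "(\<Sum>k<K. b k) \<le> 2 * b 0 + ennreal (2 * D) * ring_energy \<Omega> ?p u UNIV" for K
    proof -
      have "(\<Sum>k<K. b k) \<le> (\<Sum>k\<le>K. b k)" by (intro sum_mono2) auto
      also have "\<dots> \<le> (\<Sum>k\<le>K. b k) + b K" by simp
      also have "\<dots> \<le> 2 * b 0 + (\<Sum>k\<le>K. g k)" by (rule ennreal_absorb[of b g, OF rec])
      also have "(\<Sum>k\<le>K. g k) = ennreal (2 * D) * (\<Sum>k<Suc K. ring_energy \<Omega> ?p u (T k))"
        by (simp add: g_def sum_distrib_left lessThan_Suc_atMost)
      also have "\<dots> \<le> ennreal (2 * D) * ring_energy \<Omega> ?p u UNIV"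
        using \<Omega>(2) by (intro mult_left_mono ring_energy_sum_le disj) (auto simp: T_def)
      finally show ?thesis by (simp add: add_left_mono)
    qed
    have "m (d 0) \<le> (\<integral>\<^sup>+x. ennreal \<bar>u x\<bar> * indicator \<Omega> x \<partial>lborel)"
      unfolding m_def using boundary_layer_subset[of \<Omega>]
      by (intro nn_integral_mono) (auto simp: indicator_def)
    then have "b 0 < \<infinity>" using mass by (simp add: b_def ennreal_mult_less_top order_le_less_trans)
    then have "2 * b 0 + ennreal (2 * D) * ring_energy \<Omega> ?p u UNIV < \<infinity>"
      using gag by (simp add: ennreal_mult_less_top)
    moreover have "suminf b \<le> 2 * b 0 + ennreal (2 * D) * ring_energy \<Omega> ?p u UNIV"
      by (intro suminf_le_const bound) auto
    ultimately have "suminf b < \<infinity>" by (rule order_le_less_trans[rotated])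
    then show "(\<Sum>k. ennreal ((\<delta> / \<Lambda> ^ k) powr - s) *
         (\<integral>\<^sup>+x. ennreal \<bar>u x\<bar> * indicator (boundary_layer \<Omega> (\<delta> / \<Lambda> ^ k)) x \<partial>lborel)) < \<infinity>"
      by (simp add: b_def[abs_def] m_def d_def)
  qed
qed

text \<open>For \<open>x\<close> at distance \<open>d\<close> from the complement the inner integral is at most a multiple of \<open>d powr - s\<close>,
and up to constants this weight is dominated by \<open>1\<close> plus the sum of \<open>(\<delta> / \<Lambda> ^ k) powr - s\<close> over the
layers containing \<open>x\<close>. As \<open>s < 1\<close>, this covers functions that do not vanish at the boundary; for the
constant function it says that \<open>\<Omega>\<close> has finite fractional perimeter.\<close>

theorem fractional_hardy:
  fixes \<Omega> :: "'a::euclidean_space set"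
  assumes \<Omega>: "bounded \<Omega>" "open \<Omega>" "lipschitz_boundary \<Omega>" and s: "0 < s" "s < 1"
    and u[measurable]: "u \<in> borel_measurable borel"
    and mass: "(\<integral>\<^sup>+x. ennreal \<bar>u x\<bar> * indicator \<Omega> x \<partial>lborel) < \<infinity>"
    and gag: "ring_energy \<Omega> (real DIM('a) + s) u UNIV < \<infinity>"
  shows "(\<integral>\<^sup>+x. ennreal \<bar>u x\<bar> * indicator \<Omega> x *
      (\<integral>\<^sup>+y. ennreal (norm (x - y) powr - (real DIM('a) + s)) * indicator (- \<Omega>) y \<partial>lborel) \<partial>lborel) < \<infinity>"
proof -
  let ?p = "real DIM('a) + s"
  obtain C where C: "0 < C" "\<And>R. 0 < R \<Longrightarrow>
      (\<integral>\<^sup>+z. ennreal (norm (z::'a) powr - ?p) * indicator {z. R \<le> norm z} z \<partial>lborel) \<le> ennreal (C * R powr - s)"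
  proof -
    have dp: "real DIM('a) < ?p" using s by simp
    show ?thesis
    proof (rule kernel_tail_le[where 'a='a, OF dp])
      fix C assume C: "0 < C" "\<And>R. 0 < R \<Longrightarrow>
        (\<integral>\<^sup>+z. ennreal (norm (z::'a) powr - ?p) * indicator {z. R \<le> norm z} z \<partial>lborel)
          \<le> ennreal (C * R powr (real DIM('a) - ?p))"
      have e: "real DIM('a) - ?p = - s" by simp
      show ?thesis by (rule that[OF C(1) C(2)[unfolded e]])
    qed
  qed
  obtain \<Lambda> \<delta> where \<Lambda>: "1 < \<Lambda>" and \<delta>: "0 < \<delta>" and
    sum: "(\<Sum>k. ennreal ((\<delta> / \<Lambda> ^ k) powr - s) *
         (\<integral>\<^sup>+x. ennreal \<bar>u x\<bar> * indicator (boundary_layer \<Omega> (\<delta> / \<Lambda> ^ k)) x \<partial>lborel)) < \<infinity>"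
    by (rule weighted_layers_finite[OF \<Omega> s]) (rule that[OF _ _ _], assumption, assumption, use u mass gag in blast)
  have [measurable]: "\<Omega> \<in> sets borel" "\<And>\<epsilon>. boundary_layer \<Omega> \<epsilon> \<in> sets borel"
    using \<Omega>(2) open_boundary_layer[OF \<Omega>(2)] by auto
  define \<kappa> where "\<kappa> x = (\<integral>\<^sup>+y. ennreal (norm (x - y) powr - ?p) * indicator (- \<Omega>) y \<partial>lborel)" for x
  have far: "\<kappa> x \<le> ennreal (C * \<epsilon> powr - s)" if x: "x \<in> \<Omega>" "x \<notin> boundary_layer \<Omega> \<epsilon>" and \<epsilon>: "0 < \<epsilon>" for x \<epsilon>
  proof -
    have "\<kappa> x \<le> (\<integral>\<^sup>+y. ennreal (norm (x - y) powr - ?p) * indicator {z. \<epsilon> \<le> norm z} (x - y) \<partial>lborel)"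
      unfolding \<kappa>_def using x
      by (intro nn_integral_mono) (auto simp: indicator_def boundary_layer_def dist_norm not_less)
    also have "\<dots> = (\<integral>\<^sup>+z. ennreal (norm (z::'a) powr - ?p) * indicator {z. \<epsilon> \<le> norm z} z \<partial>lborel)"
      by (rule nn_integral_reflect) measurable
    also have "\<dots> \<le> ennreal (C * \<epsilon> powr - s)" by (rule C(2)[OF \<epsilon>])
    finally show ?thesis .
  qed
  let ?d = "\<lambda>k::nat. \<delta> / \<Lambda> ^ k"
  let ?h = "\<lambda>k x. ennreal (C * \<Lambda> powr s) * (ennreal (?d k powr - s) * (ennreal \<bar>u x\<bar> * indicator (boundary_layer \<Omega> (?d k)) x))"
  let ?t = "\<lambda>k x. ennreal (C * \<Lambda> powr s) * (ennreal (?d k powr - s) * indicator (boundary_layer \<Omega> (?d k)) x)"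
  have kap: "\<kappa> x \<le> ennreal (C * \<delta> powr - s) +
      (\<Sum>k. ?t k x)"
    if x: "x \<in> \<Omega>" for x
  proof -
    obtain \<epsilon> where \<epsilon>: "0 < \<epsilon>" "ball x \<epsilon> \<subseteq> \<Omega>" using \<Omega>(2) x by (auto simp: open_contains_ball)
    obtain k where "\<delta> / \<epsilon> < \<Lambda> ^ k" using real_arch_pow[OF \<Lambda>] by blast
    then have "?d k < \<epsilon>" using \<epsilon> \<Lambda> by (simp add: field_simps)
    then have ex: "x \<notin> boundary_layer \<Omega> (?d k)" using \<epsilon> by (force simp: boundary_layer_def)
    \<comment> \<open>The first layer that misses \<open>x\<close> tells its distance to the complement up to the factor \<open>\<Lambda>\<close>.\<close>
    define k0 where "k0 = (LEAST k. x \<notin> boundary_layer \<Omega> (?d k))"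
    have k0: "x \<notin> boundary_layer \<Omega> (?d k0)" unfolding k0_def using ex by (rule LeastI)
    have pos: "0 < ?d k" for k using \<delta> \<Lambda> by simp
    show ?thesis
    proof (cases k0)
      case 0
      then have "\<kappa> x \<le> ennreal (C * \<delta> powr - s)" using far[OF x k0 pos] by simp
      then show ?thesis by (rule order_trans) simp
    next
      case (Suc j)
      then have j: "x \<in> boundary_layer \<Omega> (?d j)"
        using not_less_Least[of j "\<lambda>k. x \<notin> boundary_layer \<Omega> (?d k)"] k0_def by auto
      have scale: "C * ?d k0 powr - s = C * \<Lambda> powr s * ?d j powr - s"
        using pos[of j] \<Lambda> \<delta> unfolding Suc by (simp add: powr_minus powr_divide powr_mult field_simps)
      have "\<kappa> x \<le> ennreal (C * \<Lambda> powr s * ?d j powr - s)" using far[OF x k0 pos] unfolding scale .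
      also have "\<dots> = (\<Sum>k\<in>{j}. ?t k x)"
        using j C(1) by (simp add: ennreal_mult')
      also have "\<dots> \<le> (\<Sum>k. ?t k x)"
        by (intro sum_le_suminf) auto
      finally show ?thesis by (rule order_trans) simp
    qed
  qed
  have "(\<integral>\<^sup>+x. ennreal \<bar>u x\<bar> * indicator \<Omega> x * \<kappa> x \<partial>lborel)
      \<le> (\<integral>\<^sup>+x. ennreal (C * \<delta> powr - s) * (ennreal \<bar>u x\<bar> * indicator \<Omega> x) +
        (\<Sum>k. ?h k x) \<partial>lborel)"
  proof (rule nn_integral_mono)
    fix x
    show "ennreal \<bar>u x\<bar> * indicator \<Omega> x * \<kappa> x \<le> ennreal (C * \<delta> powr - s) * (ennreal \<bar>u x\<bar> * indicator \<Omega> x) +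
        (\<Sum>k. ?h k x)"
    proof (cases "x \<in> \<Omega>")
      case True
      have "ennreal \<bar>u x\<bar> * \<kappa> x \<le> ennreal \<bar>u x\<bar> * (ennreal (C * \<delta> powr - s) +
        (\<Sum>k. ?t k x))"
        by (intro mult_left_mono kap True) simp
      also have "\<dots> = ennreal (C * \<delta> powr - s) * ennreal \<bar>u x\<bar> +
        (\<Sum>k. ennreal \<bar>u x\<bar> * (?t k x))"
        by (simp only: distrib_left ennreal_suminf_cmult mult.commute)
      finally show ?thesis using True by (simp add: mult_ac)
    qed simp
  qed
  also have "\<dots> = ennreal (C * \<delta> powr - s) * (\<integral>\<^sup>+x. ennreal \<bar>u x\<bar> * indicator \<Omega> x \<partial>lborel) +
      ennreal (C * \<Lambda> powr s) * (\<Sum>k. ennreal (?d k powr - s) *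
         (\<integral>\<^sup>+x. ennreal \<bar>u x\<bar> * indicator (boundary_layer \<Omega> (?d k)) x \<partial>lborel))"
  proof -
    have term_int: "(\<integral>\<^sup>+x. ?h k x \<partial>lborel)
        = ennreal (C * \<Lambda> powr s) * (ennreal (?d k powr - s) * (\<integral>\<^sup>+x. ennreal \<bar>u x\<bar> * indicator (boundary_layer \<Omega> (?d k)) x \<partial>lborel))" for k
      by (simp add: nn_integral_cmult)
    have meas: "(\<lambda>x. ennreal (C * \<delta> powr - s) * (ennreal \<bar>u x\<bar> * indicator \<Omega> x)) \<in> borel_measurable lborel"
      "(\<lambda>x. \<Sum>k. ?h k x) \<in> borel_measurable lborel"
      "\<And>k. ?h k \<in> borel_measurable lborel"
      "(\<lambda>x. ennreal \<bar>u x\<bar> * indicator \<Omega> x) \<in> borel_measurable lborel"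
      by measurable
    show ?thesis
      unfolding nn_integral_add[OF meas(1,2)] nn_integral_suminf[OF meas(3)] nn_integral_cmult[OF meas(4)]
      by (simp only: term_int ennreal_suminf_cmult)
  qed
  also have "\<dots> < \<infinity>" using mass sum by (simp add: ennreal_mult_less_top)
  finally show ?thesis by (simp add: \<kappa>_def)
qed

section \<open>The energy difference of two functions\<close>

lemma AE_lborel_pair:
  assumes "AE x in lborel. P (x::'a::euclidean_space)"
  shows "AE z in lborel. P (fst z) \<and> P (snd (z :: 'a \<times> 'a))"
proof -
  obtain N where N: "{x. \<not> P x} \<subseteq> N" "N \<in> null_sets lborel"
    using assms unfolding eventually_ae_filter by (auto simp only: space_lborel space_borel UNIV_I simp_thms)
  have [measurable]: "N \<in> sets borel" and N0: "emeasure lborel N = 0"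
    using N(2) unfolding null_sets_def by simp_all
  have "emeasure (lborel \<Otimes>\<^sub>M (lborel :: 'a measure)) (N \<times> UNIV) = 0"
    "emeasure ((lborel :: 'a measure) \<Otimes>\<^sub>M lborel) (UNIV \<times> N) = 0"
    by (subst lborel.emeasure_pair_measure_Times; simp add: N0)+
  then have "N \<times> UNIV \<in> null_sets (lborel :: ('a \<times> 'a) measure)"
    "UNIV \<times> N \<in> null_sets (lborel :: ('a \<times> 'a) measure)"
    unfolding null_sets_def lborel_prod[symmetric] by simp_all
  then have *: "N \<times> UNIV \<union> UNIV \<times> N \<in> null_sets (lborel :: ('a \<times> 'a) measure)"
    by (rule null_sets.Un)
  show ?thesis
  proof (rule AE_I'[OF *], rule subsetI)
    fix z :: "'a \<times> 'a"
    assume "z \<in> {z \<in> space lborel. \<not> (P (fst z) \<and> P (snd z))}"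
    then have "fst z \<in> N \<or> snd z \<in> N" using N(1) by blast
    then show "z \<in> N \<times> UNIV \<union> UNIV \<times> N" by (cases z) simp
  qed
qed

lemma W_s_norm_borel:
  fixes u :: "real ^ 'n \<Rightarrow> real"
  assumes [measurable]: "u \<in> borel_measurable borel" and "open \<Omega>"
  shows "W_s_norm s \<Omega> u = (\<integral>\<^sup>+x. ennreal \<bar>u x\<bar> * indicator \<Omega> x \<partial>lborel)
    + ring_energy \<Omega> (real CARD('n) + s) u UNIV"
proof -
  have [measurable]: "\<Omega> \<in> sets borel" using assms(2) by simp
  let ?f = "\<lambda>(x, y). ennreal (\<bar>u x - u y\<bar> / norm (x - y) powr (real CARD('n) + s)) * indicator (\<Omega> \<times> \<Omega>) (x, y)"
  have "(\<integral>\<^sup>+z. ?f z \<partial>lebesgue) = (\<integral>\<^sup>+z. ?f z \<partial>(lborel \<Otimes>\<^sub>M lborel))"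
    by (simp only: nn_integral_completion lborel_prod)
  also have "\<dots> = (\<integral>\<^sup>+x. \<integral>\<^sup>+y. ?f (x, y) \<partial>lborel \<partial>lborel)"
    by (rule lborel.nn_integral_fst[symmetric]) (unfold indicator_times, measurable)
  also have "\<dots> = ring_energy \<Omega> (real CARD('n) + s) u UNIV"
    unfolding ring_energy_def by (simp only: indicator_times powr_minus_divide prod.case times_divide_eq_right mult_1_right fst_conv snd_conv indicator_UNIV)
  finally have "(\<integral>\<^sup>+z. ?f z \<partial>lebesgue) = ring_energy \<Omega> (real CARD('n) + s) u UNIV" .
  then show ?thesis
    unfolding W_s_norm_def nn_integral_completion by (simp add: case_prod_unfold)
qed

lemma W_s_borel_iff:
  fixes u :: "real ^ 'n \<Rightarrow> real"
  assumes "u \<in> borel_measurable borel" "open \<Omega>"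
  shows "u \<in> W_s s \<Omega> \<longleftrightarrow> (\<integral>\<^sup>+x. ennreal \<bar>u x\<bar> * indicator \<Omega> x \<partial>lborel) < \<infinity>
    \<and> ring_energy \<Omega> (real CARD('n) + s) u UNIV < \<infinity>"
proof -
  have "u \<in> borel_measurable lebesgue" using assms(1) by (simp add: measurable_completion)
  then show ?thesis
    unfolding W_s_def mem_Collect_eq W_s_norm_borel[OF assms] infinity_ennreal_def ennreal_add_less_top by simp
qed

text \<open>The full energy of a function may be infinite, as exterior data are arbitrary far away. By the
Lipschitz bound on \<open>calG_s\<close> the difference of two energy densities sees only the difference of the
two functions, in which the exterior data cancel.\<close>

lemma energy_diff_bound:
  fixes u v :: "real ^ 'n \<Rightarrow> real"
  assumes "0 \<le> s"
  shows "\<bar>energy_diff s u v (x, y)\<bar>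
    \<le> 2 * \<bar>(u x - v x) - (u y - v y)\<bar> * norm (x - y) powr - (real CARD('n) + s)"
proof (cases "x = y")
  case False
  define r where "r = norm (x - y)"
  have r: "0 < r" using False by (simp add: r_def)
  let ?n = "CARD('n)"
  have n: "1 \<le> ?n" by (simp add: Suc_leI)
  have "\<bar>energy_diff s u v (x, y)\<bar>
      = \<bar>calG_s ?n s ((u x - u y) / r) - calG_s ?n s ((v x - v y) / r)\<bar> / r powr (real ?n - 1 + s)"
    by (simp add: energy_diff_def r_def)
  also have "\<dots> \<le> 2 * \<bar>(u x - u y) / r - (v x - v y) / r\<bar> / r powr (real ?n - 1 + s)"
    by (intro divide_right_mono calG_s_lipschitz n assms) simp
  also have "\<bar>(u x - u y) / r - (v x - v y) / r\<bar> = \<bar>(u x - v x) - (u y - v y)\<bar> / r"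
    using r by (simp add: diff_divide_distrib[symmetric] abs_divide algebra_simps)
  also have "2 * (\<bar>(u x - v x) - (u y - v y)\<bar> / r) / r powr (real ?n - 1 + s)
      = 2 * \<bar>(u x - v x) - (u y - v y)\<bar> * (1 / (r powr 1 * r powr (real ?n - 1 + s)))"
    using r by simp
  also have "1 / (r powr 1 * r powr (real ?n - 1 + s)) = r powr - (real ?n + s)"
  proof -
    have "r powr 1 * r powr (real ?n - 1 + s) = r powr (real ?n + s)"
      by (subst powr_add[symmetric]) simp
    then show ?thesis by (simp only: powr_minus_divide)
  qed
  finally show ?thesis by (simp add: r_def)
qed (simp add: energy_diff_def)

lemma energy_diff_self [simp]: "energy_diff s u u z = 0"
  by (simp add: energy_diff_def case_prod_unfold)

lemma energy_diff_add: "energy_diff s u v z + energy_diff s v w z = energy_diff s u w z"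
  by (simp add: energy_diff_def case_prod_unfold diff_divide_distrib)

lemma borel_measurable_energy_diff:
  fixes u v :: "real ^ 'n \<Rightarrow> real"
  assumes [measurable]: "u \<in> borel_measurable borel" "v \<in> borel_measurable borel"
  shows "energy_diff s u v \<in> borel_measurable (borel :: ((real ^ 'n) \<times> (real ^ 'n)) measure)"
  unfolding energy_diff_def borel_prod[symmetric] by measurable

locale fractional_domain =
  fixes s :: real and \<Omega> :: "(real ^ 'n) set"
  assumes s_pos: "0 < s" and s_less_1: "s < 1"
    and bounded_domain: "bounded \<Omega>" and open_domain: "open \<Omega>" and lipschitz_domain: "lipschitz_boundary \<Omega>"
begin

lemma domain_borel [measurable]: "\<Omega> \<in> sets borel"
  using open_domain by simp

lemma domain_emeasure_finite: "emeasure lborel \<Omega> < \<infinity>"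
  using bounded_domain by (rule emeasure_bounded_finite)

abbreviation kernel :: "real ^ 'n \<Rightarrow> real" where
  "kernel z \<equiv> norm z powr - (real CARD('n) + s)"

text \<open>This is where the boundary regularity enters: functions in \<open>W_s s \<Omega>\<close> stay in the fractional
  space of the whole space when they are extended by zero, because the Hardy inequality
  controls their interaction with the complement.\<close>

lemma zero_extension_finite:
  assumes u[measurable]: "u \<in> borel_measurable borel" and W: "u \<in> W_s s \<Omega>"
  shows "integrable lborel (\<lambda>(x, y). \<bar>u x * indicator \<Omega> x - u y * indicator \<Omega> y\<bar> * kernel (x - y))"
    (is "integrable _ ?F")
proof (rule integrableI_bounded)
  let ?I = "indicator \<Omega> :: _ \<Rightarrow> ennreal"
  let ?J = "indicator (- \<Omega>) :: _ \<Rightarrow> ennreal"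
  show "?F \<in> borel_measurable lborel"
    unfolding lborel_prod[symmetric] by measurable
  have mass: "(\<integral>\<^sup>+x. ennreal \<bar>u x\<bar> * indicator \<Omega> x \<partial>lborel) < \<infinity>"
    and gag: "ring_energy \<Omega> (real CARD('n) + s) u UNIV < \<infinity>"
    using W W_s_borel_iff[OF u open_domain] by auto
  have hardy: "(\<integral>\<^sup>+x. ennreal \<bar>u x\<bar> * ?I x * (\<integral>\<^sup>+y. ennreal (kernel (x - y)) * ?J y \<partial>lborel) \<partial>lborel) < \<infinity>"
    using fractional_hardy[OF bounded_domain open_domain lipschitz_domain s_pos s_less_1 u mass] gag by simp
  let ?h = "\<lambda>x y. ennreal \<bar>u x\<bar> * ?I x * (ennreal (kernel (x - y)) * ?J y)"
  let ?g = "\<lambda>x y. ennreal (\<bar>u x - u y\<bar> * kernel (x - y)) * (?I x * ?I y)"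
  have "(\<integral>\<^sup>+z. ennreal (norm (?F z)) \<partial>lborel) = (\<integral>\<^sup>+x. \<integral>\<^sup>+y. ennreal (norm (?F (x, y))) \<partial>lborel \<partial>lborel)"
    unfolding lborel_prod[symmetric] by (rule lborel.nn_integral_fst[symmetric]) measurable
  also have "\<dots> \<le> (\<integral>\<^sup>+x. \<integral>\<^sup>+y. ?g x y + (?h x y + ?h y x) \<partial>lborel \<partial>lborel)"
    by (intro nn_integral_mono) (auto simp: indicator_def ennreal_mult' norm_minus_commute abs_mult)
  also have "\<dots> = (\<integral>\<^sup>+x. (\<integral>\<^sup>+y. ?g x y \<partial>lborel) + ((\<integral>\<^sup>+y. ?h x y \<partial>lborel) + (\<integral>\<^sup>+y. ?h y x \<partial>lborel)) \<partial>lborel)"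
    by (simp add: nn_integral_add)
  also have "\<dots> = (\<integral>\<^sup>+x. \<integral>\<^sup>+y. ?g x y \<partial>lborel \<partial>lborel) +
      ((\<integral>\<^sup>+x. \<integral>\<^sup>+y. ?h x y \<partial>lborel \<partial>lborel) + (\<integral>\<^sup>+x. \<integral>\<^sup>+y. ?h y x \<partial>lborel \<partial>lborel))"
    by (simp add: nn_integral_add)
  also have "(\<integral>\<^sup>+x. \<integral>\<^sup>+y. ?h y x \<partial>lborel \<partial>lborel) = (\<integral>\<^sup>+x. \<integral>\<^sup>+y. ?h x y \<partial>lborel \<partial>lborel)"
    by (rule lborel_pair.Fubini') measurable
  also have "(\<integral>\<^sup>+x. \<integral>\<^sup>+y. ?h x y \<partial>lborel \<partial>lborel) =
      (\<integral>\<^sup>+x. ennreal \<bar>u x\<bar> * ?I x * (\<integral>\<^sup>+y. ennreal (kernel (x - y)) * ?J y \<partial>lborel) \<partial>lborel)"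
    by (intro nn_integral_cong nn_integral_cmult) measurable
  also have "(\<integral>\<^sup>+x. \<integral>\<^sup>+y. ?g x y \<partial>lborel \<partial>lborel) = ring_energy \<Omega> (real CARD('n) + s) u UNIV"
    by (simp add: ring_energy_def)
  finally show "(\<integral>\<^sup>+z. ennreal (norm (?F z)) \<partial>lborel) < \<infinity>"
    by (rule order_le_less_trans) (use gag hardy in simp)
qed

lemma integrable_energy_diff:
  assumes u[measurable]: "u \<in> borel_measurable borel" and v[measurable]: "v \<in> borel_measurable borel"
    and W: "u \<in> W_s s \<Omega>" "v \<in> W_s s \<Omega>" and off: "\<And>x. x \<notin> \<Omega> \<Longrightarrow> u x = v x"
  shows "integrable lborel (energy_diff s u v)"
proof (rule Bochner_Integration.integrable_bound)
  let ?F = "\<lambda>u (x, y). \<bar>u x * indicator \<Omega> x - u y * indicator \<Omega> y\<bar> * kernel (x - y)"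
  show "integrable lborel (\<lambda>z. 2 * (?F u z + ?F v z))"
    by (intro integrable_mult_right Bochner_Integration.integrable_add zero_extension_finite u v W)
  show "energy_diff s u v \<in> borel_measurable lborel"
    using borel_measurable_energy_diff[OF u v] by simp
  have "norm (energy_diff s u v (x, y)) \<le> norm (2 * (?F u (x, y) + ?F v (x, y)))" for x y
  proof -
    define w where "w u x = u x * indicator \<Omega> x" for u :: "real ^ 'n \<Rightarrow> real" and x
    have "u x - v x = w u x - w v x" for x using off[of x] by (auto simp: w_def indicator_def)
    then have "\<bar>(u x - v x) - (u y - v y)\<bar> \<le> \<bar>w u x - w u y\<bar> + \<bar>w v x - w v y\<bar>" by simp
    then have "2 * \<bar>(u x - v x) - (u y - v y)\<bar> * kernel (x - y)
        \<le> 2 * (\<bar>w u x - w u y\<bar> + \<bar>w v x - w v y\<bar>) * kernel (x - y)"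
      by (intro mult_right_mono) auto
    then show ?thesis using energy_diff_bound[of s u v x y] s_pos
      by (simp add: w_def distrib_right distrib_left)
  qed
  then show "AE z in lborel. norm (energy_diff s u v z) \<le> norm (2 * (?F u z + ?F v z))"
    by (intro AE_I2) (simp only: split_paired_all)
qed

text \<open>For Borel functions that agree at every point of the complement, the energy difference vanishes
identically outside \<open>Q_region \<Omega>\<close>. So all integrals may be taken over the whole space, with
respect to the product of Borel measures, where Fubini applies.\<close>

lemma energy_diff_eq_0_off:
  assumes "\<And>x. x \<notin> \<Omega> \<Longrightarrow> u x = v x" "z \<notin> Q_region \<Omega>"
  shows "energy_diff s u v z = 0"
proof -
  have "u (fst z) = v (fst z)" "u (snd z) = v (snd z)"
    using assms by (cases z; simp add: Q_region_def)+
  then show ?thesis by (simp add: energy_diff_def case_prod_unfold)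
qed

lemma set_integral_energy_diff:
  assumes u[measurable]: "u \<in> borel_measurable borel" and v[measurable]: "v \<in> borel_measurable borel"
    and off: "\<And>x. x \<notin> \<Omega> \<Longrightarrow> u x = v x"
  shows "set_integrable lebesgue (Q_region \<Omega>) (energy_diff s u v) \<longleftrightarrow> integrable lborel (energy_diff s u v)"
    and "set_lebesgue_integral lebesgue (Q_region \<Omega>) (energy_diff s u v) = integral\<^sup>L lborel (energy_diff s u v)"
proof -
  have eq: "(\<lambda>z. indicator (Q_region \<Omega>) z *\<^sub>R energy_diff s u v z) = energy_diff s u v"
  proof
    fix z show "indicator (Q_region \<Omega>) z *\<^sub>R energy_diff s u v z = energy_diff s u v z"
      using energy_diff_eq_0_off[OF off, where z=z] by (cases "z \<in> Q_region \<Omega>") auto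
  qed
  have m: "energy_diff s u v \<in> borel_measurable lborel"
    using borel_measurable_energy_diff[OF u v] by simp
  show "set_integrable lebesgue (Q_region \<Omega>) (energy_diff s u v) \<longleftrightarrow> integrable lborel (energy_diff s u v)"
    unfolding set_integrable_def eq by (rule integrable_completion[OF m])
  show "set_lebesgue_integral lebesgue (Q_region \<Omega>) (energy_diff s u v) = integral\<^sup>L lborel (energy_diff s u v)"
    unfolding set_lebesgue_integral_def eq by (rule integral_completion[OF m])
qed

end

section \<open>Truncation decreases the energy\<close>

definition truncate_on :: "'a set \<Rightarrow> real \<Rightarrow> ('a \<Rightarrow> real) \<Rightarrow> 'a \<Rightarrow> real" where
  "truncate_on \<Omega> M v x = (if x \<in> \<Omega> then max (- M) (min M (v x)) else v x)"

text \<open>If the value \<open>c\<close> at the other point is below the truncation level by the margin \<open>d\<close>, then all the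
slopes that are passed while \<open>a\<close> is pushed back to the level are at least \<open>G_s n s (d / r)\<close> in
absolute value. By convexity this is the rate at which energy is gained.\<close>

lemma calG_s_truncation_gain:
  fixes a c d M r :: real
  assumes "\<bar>c\<bar> \<le> M - d" "0 < r" "0 \<le> d"
  defines "a' \<equiv> max (- M) (min M a)"
  shows "calG_s n s ((a' - c) / r) - calG_s n s ((a - c) / r) \<le> - (G_s n s (d / r) * \<bar>a - a'\<bar> / r)"
proof -
  have tan: "calG_s n s ((a' - c) / r) - calG_s n s ((a - c) / r)
      \<le> - (G_s n s ((a' - c) / r) * ((a - a') / r))"
  proof -
    have "(a - c) / r - (a' - c) / r = (a - a') / r" by (simp add: diff_divide_distrib)
    then show ?thesis using calG_s_tangent[of n s "(a' - c) / r" "(a - c) / r"] by simp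
  qed
  consider "M < a" | "a < - M" | "a' = a" unfolding a'_def by linarith
  then show ?thesis
  proof cases
    case 1
    then have a': "a' = M" using assms by (simp add: a'_def)
    have "G_s n s (d / r) \<le> G_s n s ((a' - c) / r)"
      using assms by (intro G_s_mono divide_right_mono) (auto simp: a')
    then have "G_s n s (d / r) * ((a - a') / r) \<le> G_s n s ((a' - c) / r) * ((a - a') / r)"
      using 1 assms by (intro mult_right_mono) (auto simp: a')
    then show ?thesis using tan 1 by (simp add: a')
  next
    case 2
    then have a': "a' = - M" using assms by (simp add: a'_def)
    have "G_s n s ((a' - c) / r) \<le> G_s n s (- (d / r))"
      unfolding minus_divide_left using assms by (intro G_s_mono divide_right_mono) (auto simp: a')
    then have "G_s n s (d / r) \<le> - G_s n s ((a' - c) / r)" by (simp add: G_s_minus)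
    then have "G_s n s (d / r) * ((a' - a) / r) \<le> - G_s n s ((a' - c) / r) * ((a' - a) / r)"
      using 2 assms by (intro mult_right_mono) (auto simp: a')
    also have "\<dots> = G_s n s ((a' - c) / r) * ((a - a') / r)"
      by (simp add: diff_divide_distrib algebra_simps)
    finally have "G_s n s (d / r) * ((a' - a) / r) \<le> G_s n s ((a' - c) / r) * ((a - a') / r)" .
    moreover have abs: "\<bar>a - a'\<bar> = a' - a" using 2 a' by simp
    ultimately show ?thesis using tan unfolding abs times_divide_eq_right[symmetric] by linarith
  qed simp
qed

text \<open>An upper bound for the change of energy per unit of truncated height, caused by an exterior point
at displacement \<open>z\<close>. Points at distance between \<open>d\<close> and \<open>2 * d\<close> yield a gain, with slope at least
\<open>G_s n s (1/2)\<close> since \<open>d / norm z \<ge> 1/2\<close>. Points beyond \<open>\<Theta> * d\<close>, where nothing is known about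
the exterior data, cost at most the Lipschitz constant \<open>2\<close>. The remaining points are favourable and
are bounded by zero.\<close>

definition truncation_kernel :: "real \<Rightarrow> real \<Rightarrow> real \<Rightarrow> real ^ 'n \<Rightarrow> real" where
  "truncation_kernel s \<Theta> d z = norm z powr - (real CARD('n) + s) *
     (2 * indicator {z. \<Theta> * d \<le> norm z} z
      - G_s CARD('n) s (1/2) * indicator {z. d < norm z \<and> norm z < 2 * d} z)"

text \<open>By scaling, the gain is a constant times \<open>d powr - s\<close> and the cost a constant times
\<open>(\<Theta> * d) powr - s\<close>. A large \<open>\<Theta>\<close> depending only on the dimension and \<open>s\<close> makes the gain dominate for
all \<open>d\<close> at once. This is the origin of the constant in the theorem.\<close>

lemma exists_truncation_radius:
  fixes s :: real
  assumes s: "0 < s"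
  obtains \<Theta> where "2 \<le> \<Theta>"
    "\<And>d. 0 < d \<Longrightarrow> integrable lborel (truncation_kernel s \<Theta> d :: real ^ 'n \<Rightarrow> real)"
    "\<And>d. 0 < d \<Longrightarrow> integral\<^sup>L lborel (truncation_kernel s \<Theta> d :: real ^ 'n \<Rightarrow> real) \<le> 0"
proof -
  let ?p = "real CARD('n) + s"
  let ?G = "G_s CARD('n) s (1/2)"
  let ?k = "\<lambda>z :: real ^ 'n. norm z powr - ?p"
  let ?V = "unit_ball_vol (real CARD('n)) * 2 powr - ?p"
  have dp: "real DIM(real ^ 'n) < ?p" using s by simp
  obtain C where C: "0 < C" "\<And>R. 0 < R \<Longrightarrow>
      (\<integral>\<^sup>+z. ennreal (?k z) * indicator {z. R \<le> norm z} z \<partial>lborel)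
        \<le> ennreal (C * R powr (real DIM(real ^ 'n) - ?p))"
    by (rule kernel_tail_le[where 'a="real ^ 'n", OF dp]) (rule that)
  have G: "0 < ?G" by (rule G_s_pos) simp
  have V: "0 < ?V" by simp
  \<comment> \<open>The ratio of cost to gain at \<open>\<Theta> = 1\<close>; it decreases like \<open>\<Theta> powr - s\<close>.\<close>
  define K where "K = 2 * C / (?G * ?V)"
  have K: "0 < K" using C G V by (simp add: K_def)
  define \<Theta> where "\<Theta> = max 2 (K powr (1 / s))"
  have \<Theta>: "2 \<le> \<Theta>" by (simp add: \<Theta>_def)
  have "K = (K powr (1 / s)) powr s" using K s by (simp add: powr_powr)
  also have "\<dots> \<le> \<Theta> powr s" using s by (intro powr_mono2) (auto simp: \<Theta>_def)
  finally have K\<Theta>: "K * \<Theta> powr - s \<le> 1" using \<Theta> by (simp add: powr_minus field_simps)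
  have both: "integrable lborel (truncation_kernel s \<Theta> d :: real ^ 'n \<Rightarrow> real) \<and>
      integral\<^sup>L lborel (truncation_kernel s \<Theta> d :: real ^ 'n \<Rightarrow> real) \<le> 0" if d: "0 < d" for d
  proof -
    define f where "f z = 2 * norm z powr - ?p * indicator {z. \<Theta> * d \<le> norm z} z" for z :: "real ^ 'n"
    define g where "g z = ?G * norm z powr - ?p * indicator {z. d < norm z \<and> norm z < 2 * d} z" for z :: "real ^ 'n"
    have [measurable]: "f \<in> borel_measurable borel" "g \<in> borel_measurable borel"
      unfolding f_def g_def by measurable
    have nonneg: "0 \<le> f z" "0 \<le> g z" for z using G by (auto simp: f_def g_def)
    have tail: "(\<integral>\<^sup>+z. ennreal (?k z) * indicator {z. R \<le> norm z} z \<partial>lborel)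
        \<le> ennreal (C * R powr - s)" if "0 < R" for R
      using C(2)[OF that] by simp
    have "(\<integral>\<^sup>+z. ennreal (f z) \<partial>lborel)
        = (\<integral>\<^sup>+z. 2 * (ennreal (?k z) * indicator {z. \<Theta> * d \<le> norm z} z) \<partial>lborel)"
      by (intro nn_integral_cong) (auto simp: f_def indicator_def ennreal_mult')
    also have "\<dots> = 2 * (\<integral>\<^sup>+z. ennreal (?k z) * indicator {z. \<Theta> * d \<le> norm z} z \<partial>lborel)"
      by (rule nn_integral_cmult) measurable
    also have "\<dots> \<le> 2 * ennreal (C * (\<Theta> * d) powr - s)"
      using \<Theta> d by (intro mult_left_mono tail) auto
    also have "\<dots> = ennreal (2 * C * \<Theta> powr - s * d powr - s)"
      using C(1) \<Theta> d by (simp add: ennreal_mult' powr_mult mult.assoc)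
    finally have f_le: "(\<integral>\<^sup>+z. ennreal (f z) \<partial>lborel) \<le> ennreal (2 * C * \<Theta> powr - s * d powr - s)" .
    have "?G * ?V \<noteq> 0" using mult_pos_pos[OF G V] by linarith
    then have "2 * C = K * (?G * ?V)"
      by (metis K_def nonzero_eq_divide_eq)
    then have "2 * C * \<Theta> powr - s * d powr - s = (K * \<Theta> powr - s) * (?G * ?V * d powr - s)" by simp
    also have "\<dots> \<le> 1 * (?G * ?V * d powr - s)" using K\<Theta> G V by (intro mult_right_mono) auto
    finally have cmp: "2 * C * \<Theta> powr - s * d powr - s \<le> ?G * (?V * d powr - s)" by simp
    have "ennreal (?G * (?V * d powr - s)) = ennreal ?G * ennreal (?V * d powr - s)"
      using G by (simp add: ennreal_mult')
    also have "\<dots> \<le> ennreal ?G * (\<integral>\<^sup>+z. ennreal (?k z) * indicator {z. d < norm z \<and> norm z < 2 * d} z \<partial>lborel)"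
      using kernel_annulus_ge[where 'a="real ^ 'n", OF d, of ?p] s by (intro mult_left_mono) auto
    also have "\<dots> = (\<integral>\<^sup>+z. ennreal ?G * (ennreal (?k z) * indicator {z. d < norm z \<and> norm z < 2 * d} z) \<partial>lborel)"
      by (rule nn_integral_cmult[symmetric]) measurable
    also have "\<dots> = (\<integral>\<^sup>+z. ennreal (g z) \<partial>lborel)"
      using G by (intro nn_integral_cong) (auto simp: g_def indicator_def ennreal_mult')
    finally have g_ge: "ennreal (?G * (?V * d powr - s)) \<le> (\<integral>\<^sup>+z. ennreal (g z) \<partial>lborel)" .
    have fg: "(\<integral>\<^sup>+z. ennreal (f z) \<partial>lborel) \<le> (\<integral>\<^sup>+z. ennreal (g z) \<partial>lborel)"
      using f_le cmp g_ge by (meson ennreal_leI order_trans)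
    have "(\<integral>\<^sup>+z. ennreal (g z) \<partial>lborel)
        \<le> (\<integral>\<^sup>+z. ennreal ?G * (ennreal (?k z) * indicator {z. d \<le> norm z} z) \<partial>lborel)"
      using G by (intro nn_integral_mono) (auto simp: g_def indicator_def ennreal_mult')
    also have "\<dots> = ennreal ?G * (\<integral>\<^sup>+z. ennreal (?k z) * indicator {z. d \<le> norm z} z \<partial>lborel)"
      by (rule nn_integral_cmult) measurable
    also have "\<dots> \<le> ennreal ?G * ennreal (C * d powr - s)" by (intro mult_left_mono tail d) simp
    also have "\<dots> < \<infinity>" by (simp add: ennreal_mult_less_top)
    finally have g_fin: "(\<integral>\<^sup>+z. ennreal (g z) \<partial>lborel) < \<infinity>" .
    have f_int: "integrable lborel f" and g_int: "integrable lborel g"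
      using fg g_fin nonneg by (auto intro!: integrableI_nonneg elim: order_le_less_trans)
    have eq: "truncation_kernel s \<Theta> d = (\<lambda>z. f z - g z)"
      by (auto simp: truncation_kernel_def f_def g_def algebra_simps)
    have "integral\<^sup>L lborel f \<le> integral\<^sup>L lborel g"
      using fg g_fin nonneg by (subst (1 2) integral_eq_nn_integral) (auto intro!: enn2real_mono)
    then show ?thesis unfolding eq using f_int g_int by simp
  qed
  show ?thesis by (rule that[OF \<Theta>]) (use both in auto)
qed

lemma integrable_convolution_form:
  fixes f b :: "'a::euclidean_space \<Rightarrow> real"
  assumes f: "integrable lborel f" and b: "integrable lborel b"
  shows "integrable lborel (\<lambda>(x, y). f x * b (x - y))"
    and "(LINT z|lborel. (case z of (x, y) \<Rightarrow> f x * b (x - y))) = integral\<^sup>L lborel f * integral\<^sup>L lborel b"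
proof -
  have [measurable]: "f \<in> borel_measurable borel" "b \<in> borel_measurable borel"
    using f b by (auto dest: borel_measurable_integrable)
  have refl_int: "integrable lborel (\<lambda>y. g (x - y))" and refl: "(LINT y|lborel. g (x - y)) = integral\<^sup>L lborel g"
    if g: "integrable lborel g" for g :: "'a \<Rightarrow> real" and x
  proof -
    have [measurable]: "g \<in> borel_measurable borel" using borel_measurable_integrable[OF g] by simp
    have "integrable (distr lborel borel (\<lambda>y. x - y)) g" using g by (simp add: lborel_distr_reflect)
    then show "integrable lborel (\<lambda>y. g (x - y))" by (subst (asm) integrable_distr_eq) auto
    have "integral\<^sup>L (distr lborel borel (\<lambda>y. x - y)) g = (LINT y|lborel. g (x - y))"
      by (rule integral_distr) auto
    then show "(LINT y|lborel. g (x - y)) = integral\<^sup>L lborel g" by (simp add: lborel_distr_reflect)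
  qed
  have ab: "integrable lborel (\<lambda>z. \<bar>b z\<bar>)" using b by simp
  have norm_int: "(LINT y|lborel. norm (f x * b (x - y))) = \<bar>f x\<bar> * (LINT z|lborel. \<bar>b z\<bar>)" for x
    using refl[OF ab, of x] by (simp add: abs_mult)
  have int: "integrable (lborel \<Otimes>\<^sub>M lborel) (\<lambda>(x, y). f x * b (x - y))"
  proof (rule lborel_pair.Fubini_integrable)
    show "integrable lborel (\<lambda>x. LINT y|lborel. norm (case (x, y) of (x, y) \<Rightarrow> f x * b (x - y)))"
      using f norm_int by simp
    show "AE x in lborel. integrable lborel (\<lambda>y. case (x, y) of (x, y) \<Rightarrow> f x * b (x - y))"
      using refl_int[OF b] by simp
  qed measurable
  then show "integrable lborel (\<lambda>(x, y). f x * b (x - y))" by (simp add: lborel_prod)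
  have "(LINT z|lborel. (case z of (x, y) \<Rightarrow> f x * b (x - y))) = (LINT x|lborel. LINT y|lborel. f x * b (x - y))"
    using lborel_pair.integral_fst'[OF int] by (simp add: lborel_prod)
  also have "\<dots> = integral\<^sup>L lborel f * integral\<^sup>L lborel b" using refl[OF b] by simp
  finally show "(LINT z|lborel. (case z of (x, y) \<Rightarrow> f x * b (x - y))) = integral\<^sup>L lborel f * integral\<^sup>L lborel b" .
qed

lemma integrable_convolution_form_swap:
  fixes f b :: "'a::euclidean_space \<Rightarrow> real"
  assumes f: "integrable lborel f" and b: "integrable lborel b" and even: "\<And>z. b (- z) = b z"
  shows "integrable lborel (\<lambda>(x, y). f y * b (x - y))"
    and "(LINT z|lborel. (case z of (x, y) \<Rightarrow> f y * b (x - y))) = integral\<^sup>L lborel f * integral\<^sup>L lborel b"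
proof -
  have sym: "b (x - y) = b (y - x)" for x y using even[of "y - x"] by simp
  have int: "integrable (lborel \<Otimes>\<^sub>M lborel) (\<lambda>(x, y). f x * b (x - y))"
    using integrable_convolution_form(1)[OF f b] by (simp add: lborel_prod)
  have "integrable (lborel \<Otimes>\<^sub>M lborel) (\<lambda>(x, y). f y * b (y - x))"
    using lborel_pair.integrable_product_swap[OF int] by simp
  then show "integrable lborel (\<lambda>(x, y). f y * b (x - y))" by (simp add: lborel_prod sym)
  have "(LINT z|(lborel \<Otimes>\<^sub>M lborel). (case z of (x, y) \<Rightarrow> f y * b (y - x)))
      = (LINT z|(lborel \<Otimes>\<^sub>M lborel). (case z of (x, y) \<Rightarrow> f x * b (x - y)))"
    using lborel_pair.integral_product_swap[OF borel_measurable_integrable[OF int]] by simp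
  then show "(LINT z|lborel. (case z of (x, y) \<Rightarrow> f y * b (x - y))) = integral\<^sup>L lborel f * integral\<^sup>L lborel b"
    using integrable_convolution_form(2)[OF f b] by (simp add: lborel_prod sym)
qed

lemma energy_diff_swap: "energy_diff s u v (y, x) = energy_diff s u v (x, y)"
proof -
  have "calG_s n s ((w y - w x) / norm (y - x)) = calG_s n s ((w x - w y) / norm (x - y))" for w :: "_ \<Rightarrow> real" and n
    using calG_s_minus[of n s "(w x - w y) / norm (x - y)"]
    by (simp add: minus_divide_left norm_minus_commute)
  then show ?thesis by (simp add: energy_diff_def norm_minus_commute)
qed

lemma open_diameter_pos:
  fixes S :: "'a::euclidean_space set"
  assumes "open S" "bounded S" "S \<noteq> {}" shows "0 < diameter S"
proof -
  obtain x where x: "x \<in> S" using assms by blast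
  have "S \<noteq> {x}" using assms(1) not_open_singleton by metis
  then obtain y where "y \<in> S" "y \<noteq> x" using x by blast
  then show ?thesis using diameter_bounded_bound[OF assms(2) x, of y] by (smt (verit) zero_less_dist_iff)
qed

context fractional_domain begin

lemma borel_measurable_truncate_on [measurable]:
  assumes [measurable]: "v \<in> borel_measurable borel"
  shows "truncate_on \<Omega> M v \<in> borel_measurable borel"
  unfolding truncate_on_def[abs_def] by measurable

lemma truncate_on_in_W_s:
  assumes v[measurable]: "v \<in> borel_measurable borel" and W: "v \<in> W_s s \<Omega>" and M: "0 \<le> M"
  shows "truncate_on \<Omega> M v \<in> W_s s \<Omega>"
proof -
  let ?T = "truncate_on \<Omega> M v"
  have vW: "(\<integral>\<^sup>+x. ennreal \<bar>v x\<bar> * indicator \<Omega> x \<partial>lborel) < \<infinity>"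
    "ring_energy \<Omega> (real CARD('n) + s) v UNIV < \<infinity>"
    using W W_s_borel_iff[OF v open_domain] by auto
  have "(\<integral>\<^sup>+x. ennreal \<bar>?T x\<bar> * indicator \<Omega> x \<partial>lborel) \<le> (\<integral>\<^sup>+x. ennreal \<bar>v x\<bar> * indicator \<Omega> x \<partial>lborel)"
    using M by (intro nn_integral_mono mult_right_mono ennreal_leI) (auto simp: truncate_on_def)
  moreover have "ring_energy \<Omega> (real CARD('n) + s) ?T UNIV \<le> ring_energy \<Omega> (real CARD('n) + s) v UNIV"
    unfolding ring_energy_def
  proof (intro nn_integral_mono)
    fix x y :: "real ^ 'n"
    show "ennreal (\<bar>?T x - ?T y\<bar> * kernel (x - y)) * (indicator \<Omega> x * indicator \<Omega> y * indicator UNIV (norm (x - y)))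
      \<le> ennreal (\<bar>v x - v y\<bar> * kernel (x - y)) * (indicator \<Omega> x * indicator \<Omega> y * indicator UNIV (norm (x - y)))"
    proof (cases "x \<in> \<Omega> \<and> y \<in> \<Omega>")
      case True
      then have "\<bar>?T x - ?T y\<bar> \<le> \<bar>v x - v y\<bar>" unfolding truncate_on_def by auto
      then show ?thesis by (intro mult_right_mono ennreal_leI) auto
    qed auto
  qed
  ultimately show ?thesis
    using vW borel_measurable_truncate_on[OF v, of M] W_s_borel_iff[OF _ open_domain, of ?T s]
    by (auto intro: order_le_less_trans)
qed

text \<open>Exterior points within distance \<open>\<Theta> * d\<close> of \<open>x\<close> lie in the enlargement, where the data are bounded by
\<open>M - d\<close>, so truncation at \<open>M\<close> gains there; farther points are handled by the Lipschitz bound.\<close>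

lemma truncation_pointwise:
  fixes v :: "real ^ 'n \<Rightarrow> real" and M \<Theta> :: real
  defines "d \<equiv> diameter \<Omega>"
  assumes \<Theta>: "2 \<le> \<Theta>" and xy: "x \<in> \<Omega>" "y \<notin> \<Omega>"
    and c: "y \<in> enlargement \<Omega> (\<Theta> * d) - \<Omega> \<Longrightarrow> \<bar>v y\<bar> \<le> M - d"
  shows "energy_diff s (truncate_on \<Omega> M v) v (x, y)
    \<le> \<bar>v x - truncate_on \<Omega> M v x\<bar> * truncation_kernel s \<Theta> d (x - y)"
proof -
  let ?T = "truncate_on \<Omega> M v" and ?n = "CARD('n)"
  define r where "r = norm (x - y)"
  have r: "0 < r" using xy by (auto simp: r_def)
  have d: "0 < d" unfolding d_def using xy by (intro open_diameter_pos open_domain bounded_domain) auto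
  have dr: "d / r * r = d" using r by simp
  have Ty: "?T y = v y" using xy by (simp add: truncate_on_def)
  have kr: "kernel (x - y) = 1 / (r * r powr (real ?n - 1 + s))"
  proof -
    have "r powr 1 * r powr (real ?n - 1 + s) = r powr (real ?n + s)"
      by (subst powr_add[symmetric]) simp
    then have "r * r powr (real ?n - 1 + s) = r powr (real ?n + s)" using r by simp
    then show ?thesis by (simp only: powr_minus_divide r_def[symmetric])
  qed
  show ?thesis
  proof (cases "\<Theta> * d \<le> r")
    case True
    have "2 * d \<le> \<Theta> * d" using \<Theta> d by (intro mult_right_mono) auto
    then have "truncation_kernel s \<Theta> d (x - y) = 2 * kernel (x - y)"
      using True by (simp add: truncation_kernel_def r_def)
    then show ?thesis
      using energy_diff_bound[of s ?T v x y] s_pos Ty by (simp add: abs_minus_commute mult_ac)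
  next
    case False
    have "\<Omega> \<noteq> {}" using xy by auto
    have "signed_dist \<Omega> y = infdist y \<Omega>" using xy by (simp add: signed_dist_def)
    also have "\<dots> \<le> dist y x" using xy by (intro infdist_le)
    finally have "signed_dist \<Omega> y < \<Theta> * d" using False by (simp add: r_def dist_norm norm_minus_commute)
    then have "\<bar>v y\<bar> \<le> M - d" using c xy by (simp add: enlargement_def)
    from calG_s_truncation_gain[OF this r less_imp_le[OF d], of ?n s "v x"]
    have "calG_s ?n s ((?T x - v y) / r) - calG_s ?n s ((v x - v y) / r)
        \<le> - (G_s ?n s (d / r) * \<bar>v x - ?T x\<bar> / r)"
      using xy by (simp add: truncate_on_def)
    then have "energy_diff s ?T v (x, y) \<le> - (G_s ?n s (d / r) * \<bar>v x - ?T x\<bar> / r) / r powr (real ?n - 1 + s)"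
      unfolding energy_diff_def prod.case Ty r_def[symmetric] by (intro divide_right_mono) auto
    also have "\<dots> = \<bar>v x - ?T x\<bar> * (kernel (x - y) * (- G_s ?n s (d / r)))"
      unfolding kr by simp
    also have "\<dots> \<le> \<bar>v x - ?T x\<bar> * truncation_kernel s \<Theta> d (x - y)"
    proof (intro mult_left_mono abs_ge_zero)
      show "kernel (x - y) * (- G_s ?n s (d / r)) \<le> truncation_kernel s \<Theta> d (x - y)"
      proof (cases "d < r \<and> r < 2 * d")
        case True
        then have "G_s ?n s (1/2) \<le> G_s ?n s (d / r)" using r by (intro G_s_mono) (simp add: field_simps)
        then have "kernel (x - y) * (- G_s ?n s (d / r)) \<le> kernel (x - y) * (- G_s ?n s (1/2))"
          by (intro mult_left_mono) auto
        then show ?thesis using True False by (simp add: truncation_kernel_def r_def)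
      next
        case neither: False
        have "0 \<le> G_s ?n s (d / r)" using G_s_mono[of 0 "d / r" ?n s] d r by simp
        then have "kernel (x - y) * (- G_s ?n s (d / r)) \<le> 0" by (simp add: mult_nonneg_nonneg)
        moreover have "truncation_kernel s \<Theta> d (x - y) = 0"
          using neither False by (auto simp: truncation_kernel_def r_def)
        ultimately show ?thesis by simp
      qed
    qed
    finally show ?thesis .
  qed
qed

lemma truncation_kernel_minus: "truncation_kernel s \<Theta> d (- z) = truncation_kernel s \<Theta> d z"
  by (simp add: truncation_kernel_def indicator_def)

lemma integrable_on_domain:
  assumes v[measurable]: "v \<in> borel_measurable borel" and W: "v \<in> W_s s \<Omega>"
  shows "integrable lborel (\<lambda>x. v x * indicator \<Omega> x)"
proof (rule integrableI_bounded)
  have "(\<integral>\<^sup>+x. ennreal (norm (v x * indicator \<Omega> x)) \<partial>lborel) = (\<integral>\<^sup>+x. ennreal \<bar>v x\<bar> * indicator \<Omega> x \<partial>lborel)"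
    by (intro nn_integral_cong) (auto simp: indicator_def)
  then show "(\<integral>\<^sup>+x. ennreal (norm (v x * indicator \<Omega> x)) \<partial>lborel) < \<infinity>"
    using W W_s_borel_iff[OF v open_domain] by auto
qed measurable

text \<open>Pairs of points inside \<open>\<Omega>\<close> never lose, because truncation is a contraction. For interior \<open>x\<close> all
points at distance more than the diameter are exterior, so the interaction is bounded by the
truncated height times the full integral of \<open>truncation_kernel\<close>, which is nonpositive.\<close>

lemma energy_truncation_le:
  fixes v :: "real ^ 'n \<Rightarrow> real" and M \<Theta> :: real
  defines "d \<equiv> diameter \<Omega>"
  assumes v[measurable]: "v \<in> borel_measurable borel" and W: "v \<in> W_s s \<Omega>" and M: "0 \<le> M" and \<Theta>: "2 \<le> \<Theta>"
    and ker_int: "0 < d \<Longrightarrow> integrable lborel (truncation_kernel s \<Theta> d :: real ^ 'n \<Rightarrow> real)"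
    and ker_le: "0 < d \<Longrightarrow> integral\<^sup>L lborel (truncation_kernel s \<Theta> d :: real ^ 'n \<Rightarrow> real) \<le> 0"
    and ext: "AE x in lborel. x \<in> enlargement \<Omega> (\<Theta> * d) - \<Omega> \<longrightarrow> \<bar>v x\<bar> \<le> M - d"
  shows "integral\<^sup>L lborel (energy_diff s (truncate_on \<Omega> M v) v) \<le> 0"
proof (cases "\<Omega> = {}")
  case True
  then have "truncate_on \<Omega> M v = v" by (auto simp: truncate_on_def)
  then have "energy_diff s (truncate_on \<Omega> M v) v = (\<lambda>_. 0)" by auto
  then show ?thesis by simp
next
  case False
  have d: "0 < d" unfolding d_def by (intro open_diameter_pos open_domain bounded_domain False)
  let ?T = "truncate_on \<Omega> M v"
  define f where "f x = \<bar>v x - ?T x\<bar>" for x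
  define b where "b = (truncation_kernel s \<Theta> d :: real ^ 'n \<Rightarrow> real)"
  have TW: "?T \<in> W_s s \<Omega>" by (rule truncate_on_in_W_s[OF v W M])
  have T_meas: "?T \<in> borel_measurable borel" by measurable
  have off: "?T x = v x" if "x \<notin> \<Omega>" for x using that by (simp add: truncate_on_def)
  have "integrable lborel (\<lambda>x. \<bar>v x * indicator \<Omega> x - ?T x * indicator \<Omega> x\<bar>)"
    by (intro integrable_abs Bochner_Integration.integrable_diff integrable_on_domain v W TW T_meas)
  moreover have "(\<lambda>x. \<bar>v x * indicator \<Omega> x - ?T x * indicator \<Omega> x\<bar>) = f"
    by (auto simp: f_def truncate_on_def indicator_def)
  ultimately have f_int: "integrable lborel f" by simp
  have b_int: "integrable lborel b" unfolding b_def by (rule ker_int[OF d])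
  have b_even: "b (- z) = b z" for z by (simp add: b_def truncation_kernel_minus)
  note F1 = integrable_convolution_form[OF f_int b_int]
  note F2 = integrable_convolution_form_swap[OF f_int b_int b_even]
  have pt: "energy_diff s ?T v (x, y) \<le> f x * b (x - y) + f y * b (x - y)"
    if x: "x \<in> enlargement \<Omega> (\<Theta> * d) - \<Omega> \<longrightarrow> \<bar>v x\<bar> \<le> M - d"
      and y: "y \<in> enlargement \<Omega> (\<Theta> * d) - \<Omega> \<longrightarrow> \<bar>v y\<bar> \<le> M - d" for x y
  proof -
    consider "x \<in> \<Omega>" "y \<in> \<Omega>" | "x \<in> \<Omega>" "y \<notin> \<Omega>" | "x \<notin> \<Omega>" "y \<in> \<Omega>" | "x \<notin> \<Omega>" "y \<notin> \<Omega>" by blast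
    then show ?thesis
    proof cases
      case 1
      have "norm (x - y) \<le> d" using diameter_bounded_bound[OF bounded_domain 1] by (simp add: d_def dist_norm)
      moreover have "d < \<Theta> * d" using \<Theta> d by simp
      ultimately have "b (x - y) = 0" by (simp add: b_def truncation_kernel_def)
      moreover have "\<bar>?T x - ?T y\<bar> \<le> \<bar>v x - v y\<bar>" using 1 by (auto simp: truncate_on_def)
      then have "\<bar>(?T x - ?T y) / norm (x - y)\<bar> \<le> \<bar>(v x - v y) / norm (x - y)\<bar>"
        by (simp add: abs_divide divide_right_mono)
      then have "energy_diff s ?T v (x, y) \<le> 0"
        unfolding energy_diff_def prod.case by (intro divide_nonpos_nonneg) (auto intro: calG_s_mono_abs)
      ultimately show ?thesis by simp
    next
      case 2
      have "f y = 0" using 2 off by (simp add: f_def)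
      then show ?thesis using truncation_pointwise[OF \<Theta> 2, of v M] y by (simp add: f_def b_def d_def)
    next
      case 3
      have "f x = 0" using 3 off by (simp add: f_def)
      moreover have "b (x - y) = b (y - x)" using b_even[of "y - x"] by simp
      ultimately show ?thesis using truncation_pointwise[OF \<Theta> 3(2,1), of v M] x
        by (simp add: f_def b_def d_def energy_diff_swap[of s _ _ x y])
    next
      case 4
      then show ?thesis using off by (simp add: f_def energy_diff_def)
    qed
  qed
  have "integral\<^sup>L lborel (energy_diff s ?T v)
      \<le> (LINT z|lborel. (case z of (x, y) \<Rightarrow> f x * b (x - y)) + (case z of (x, y) \<Rightarrow> f y * b (x - y)))"
  proof (rule integral_mono_AE)
    show "integrable lborel (energy_diff s ?T v)"
      by (rule integrable_energy_diff[OF T_meas v TW W off])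
    show "integrable lborel (\<lambda>z. (case z of (x, y) \<Rightarrow> f x * b (x - y)) + (case z of (x, y) \<Rightarrow> f y * b (x - y)))"
      by (intro Bochner_Integration.integrable_add F1(1) F2(1))
    show "AE z in lborel. energy_diff s ?T v z
        \<le> (case z of (x, y) \<Rightarrow> f x * b (x - y)) + (case z of (x, y) \<Rightarrow> f y * b (x - y))"
      using AE_lborel_pair[OF ext]
    proof eventually_elim
      case (elim z)
      show ?case using pt[of "fst z" "snd z"] elim by (cases z) simp
    qed
  qed
  also have "\<dots> = 2 * (integral\<^sup>L lborel f * integral\<^sup>L lborel b)"
    by (subst Bochner_Integration.integral_add[OF F1(1) F2(1)]) (simp add: F1(2) F2(2))
  also have "\<dots> \<le> 0"
  proof -
    have "0 \<le> integral\<^sup>L lborel f" by (intro integral_nonneg_AE) (simp add: f_def)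
    then show ?thesis using ker_le[OF d] by (simp add: b_def mult_nonneg_nonpos)
  qed
  finally show ?thesis .
qed

end

section \<open>Minimising sequences that converge almost everywhere\<close>

text \<open>Strong convergence comes from a second minimisation. Among the nearly minimal elements of level \<open>k\<close> choose one that also
nearly minimises a quadratic functional \<open>N\<close>. The sublevel sets of the convex functional \<open>J\<close> are closed under
midpoints, so the midpoint of two chosen elements is again a candidate, and the parallelogram law
bounds their distance by the increments of the infima of \<open>N\<close>. These infima increase and are bounded,
so the sequence is Cauchy.\<close>

lemma near_minimal_sequence:
  fixes J N :: "'b \<Rightarrow> real" and mid :: "'b \<Rightarrow> 'b \<Rightarrow> 'b"
  assumes ne: "X \<noteq> {}" and mid: "\<And>u v. u \<in> X \<Longrightarrow> v \<in> X \<Longrightarrow> mid u v \<in> X"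
    and J_mid: "\<And>u v. u \<in> X \<Longrightarrow> v \<in> X \<Longrightarrow> 2 * J (mid u v) \<le> J u + J v"
    and J_bdd: "bdd_below (J ` X)" and N: "\<And>u. u \<in> X \<Longrightarrow> 0 \<le> N u" "\<And>u. u \<in> X \<Longrightarrow> N u \<le> B"
  obtains w where "\<And>k. w k \<in> X" "\<And>k. J (w k) \<le> Inf (J ` X) + 1 / (real k + 1)"
    "\<And>\<epsilon>. 0 < \<epsilon> \<Longrightarrow> \<exists>K. \<forall>k\<ge>K. \<forall>l\<ge>K. 2 * N (w k) + 2 * N (w l) - 4 * N (mid (w k) (w l)) < \<epsilon>"
proof -
  define I where "I = Inf (J ` X)"
  define \<eta> where "\<eta> k = 1 / (real k + 1)" for k :: nat
  \<comment> \<open>The levels stay strictly above the infimum, so no minimiser has to exist for these to be nonempty.\<close>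
  define S where "S k = {u \<in> X. J u \<le> I + \<eta> k}" for k
  define a where "a k = Inf (N ` S k)" for k
  have \<eta>: "0 < \<eta> k" for k by (simp add: \<eta>_def)
  have \<eta>_mono: "k \<le> l \<Longrightarrow> \<eta> l \<le> \<eta> k" for k l by (simp add: \<eta>_def frac_le)
  have S_ne: "S k \<noteq> {}" for k
  proof -
    have "Inf (J ` X) < I + \<eta> k" using \<eta> by (simp add: I_def)
    then obtain u where "u \<in> X" "J u < I + \<eta> k"
      using cInf_lessD[of "J ` X"] ne by blast
    then show ?thesis by (auto simp: S_def)
  qed
  have S_anti: "k \<le> l \<Longrightarrow> S l \<subseteq> S k" for k l using \<eta>_mono[of k l] by (auto simp: S_def)
  have bdd: "bdd_below (N ` S k)" for k using N(1) by (intro bdd_belowI[of _ 0]) (auto simp: S_def)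
  have a_le: "u \<in> S k \<Longrightarrow> a k \<le> N u" for u k unfolding a_def using bdd by (intro cInf_lower) auto
  have "\<exists>u. u \<in> S k \<and> N u < a k + \<eta> k" for k
  proof -
    have "Inf (N ` S k) < a k + \<eta> k" using \<eta> by (simp add: a_def)
    then show ?thesis using cInf_lessD[of "N ` S k"] S_ne[of k] by blast
  qed
  then obtain w where w: "\<And>k. w k \<in> S k" "\<And>k. N (w k) < a k + \<eta> k" by metis
  have "incseq a"
  proof (rule incseq_SucI)
    fix k show "a k \<le> a (Suc k)" unfolding a_def
      using S_anti[of k "Suc k"] bdd S_ne by (intro cInf_superset_mono) auto
  qed
  moreover have "a k \<le> B" for k
  proof -
    have "w k \<in> X" using w(1)[of k] by (simp add: S_def)
    then show ?thesis using a_le[OF w(1)[of k]] N(2) by force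
  qed
  ultimately have "convergent a" by (meson Bseq_mono_convergent incseq_def incseq_convergent convergentI)
  then have Ca: "Cauchy a" by (simp add: Cauchy_convergent_iff)
  show ?thesis
  proof (rule that)
    show "w k \<in> X" for k using w(1)[of k] by (simp add: S_def)
    show "J (w k) \<le> Inf (J ` X) + 1 / (real k + 1)" for k using w(1)[of k] by (simp add: S_def I_def \<eta>_def)
    fix \<epsilon> :: real assume \<epsilon>: "0 < \<epsilon>"
    obtain K1 where K1: "\<And>k l. k \<ge> K1 \<Longrightarrow> l \<ge> K1 \<Longrightarrow> \<bar>a k - a l\<bar> < \<epsilon> / 4"
      using Ca \<epsilon> unfolding Cauchy_def dist_real_def by (metis divide_pos_pos zero_less_numeral)
    obtain K2 where K2: "1 / (real K2 + 1) < \<epsilon> / 8"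
      using reals_Archimedean[of "\<epsilon> / 8"] \<epsilon> by (auto simp: inverse_eq_divide add.commute)
    show "\<exists>K. \<forall>k\<ge>K. \<forall>l\<ge>K. 2 * N (w k) + 2 * N (w l) - 4 * N (mid (w k) (w l)) < \<epsilon>"
    proof (intro exI allI impI)
      fix k l assume kl: "max K1 K2 \<le> k" "max K1 K2 \<le> l"
      let ?m = "min k l"
      have "w k \<in> S ?m" "w l \<in> S ?m" using w(1) S_anti[of ?m k] S_anti[of ?m l] by auto
      then have "mid (w k) (w l) \<in> S ?m"
        using mid[of "w k" "w l"] J_mid[of "w k" "w l"] by (auto simp: S_def)
      then have "a ?m \<le> N (mid (w k) (w l))" by (rule a_le)
      moreover have "a k + a l - 2 * a ?m = \<bar>a k - a l\<bar>"
        using incseqD[OF \<open>incseq a\<close>, of k l] incseqD[OF \<open>incseq a\<close>, of l k]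
        by (cases "k \<le> l") (auto simp: min_def)
      moreover have "\<bar>a k - a l\<bar> < \<epsilon> / 4" using K1 kl by simp
      moreover have "\<eta> k < \<epsilon> / 8" "\<eta> l < \<epsilon> / 8"
        using K2 \<eta>_mono[of K2 k] \<eta>_mono[of K2 l] kl unfolding \<eta>_def by linarith+
      ultimately show "2 * N (w k) + 2 * N (w l) - 4 * N (mid (w k) (w l)) < \<epsilon>"
        using w(2)[of k] w(2)[of l] by linarith
    qed
  qed
qed

lemma ennreal_mult_add:
  assumes "0 \<le> p" "0 \<le> q" "0 \<le> r" "0 \<le> t"
  shows "ennreal p * ennreal q + ennreal r * ennreal t = ennreal (p * q + r * t)"
  using assms by (simp add: ennreal_mult)

text \<open>Along a fast subsequence the increments are summable in the mean; on a set of finite measure this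
follows from \<open>t \<le> 2 ^ j * t\<^sup>2 + (1/2) ^ j\<close>. Hence the telescoping series converges absolutely at
almost every point.\<close>

lemma L2_Cauchy_AE_convergent_subseq:
  fixes f :: "nat \<Rightarrow> 'a \<Rightarrow> real"
  assumes [measurable]: "\<And>k. f k \<in> borel_measurable M" "S \<in> sets M" and fin: "emeasure M S < \<infinity>"
    and cauchy: "\<And>\<epsilon>. 0 < \<epsilon> \<Longrightarrow> \<exists>K. \<forall>k\<ge>K. \<forall>l\<ge>K.
      (\<integral>\<^sup>+x. ennreal ((f k x - f l x)\<^sup>2) * indicator S x \<partial>M) < ennreal \<epsilon>"
  obtains r :: "nat \<Rightarrow> nat" where "strict_mono r" "AE x in M. x \<in> S \<longrightarrow> convergent (\<lambda>j. f (r j) x)"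
proof -
  have "\<exists>K. \<forall>k\<ge>K. \<forall>l\<ge>K. (\<integral>\<^sup>+x. ennreal ((f k x - f l x)\<^sup>2) * indicator S x \<partial>M) < ennreal ((1/4) ^ j)" for j :: nat
    by (rule cauchy) simp
  then obtain K where K: "\<And>j k l. K j \<le> k \<Longrightarrow> K j \<le> l \<Longrightarrow>
      (\<integral>\<^sup>+x. ennreal ((f k x - f l x)\<^sup>2) * indicator S x \<partial>M) < ennreal ((1/4) ^ j)" by metis
  \<comment> \<open>Partial sums make the indices increase strictly while dominating each \<open>K j\<close>.\<close>
  define r where "r j = (\<Sum>i\<le>j. K i) + j" for j :: nat
  have r_mono: "strict_mono r" by (rule strict_monoI_Suc) (simp add: r_def)
  have "K j \<le> r j" for j unfolding r_def using member_le_sum[of j "{..j}" K] by simp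
  moreover have "r j \<le> r (Suc j)" for j by (simp add: r_def)
  ultimately have rK: "K j \<le> r j" "K j \<le> r (Suc j)" for j by (auto intro: order_trans)
  define D where "D j x = \<bar>f (r (Suc j)) x - f (r j) x\<bar>" for j x
  have [measurable]: "D j \<in> borel_measurable M" for j unfolding D_def by measurable
  define \<mu> where "\<mu> = measure M S"
  have \<mu>: "emeasure M S = ennreal \<mu>" unfolding \<mu>_def using fin by (intro emeasure_eq_ennreal_measure) auto
  let ?q = "\<lambda>j x. ennreal ((f (r (Suc j)) x - f (r j) x)\<^sup>2) * indicator S x"
  have step: "(\<integral>\<^sup>+x. ennreal (D j x) * indicator S x \<partial>M) \<le> ennreal ((1 + \<mu>) * (1/2) ^ j)" for j
  proof -
    have amgm: "t \<le> 2 ^ j * t\<^sup>2 + (1/2) ^ j" if "0 \<le> t" for t :: real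
    proof (cases "t \<le> (1/2) ^ j")
      case True then show ?thesis by (simp add: add_increasing)
    next
      case False
      then have "1 \<le> 2 ^ j * t" by (simp add: field_simps)
      then have "t * 1 \<le> t * (2 ^ j * t)" using that by (intro mult_left_mono)
      then show ?thesis by (simp add: power2_eq_square mult_ac add_increasing2)
    qed
    have "(\<integral>\<^sup>+x. ennreal (D j x) * indicator S x \<partial>M)
        \<le> (\<integral>\<^sup>+x. ennreal (2 ^ j) * (?q j x)
            + ennreal ((1/2) ^ j) * indicator S x \<partial>M)"
    proof (rule nn_integral_mono)
      fix x
      have "ennreal (D j x) \<le> ennreal (2 ^ j * (f (r (Suc j)) x - f (r j) x)\<^sup>2 + (1/2) ^ j)"
        using amgm[of "D j x"] by (intro ennreal_leI) (simp add: D_def)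
      also have "\<dots> = ennreal (2 ^ j) * ennreal ((f (r (Suc j)) x - f (r j) x)\<^sup>2) + ennreal ((1/2) ^ j)"
        by (subst ennreal_plus) (simp_all only: ennreal_mult' zero_le_power zero_le_numeral
            mult_nonneg_nonneg zero_le_power2 zero_le_divide_1_iff)
      finally show "ennreal (D j x) * indicator S x
          \<le> ennreal (2 ^ j) * (?q j x)
            + ennreal ((1/2) ^ j) * indicator S x" by (auto simp: indicator_def)
    qed
    also have "\<dots> = (\<integral>\<^sup>+x. ennreal (2 ^ j) * (?q j x) \<partial>M)
        + (\<integral>\<^sup>+x. ennreal ((1/2) ^ j) * indicator S x \<partial>M)"
      by (rule nn_integral_add) measurable
    also have "(\<integral>\<^sup>+x. ennreal (2 ^ j) * (?q j x) \<partial>M)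
        = ennreal (2 ^ j) * (\<integral>\<^sup>+x. ?q j x \<partial>M)"
      by (rule nn_integral_cmult) measurable
    also have "(\<integral>\<^sup>+x. ennreal ((1/2) ^ j) * indicator S x \<partial>M) = ennreal ((1/2) ^ j) * ennreal \<mu>"
      by (simp add: nn_integral_cmult_indicator \<mu>)
    also have "ennreal (2 ^ j) * (\<integral>\<^sup>+x. ?q j x \<partial>M)
          + ennreal ((1/2) ^ j) * ennreal \<mu>
        \<le> ennreal (2 ^ j) * ennreal ((1/4) ^ j) + ennreal ((1/2) ^ j) * ennreal \<mu>"
      using rK by (intro add_right_mono mult_left_mono less_imp_le[OF K]) auto
    also have "\<dots> = ennreal (2 ^ j * (1/4) ^ j + (1/2) ^ j * \<mu>)"
      by (rule ennreal_mult_add) (auto simp: \<mu>_def)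
    also have "2 ^ j * (1/4) ^ j + (1/2) ^ j * \<mu> = (1 + \<mu>) * (1/2) ^ j"
      by (simp add: power_mult_distrib[symmetric] algebra_simps)
    finally show ?thesis .
  qed
  have "(\<integral>\<^sup>+x. (\<Sum>j. ennreal (D j x) * indicator S x) \<partial>M) = (\<Sum>j. \<integral>\<^sup>+x. ennreal (D j x) * indicator S x \<partial>M)"
    by (rule nn_integral_suminf) measurable
  also have "\<dots> \<le> (\<Sum>j. ennreal ((1 + \<mu>) * (1/2) ^ j))" by (intro suminf_le step) auto
  also have "\<dots> = ennreal ((1 + \<mu>) / (1 - 1/2))"
    by (rule suminf_geometric_ennreal) (auto simp: \<mu>_def)
  finally have "(\<integral>\<^sup>+x. (\<Sum>j. ennreal (D j x) * indicator S x) \<partial>M) \<noteq> \<infinity>" by (auto simp: top_unique)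
  then have "AE x in M. (\<Sum>j. ennreal (D j x) * indicator S x) \<noteq> \<infinity>"
    by (intro nn_integral_PInf_AE) measurable
  then have "AE x in M. x \<in> S \<longrightarrow> convergent (\<lambda>j. f (r j) x)"
  proof eventually_elim
    case (elim x)
    show ?case
    proof
      assume "x \<in> S"
      then have "(\<Sum>j. ennreal (D j x)) \<noteq> top" using elim by simp
      then have "summable (\<lambda>j. D j x)" by (intro summable_suminf_not_top) (auto simp: D_def)
      then have "summable (\<lambda>j. f (r (Suc j)) x - f (r j) x)"
        unfolding D_def by (rule summable_rabs_cancel)
      then have "convergent (\<lambda>n. (\<Sum>j<n. f (r (Suc j)) x - f (r j) x))"
        by (simp add: summable_iff_convergent)
      then have "convergent (\<lambda>n. f (r n) x - f (r 0) x)"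
        by (simp only: sum_lessThan_telescope[of "\<lambda>n. f (r n) x"])
      then have "convergent (\<lambda>n. (f (r n) x - f (r 0) x) + f (r 0) x)"
        by (intro convergent_add convergent_const)
      then show "convergent (\<lambda>j. f (r j) x)" by simp
    qed
  qed
  with r_mono show ?thesis by (rule that)
qed

section \<open>Existence of a bounded minimiser\<close>

lemma tendsto_energy_diff:
  assumes "(\<lambda>j. v j (fst z)) \<longlonglongrightarrow> u (fst z)" "(\<lambda>j. v j (snd z)) \<longlonglongrightarrow> u (snd z)"
  shows "(\<lambda>j. energy_diff s (v j) w z) \<longlonglongrightarrow> energy_diff s u w z"
proof -
  have cont: "isCont (calG_s n s) t" for n t using calG_s_deriv by (rule DERIV_isCont)
  have "(\<lambda>j. (v j (fst z) - v j (snd z)) / c) \<longlonglongrightarrow> (u (fst z) - u (snd z)) / c" for c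
    unfolding divide_inverse by (intro tendsto_intros assms)
  then have "(\<lambda>j. calG_s n s ((v j (fst z) - v j (snd z)) / c)) \<longlonglongrightarrow> calG_s n s ((u (fst z) - u (snd z)) / c)" for n c
    by (rule isCont_tendsto_compose[OF cont])
  then show ?thesis
    unfolding energy_diff_def case_prod_unfold divide_inverse by (intro tendsto_intros) (simp add: divide_inverse)
qed

lemma energy_diff_midpoint:
  "2 * energy_diff s (\<lambda>x. (u x + v x) / 2) w z \<le> energy_diff s u w z + energy_diff s v w z"
proof -
  obtain x y where z: "z = (x, y)" by (cases z)
  let ?n = "CARD('a)"
  define r where "r = norm (x - y)"
  define q where "q = r powr (real ?n - 1 + s)"
  have q: "0 \<le> q" by (simp add: q_def)
  have e: "energy_diff s f w z = (calG_s ?n s ((f x - f y) / r) - calG_s ?n s ((w x - w y) / r)) / q" for f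
    by (simp add: energy_diff_def z r_def q_def)
  have arg: "((u x + v x) / 2 - (u y + v y) / 2) / r = ((u x - u y) / r + (v x - v y) / r) / 2"
    by (simp add: diff_divide_distrib add_divide_distrib)
  have "2 * calG_s ?n s (((u x + v x) / 2 - (u y + v y) / 2) / r)
      \<le> calG_s ?n s ((u x - u y) / r) + calG_s ?n s ((v x - v y) / r)"
    unfolding arg by (rule calG_s_midpoint)
  then have "(2 * (calG_s ?n s (((u x + v x) / 2 - (u y + v y) / 2) / r) - calG_s ?n s ((w x - w y) / r))) / q
      \<le> ((calG_s ?n s ((u x - u y) / r) - calG_s ?n s ((w x - w y) / r))
        + (calG_s ?n s ((v x - v y) / r) - calG_s ?n s ((w x - w y) / r))) / q"
    by (intro divide_right_mono q) simp
  then show ?thesis unfolding e by (simp only: add_divide_distrib times_divide_eq_right)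
qed

context fractional_domain begin

lemma W_s_constant:
  assumes "f \<in> borel_measurable borel" "\<And>x. x \<in> \<Omega> \<Longrightarrow> f x = c"
  shows "f \<in> W_s s \<Omega>"
proof -
  have "(\<integral>\<^sup>+x. ennreal \<bar>f x\<bar> * indicator \<Omega> x \<partial>lborel) = (\<integral>\<^sup>+x. ennreal \<bar>c\<bar> * indicator \<Omega> x \<partial>lborel)"
    using assms(2) by (intro nn_integral_cong) (auto simp: indicator_def)
  also have "\<dots> < \<infinity>"
    using domain_emeasure_finite by (simp add: nn_integral_cmult_indicator ennreal_mult_less_top)
  finally have 1: "(\<integral>\<^sup>+x. ennreal \<bar>f x\<bar> * indicator \<Omega> x \<partial>lborel) < \<infinity>" .
  have "ring_energy \<Omega> (real CARD('n) + s) f UNIV = (\<integral>\<^sup>+(x::real^'n). \<integral>\<^sup>+(y::real^'n). 0 \<partial>lborel \<partial>lborel)"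
    unfolding ring_energy_def using assms(2) by (intro nn_integral_cong) (auto simp: indicator_def)
  then show ?thesis using 1 W_s_borel_iff[OF assms(1) open_domain] by simp
qed

lemma W_s_midpoint:
  assumes u[measurable]: "u \<in> borel_measurable borel" and v[measurable]: "v \<in> borel_measurable borel"
    and W: "u \<in> W_s s \<Omega>" "v \<in> W_s s \<Omega>"
  shows "(\<lambda>x. (u x + v x) / 2) \<in> W_s s \<Omega>"
proof -
  let ?m = "\<lambda>x. (u x + v x) / 2"
  let ?mass = "\<lambda>f. \<integral>\<^sup>+x. ennreal \<bar>f x\<bar> * indicator \<Omega> x \<partial>lborel"
  let ?p = "real CARD('n) + s"
  let ?g = "\<lambda>f x y. ennreal (\<bar>f x - f y\<bar> * kernel (x - y)) * (indicator \<Omega> x * indicator \<Omega> y * indicator UNIV (norm (x - y)))"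
  have fin: "?mass u < \<infinity>" "ring_energy \<Omega> ?p u UNIV < \<infinity>"
    "?mass v < \<infinity>" "ring_energy \<Omega> ?p v UNIV < \<infinity>"
    using W W_s_borel_iff[OF u open_domain] W_s_borel_iff[OF v open_domain] by auto
  have "?mass ?m
      \<le> (\<integral>\<^sup>+x. ennreal \<bar>u x\<bar> * indicator \<Omega> x + ennreal \<bar>v x\<bar> * indicator \<Omega> x \<partial>lborel)"
    by (intro nn_integral_mono) (auto simp: indicator_def ennreal_plus[symmetric] simp del: ennreal_plus intro!: ennreal_leI)
  also have "\<dots> = ?mass u + ?mass v"
    by (rule nn_integral_add) measurable
  also have "\<dots> < \<infinity>" using fin by simp
  finally have 1: "?mass ?m < \<infinity>" .
  have "ring_energy \<Omega> ?p ?m UNIV \<le> (\<integral>\<^sup>+x. \<integral>\<^sup>+y. ?g u x y + ?g v x y \<partial>lborel \<partial>lborel)"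
    unfolding ring_energy_def
  proof (intro nn_integral_mono)
    fix x y :: "real ^ 'n"
    have "\<bar>?m x - ?m y\<bar> * kernel (x - y) \<le> (\<bar>u x - u y\<bar> + \<bar>v x - v y\<bar>) * kernel (x - y)"
    proof (rule mult_right_mono)
      have "?m x - ?m y = (u x - u y) / 2 + (v x - v y) / 2" by (simp add: field_simps)
      then show "\<bar>?m x - ?m y\<bar> \<le> \<bar>u x - u y\<bar> + \<bar>v x - v y\<bar>"
        by (simp add: abs_le_iff) (auto simp: abs_if field_simps)
    qed simp
    then have "ennreal (\<bar>?m x - ?m y\<bar> * kernel (x - y)) \<le> ennreal (\<bar>u x - u y\<bar> * kernel (x - y)) + ennreal (\<bar>v x - v y\<bar> * kernel (x - y))"
      by (simp only: distrib_right ennreal_leI ennreal_plus[symmetric] mult_nonneg_nonneg abs_ge_zero powr_ge_zero)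
    then show "?g ?m x y \<le> ?g u x y + ?g v x y" by (auto simp: indicator_def)
  qed
  also have "\<dots> = ring_energy \<Omega> ?p u UNIV + ring_energy \<Omega> ?p v UNIV"
    unfolding ring_energy_def by (simp add: nn_integral_add)
  also have "\<dots> < \<infinity>" using fin by simp
  finally show ?thesis using 1 W_s_borel_iff[of ?m, OF _ open_domain] by simp
qed

text \<open>Compared with a function that is constant on \<open>\<Omega>\<close>, energy can only be lost through pairs with one
exterior point. For bounded functions the loss is controlled by the fractional perimeter of \<open>\<Omega>\<close>,
the Gagliardo energy of its indicator function.\<close>

lemma energy_diff_lower_bound:
  fixes u c :: "real ^ 'n \<Rightarrow> real"
  assumes M: "0 \<le> M" and off: "\<And>x. x \<notin> \<Omega> \<Longrightarrow> u x = c x" and c: "\<And>x. x \<in> \<Omega> \<Longrightarrow> c x = M"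
    and u: "\<And>x. x \<in> \<Omega> \<Longrightarrow> \<bar>u x\<bar> \<le> M"
  shows "0 \<le> energy_diff s u c (x, y) + 4 * M * (\<bar>1 * indicator \<Omega> x - 1 * indicator \<Omega> y\<bar> * kernel (x - y))"
proof -
  have bd: "\<bar>u x - c x\<bar> \<le> 2 * M" if "x \<in> \<Omega>" for x using u[OF that] c[OF that] by linarith
  have e: "- energy_diff s u c (x, y) \<le> 2 * \<bar>(u x - c x) - (u y - c y)\<bar> * kernel (x - y)"
    using energy_diff_bound[of s u c x y] s_pos by linarith
  have k0: "0 \<le> kernel (x - y)" by simp
  consider "x \<in> \<Omega>" "y \<in> \<Omega>" | "x \<in> \<Omega>" "y \<notin> \<Omega>" | "x \<notin> \<Omega>" "y \<in> \<Omega>" | "x \<notin> \<Omega>" "y \<notin> \<Omega>" by blast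
  then show ?thesis
  proof cases
    case 1 then show ?thesis using c by (simp add: energy_diff_def)
  next
    case 2
    then have "2 * \<bar>(u x - c x) - (u y - c y)\<bar> * kernel (x - y) \<le> 4 * M * kernel (x - y)"
      using bd[of x] off[of y] by (intro mult_right_mono k0) simp
    then have "- energy_diff s u c (x, y) \<le> 4 * M * kernel (x - y)" by (rule order_trans[OF e])
    moreover have "\<bar>1 * indicator \<Omega> x - 1 * indicator \<Omega> y\<bar> = (1::real)" using 2 by simp
    ultimately show ?thesis by simp
  next
    case 3
    then have "2 * \<bar>(u x - c x) - (u y - c y)\<bar> * kernel (x - y) \<le> 4 * M * kernel (x - y)"
      using bd[of y] off[of x] by (intro mult_right_mono k0) simp
    then have "- energy_diff s u c (x, y) \<le> 4 * M * kernel (x - y)" by (rule order_trans[OF e])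
    moreover have "\<bar>1 * indicator \<Omega> x - 1 * indicator \<Omega> y\<bar> = (1::real)" using 3 by simp
    ultimately show ?thesis by simp
  next
    case 4 then show ?thesis using off by (simp add: energy_diff_def)
  qed
qed

text \<open>Since the energy density grows linearly, finite energy controls the Gagliardo seminorm up to the
integral of \<open>norm (x - y) powr - (n - 1 + s)\<close> over \<open>\<Omega> \<times> \<Omega>\<close>. That integral is finite because \<open>\<Omega>\<close> is
bounded and \<open>s < 1\<close>.\<close>

lemma W_s_of_finite_energy:
  fixes u c :: "real ^ 'n \<Rightarrow> real" and h :: "(real ^ 'n) \<times> (real ^ 'n) \<Rightarrow> real"
  assumes u[measurable]: "u \<in> borel_measurable borel" and M: "\<And>x. x \<in> \<Omega> \<Longrightarrow> \<bar>u x\<bar> \<le> M"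
    and c: "\<And>x. x \<in> \<Omega> \<Longrightarrow> c x = M" and c_meas[measurable]: "c \<in> borel_measurable borel"
    and h[measurable]: "h \<in> borel_measurable borel" and h0: "\<And>z. 0 \<le> h z"
    and fin: "(\<integral>\<^sup>+z. ennreal (energy_diff s u c z + h z) \<partial>lborel) < \<infinity>"
  shows "u \<in> W_s s \<Omega>"
proof -
  let ?p = "real CARD('n) + s" and ?n = "CARD('n)"
  let ?g = "\<lambda>x y. ennreal (\<bar>u x - u y\<bar> * kernel (x - y)) * (indicator \<Omega> x * indicator \<Omega> y * indicator UNIV (norm (x - y)))"
  define q where "q = real ?n - 1 + s"
  have q: "0 \<le> q" "q < real DIM(real ^ 'n)" using s_pos s_less_1 by (auto simp: q_def Suc_leI)
  define D where "D = diameter \<Omega> + 1"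
  have D: "0 < D" using diameter_ge_0[OF bounded_domain] by (simp add: D_def)
  define \<gamma> where "\<gamma> = G_s ?n s 1"
  have \<gamma>: "0 < \<gamma>" unfolding \<gamma>_def by (rule G_s_pos) simp
  have "(\<integral>\<^sup>+x. ennreal \<bar>u x\<bar> * indicator \<Omega> x \<partial>lborel) \<le> (\<integral>\<^sup>+x. ennreal \<bar>M\<bar> * indicator \<Omega> x \<partial>lborel)"
    using M by (intro nn_integral_mono) (force simp: indicator_def intro!: ennreal_leI)
  also have "\<dots> < \<infinity>"
    using domain_emeasure_finite by (simp add: nn_integral_cmult_indicator ennreal_mult_less_top)
  finally have mass: "(\<integral>\<^sup>+x. ennreal \<bar>u x\<bar> * indicator \<Omega> x \<partial>lborel) < \<infinity>" .
  have ed_meas: "energy_diff s u c \<in> borel_measurable borel" by (rule borel_measurable_energy_diff[OF u c_meas])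
  define E where "E z = ennreal (energy_diff s u c z + h z)" for z
  have E_meas: "E \<in> borel_measurable (lborel \<Otimes>\<^sub>M lborel)"
    unfolding E_def lborel_prod using ed_meas by measurable
  define L where "L z = ennreal (norm z powr - q) * indicator {z. norm z < D} z" for z :: "real ^ 'n"
  have [measurable]: "L \<in> borel_measurable borel" unfolding L_def by measurable
  have pt: "ennreal \<gamma> * (?g x y)
      \<le> E (x, y) + ennreal \<gamma> * (indicator \<Omega> x * L (x - y))" for x y :: "real ^ 'n"
  proof (cases "x \<in> \<Omega> \<and> y \<in> \<Omega> \<and> x \<noteq> y")
    case True
    define r where "r = norm (x - y)"
    have r: "0 < r" using True by (simp add: r_def)
    have "r < D" using diameter_bounded_bound[OF bounded_domain, of x y] True
      by (simp add: r_def D_def dist_norm)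
    have kr: "kernel (x - y) = r powr - q / r"
    proof -
      have "r powr - q = r powr (1 + - ?p)" by (simp add: q_def algebra_simps)
      also have "\<dots> = r powr 1 * r powr - ?p" by (rule powr_add)
      finally show ?thesis using r by (simp add: r_def)
    qed
    have ed0: "0 \<le> energy_diff s u c (x, y)" using True c by (simp add: energy_diff_def)
    have "\<gamma> * (\<bar>u x - u y\<bar> * kernel (x - y)) - \<gamma> * r powr - q = \<gamma> * (\<bar>(u x - u y) / r\<bar> - 1) * r powr - q"
      unfolding kr using r by (simp add: algebra_simps)
    also have "\<dots> \<le> calG_s ?n s ((u x - u y) / r) * r powr - q"
      unfolding \<gamma>_def by (intro mult_right_mono calG_s_linear_growth) simp
    also have "\<dots> = energy_diff s u c (x, y)"
      using True c by (simp add: energy_diff_def r_def powr_minus_divide[of _ q] q_def[symmetric])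
    also have "\<dots> \<le> energy_diff s u c (x, y) + h (x, y)" using h0 by simp
    finally have "\<gamma> * (\<bar>u x - u y\<bar> * kernel (x - y)) \<le> (energy_diff s u c (x, y) + h (x, y)) + \<gamma> * r powr - q" by simp
    then have "ennreal (\<gamma> * (\<bar>u x - u y\<bar> * kernel (x - y))) \<le> ennreal ((energy_diff s u c (x, y) + h (x, y)) + \<gamma> * r powr - q)"
      by (rule ennreal_leI)
    also have "\<dots> \<le> ennreal (energy_diff s u c (x, y) + h (x, y)) + ennreal (\<gamma> * r powr - q)"
      using ed0 h0 \<gamma> by (subst ennreal_plus) auto
    finally show ?thesis using True \<gamma> \<open>r < D\<close> by (simp add: E_def L_def ennreal_mult' r_def)
  qed (auto simp: indicator_def)
  have L_fin: "(\<integral>\<^sup>+z. L z \<partial>lborel) < \<infinity>"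
    unfolding L_def by (rule kernel_local_finite[OF q D])
  have "ennreal \<gamma> * ring_energy \<Omega> ?p u UNIV
      = (\<integral>\<^sup>+x. \<integral>\<^sup>+y. ennreal \<gamma> * (?g x y) \<partial>lborel \<partial>lborel)"
    unfolding ring_energy_def by (simp add: nn_integral_cmult)
  also have "\<dots> \<le> (\<integral>\<^sup>+x. \<integral>\<^sup>+y. E (x, y) + ennreal \<gamma> * (indicator \<Omega> x * L (x - y)) \<partial>lborel \<partial>lborel)"
    by (intro nn_integral_mono pt)
  also have "\<dots> = (\<integral>\<^sup>+x. (\<integral>\<^sup>+y. E (x, y) \<partial>lborel) + ennreal \<gamma> * (indicator \<Omega> x * (\<integral>\<^sup>+z. L z \<partial>lborel)) \<partial>lborel)"
  proof (rule nn_integral_cong)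
    fix x :: "real ^ 'n"
    have "(\<integral>\<^sup>+y. E (x, y) + ennreal \<gamma> * (indicator \<Omega> x * L (x - y)) \<partial>lborel)
        = (\<integral>\<^sup>+y. E (x, y) \<partial>lborel) + (\<integral>\<^sup>+y. (ennreal \<gamma> * indicator \<Omega> x) * L (x - y) \<partial>lborel)"
      using E_meas by (subst nn_integral_add) (auto simp: mult.assoc intro: measurable_Pair2)
    also have "(\<integral>\<^sup>+y. (ennreal \<gamma> * indicator \<Omega> x) * L (x - y) \<partial>lborel) = ennreal \<gamma> * indicator \<Omega> x * (\<integral>\<^sup>+y. L (x - y) \<partial>lborel)"
      by (rule nn_integral_cmult) measurable
    also have "(\<integral>\<^sup>+y. L (x - y) \<partial>lborel) = (\<integral>\<^sup>+z. L z \<partial>lborel)" by (rule nn_integral_reflect) measurable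
    finally show "(\<integral>\<^sup>+y. E (x, y) + ennreal \<gamma> * (indicator \<Omega> x * L (x - y)) \<partial>lborel)
        = (\<integral>\<^sup>+y. E (x, y) \<partial>lborel) + ennreal \<gamma> * (indicator \<Omega> x * (\<integral>\<^sup>+z. L z \<partial>lborel))" by (simp add: mult.assoc)
  qed
  also have "\<dots> = (\<integral>\<^sup>+x. \<integral>\<^sup>+y. E (x, y) \<partial>lborel \<partial>lborel) + (\<integral>\<^sup>+x. ennreal \<gamma> * (indicator \<Omega> x * (\<integral>\<^sup>+z. L z \<partial>lborel)) \<partial>lborel)"
    by (rule nn_integral_add) (use E_meas in measurable)
  also have "(\<integral>\<^sup>+x. \<integral>\<^sup>+y. E (x, y) \<partial>lborel \<partial>lborel) = (\<integral>\<^sup>+z. E z \<partial>lborel)"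
    using lborel.nn_integral_fst[OF E_meas] by (simp add: lborel_prod)
  also have "(\<integral>\<^sup>+x. ennreal \<gamma> * (indicator \<Omega> x * (\<integral>\<^sup>+z. L z \<partial>lborel)) \<partial>lborel)
      = ennreal \<gamma> * (emeasure lborel \<Omega> * (\<integral>\<^sup>+z. L z \<partial>lborel))"
    by (simp add: nn_integral_cmult nn_integral_multc)
  finally have "ennreal \<gamma> * ring_energy \<Omega> ?p u UNIV
      \<le> (\<integral>\<^sup>+z. E z \<partial>lborel) + ennreal \<gamma> * (emeasure lborel \<Omega> * (\<integral>\<^sup>+z. L z \<partial>lborel))" .
  also have "\<dots> < \<infinity>"
    using fin L_fin domain_emeasure_finite by (simp add: E_def ennreal_mult_less_top)
  finally have "ring_energy \<Omega> ?p u UNIV < \<infinity>" using \<gamma> by (auto simp: ennreal_mult_less_top)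
  then show ?thesis using mass W_s_borel_iff[OF u open_domain] by simp
qed

end

context fractional_domain begin

text \<open>Borel functions with the exterior data attained everywhere, rather than almost everywhere. Every
element of the class in the obstacle problem has such a representative once the data are Borel.\<close>

definition competitors :: "(real ^ 'n) set \<Rightarrow> (real ^ 'n \<Rightarrow> real) \<Rightarrow> (real ^ 'n \<Rightarrow> real) \<Rightarrow> (real ^ 'n \<Rightarrow> real) set" where
  "competitors A \<phi> \<psi> = {u. u \<in> borel_measurable borel \<and> u \<in> W_s s \<Omega> \<and> (\<forall>x. x \<notin> \<Omega> \<longrightarrow> u x = \<phi> x)
     \<and> (AE x in lborel. x \<in> A \<longrightarrow> \<psi> x \<le> u x)}"

lemma competitors_energy_integrable:
  assumes "u \<in> competitors A \<phi> \<psi>" "v \<in> competitors A \<phi> \<psi>"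
  shows "integrable lborel (energy_diff s u v)"
  using assms by (intro integrable_energy_diff) (auto simp: competitors_def)

lemma competitors_energy_add:
  assumes "u \<in> competitors A \<phi> \<psi>" "v \<in> competitors A \<phi> \<psi>" "w \<in> competitors A \<phi> \<psi>"
  shows "integral\<^sup>L lborel (energy_diff s u w)
    = integral\<^sup>L lborel (energy_diff s u v) + integral\<^sup>L lborel (energy_diff s v w)"
  using Bochner_Integration.integral_add[OF competitors_energy_integrable[OF assms(1,2)]
      competitors_energy_integrable[OF assms(2,3)]]
  by (simp add: energy_diff_add)

lemma competitors_midpoint:
  assumes "u \<in> competitors A \<phi> \<psi>" "v \<in> competitors A \<phi> \<psi>"
  shows "(\<lambda>x. (u x + v x) / 2) \<in> competitors A \<phi> \<psi>"
proof -
  have "AE x in lborel. x \<in> A \<longrightarrow> \<psi> x \<le> u x" "AE x in lborel. x \<in> A \<longrightarrow> \<psi> x \<le> v x"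
    using assms by (auto simp: competitors_def)
  then have "AE x in lborel. x \<in> A \<longrightarrow> \<psi> x \<le> (u x + v x) / 2"
    by eventually_elim auto
  then show ?thesis using assms W_s_midpoint[of u v] by (auto simp: competitors_def)
qed

text \<open>The direct method on competitors bounded by \<open>M\<close>. Energies are measured relative to the competitor
\<open>c\<close> that equals \<open>M\<close> on \<open>\<Omega>\<close>, and they are bounded below by an integrable function, so Fatou's lemma
passes to the limit along an almost everywhere convergent minimising sequence. The same estimate
shows that the limit has finite energy and hence belongs to the space.\<close>

lemma bounded_minimizer_exists:
  fixes A :: "(real ^ 'n) set" and \<phi> \<psi> :: "real ^ 'n \<Rightarrow> real"
  assumes \<phi>[measurable]: "\<phi> \<in> borel_measurable borel" and A: "A \<subseteq> \<Omega>" and M: "0 \<le> M"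
    and \<psi>: "AE x in lborel. x \<in> A \<longrightarrow> \<psi> x \<le> M"
  obtains u where "u \<in> competitors A \<phi> \<psi>" "\<And>x. x \<in> \<Omega> \<Longrightarrow> \<bar>u x\<bar> \<le> M"
    "\<And>v. v \<in> competitors A \<phi> \<psi> \<Longrightarrow> (\<And>x. x \<in> \<Omega> \<Longrightarrow> \<bar>v x\<bar> \<le> M) \<Longrightarrow>
      integral\<^sup>L lborel (energy_diff s u v) \<le> 0"
proof -
  define X where "X = {u \<in> competitors A \<phi> \<psi>. \<forall>x\<in>\<Omega>. \<bar>u x\<bar> \<le> M}"
  define c where "c x = (if x \<in> \<Omega> then M else \<phi> x)" for x
  have c_meas[measurable]: "c \<in> borel_measurable borel" unfolding c_def[abs_def] by measurable
  have "AE x in lborel. x \<in> A \<longrightarrow> \<psi> x \<le> c x"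
    using \<psi> by eventually_elim (use A in \<open>auto simp: c_def\<close>)
  moreover have "c \<in> W_s s \<Omega>" by (rule W_s_constant[OF c_meas]) (simp add: c_def)
  ultimately have cX: "c \<in> X" using M c_meas by (auto simp: X_def competitors_def c_def)
  have XD: "u \<in> borel_measurable borel" "u \<in> W_s s \<Omega>" "x \<notin> \<Omega> \<Longrightarrow> u x = \<phi> x"
    "AE x in lborel. x \<in> A \<longrightarrow> \<psi> x \<le> u x" "x \<in> \<Omega> \<Longrightarrow> \<bar>u x\<bar> \<le> M" "u \<in> competitors A \<phi> \<psi>" if "u \<in> X" for u x
    using that by (auto simp: X_def competitors_def)
  define J where "J u = integral\<^sup>L lborel (energy_diff s u c)" for u
  have int: "integrable lborel (energy_diff s u c)" if "u \<in> X" for u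
    by (rule competitors_energy_integrable[OF XD(6)[OF that] XD(6)[OF cX]])
  \<comment> \<open>The negative of this function is an integrable minorant of all the energy differences to \<open>c\<close>.\<close>
  define h where "h = (\<lambda>z. 4 * M * (case z of (x, y) \<Rightarrow> \<bar>1 * indicator \<Omega> x - 1 * indicator \<Omega> y\<bar> * kernel (x - y)))"
  have "(\<lambda>x. 1) \<in> W_s s \<Omega>" by (rule W_s_constant) auto
  then have h_int: "integrable lborel h"
    unfolding h_def by (intro integrable_mult_right zero_extension_finite) auto
  have h0: "0 \<le> h z" for z using M by (auto simp: h_def split: prod.split)
  have h_meas: "h \<in> borel_measurable borel" using borel_measurable_integrable[OF h_int] by simp
  define H where "H = integral\<^sup>L lborel h"
  have lower: "0 \<le> energy_diff s u c z + h z" if "u \<in> X" for u z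
  proof (cases z)
    case (Pair x y)
    show ?thesis unfolding Pair h_def prod.case
      by (rule energy_diff_lower_bound[OF M]) (use XD[OF that] in \<open>auto simp: c_def\<close>)
  qed
  have J_lower: "0 \<le> J u + H" if "u \<in> X" for u
  proof -
    have "0 \<le> integral\<^sup>L lborel (\<lambda>z. energy_diff s u c z + h z)"
      by (intro integral_nonneg_AE AE_I2 lower that)
    then show ?thesis using int[OF that] h_int by (simp add: J_def H_def)
  qed
  define mid where "mid u v = (\<lambda>x. (u x + v x) / 2)" for u v :: "real ^ 'n \<Rightarrow> real"
  have mid_X: "mid u v \<in> X" if "u \<in> X" "v \<in> X" for u v
  proof -
    have "\<bar>(u x + v x) / 2\<bar> \<le> M" if "x \<in> \<Omega>" for x
      using XD(5)[OF \<open>u \<in> X\<close> that] XD(5)[OF \<open>v \<in> X\<close> that] by (simp add: abs_le_iff)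
    then show ?thesis using competitors_midpoint[OF XD(6)[OF that(1)] XD(6)[OF that(2)]]
      by (simp add: X_def mid_def)
  qed
  have J_mid: "2 * J (mid u v) \<le> J u + J v" if "u \<in> X" "v \<in> X" for u v
  proof -
    have "integral\<^sup>L lborel (\<lambda>z. 2 * energy_diff s (mid u v) c z)
        \<le> integral\<^sup>L lborel (\<lambda>z. energy_diff s u c z + energy_diff s v c z)"
      unfolding mid_def by (intro integral_mono energy_diff_midpoint integrable_mult_right
          Bochner_Integration.integrable_add int that int[OF mid_X[OF that], unfolded mid_def])
    then show ?thesis using int that by (simp add: J_def)
  qed
  define N where "N u = (LINT x|lborel. (u x)\<^sup>2 * indicator \<Omega> x)" for u :: "real ^ 'n \<Rightarrow> real"
  have bdd_int: "integrable lborel (\<lambda>x. f x * indicator \<Omega> x)"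
    if "f \<in> borel_measurable borel" "\<And>x. x \<in> \<Omega> \<Longrightarrow> \<bar>f x\<bar> \<le> B" for f :: "real ^ 'n \<Rightarrow> real" and B
  proof (rule Bochner_Integration.integrable_bound)
    show "integrable lborel (\<lambda>x. B * indicator \<Omega> x :: real)"
      using domain_emeasure_finite by (intro integrable_mult_right integrable_real_indicator) auto
    show "(\<lambda>x. f x * indicator \<Omega> x) \<in> borel_measurable lborel" using that(1) by measurable
    have "norm (f x * indicator \<Omega> x) \<le> norm (B * indicator \<Omega> x :: real)" for x
      using that(2)[of x] by (cases "x \<in> \<Omega>") (auto intro: order_trans)
    then show "AE x in lborel. norm (f x * indicator \<Omega> x) \<le> norm (B * indicator \<Omega> x :: real)" by (rule AE_I2)
  qed
  have sq_int: "integrable lborel (\<lambda>x. (u x)\<^sup>2 * indicator \<Omega> x)" if "u \<in> X" for u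
  proof (rule bdd_int)
    show "(\<lambda>x. (u x)\<^sup>2) \<in> borel_measurable borel" using XD(1)[OF that] by measurable
    show "\<bar>(u x)\<^sup>2\<bar> \<le> M\<^sup>2" if "x \<in> \<Omega>" for x
      using XD(5)[OF \<open>u \<in> X\<close> that] by (simp add: abs_le_square_iff[symmetric] M)
  qed
  have N0: "0 \<le> N u" for u unfolding N_def by (intro integral_nonneg_AE AE_I2) simp
  have N_le: "N u \<le> (LINT x|lborel. M\<^sup>2 * indicator \<Omega> x)" if "u \<in> X" for u
    unfolding N_def
  proof (rule integral_mono[OF sq_int[OF that]])
    show "integrable lborel (\<lambda>x. M\<^sup>2 * indicator \<Omega> x :: real)"
      using domain_emeasure_finite by (intro integrable_mult_right integrable_real_indicator) auto
    show "(u x)\<^sup>2 * indicator \<Omega> x \<le> M\<^sup>2 * indicator \<Omega> x" for x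
      using XD(5)[OF that, of x] M by (cases "x \<in> \<Omega>") (auto simp: abs_le_square_iff[symmetric])
  qed
  have parallelogram: "(\<integral>\<^sup>+x. ennreal ((u x - v x)\<^sup>2) * indicator \<Omega> x \<partial>lborel)
      = ennreal (2 * N u + 2 * N v - 4 * N (mid u v))" if uv: "u \<in> X" "v \<in> X" for u v
  proof -
    note i = sq_int[OF uv(1)] sq_int[OF uv(2)] sq_int[OF mid_X[OF uv]]
    have eq: "(u x - v x)\<^sup>2 * indicator \<Omega> x = 2 * ((u x)\<^sup>2 * indicator \<Omega> x)
        + 2 * ((v x)\<^sup>2 * indicator \<Omega> x) - 4 * ((mid u v x)\<^sup>2 * indicator \<Omega> x :: real)" for x
      by (simp add: mid_def power2_eq_square field_simps)
    have "integrable lborel (\<lambda>x. (u x - v x)\<^sup>2 * indicator \<Omega> x)"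
      unfolding eq by (intro Bochner_Integration.integrable_diff Bochner_Integration.integrable_add integrable_mult_right i)
    then have "(\<integral>\<^sup>+x. ennreal ((u x - v x)\<^sup>2 * indicator \<Omega> x) \<partial>lborel)
        = ennreal (LINT x|lborel. (u x - v x)\<^sup>2 * indicator \<Omega> x)"
      by (intro nn_integral_eq_integral) auto
    also have "(LINT x|lborel. (u x - v x)\<^sup>2 * indicator \<Omega> x) = 2 * N u + 2 * N v - 4 * N (mid u v)"
      unfolding eq N_def using i by simp
    finally show ?thesis by (simp add: ennreal_mult' ennreal_indicator)
  qed
  define I where "I = Inf (J ` X)"
  have bdd: "bdd_below (J ` X)" using J_lower by (intro bdd_belowI[of _ "- H"]) force
  have I_le: "I \<le> J v" if "v \<in> X" for v unfolding I_def using bdd that by (intro cInf_lower) auto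
  have "\<exists>w. (\<forall>k. w k \<in> X) \<and> (\<forall>k. J (w k) \<le> I + 1 / (real k + 1)) \<and>
    (\<forall>\<epsilon>>0. \<exists>K. \<forall>k\<ge>K. \<forall>l\<ge>K. 2 * N (w k) + 2 * N (w l) - 4 * N (mid (w k) (w l)) < \<epsilon>)"
    unfolding I_def
    by (rule near_minimal_sequence[of X mid J N, OF _ mid_X J_mid bdd N0 N_le]) (use cX in \<open>blast | assumption\<close>)+
  then obtain w where wX: "\<And>k. w k \<in> X" and wJ: "\<And>k. J (w k) \<le> I + 1 / (real k + 1)"
    and wN: "\<And>\<epsilon>. 0 < \<epsilon> \<Longrightarrow> \<exists>K. \<forall>k\<ge>K. \<forall>l\<ge>K. 2 * N (w k) + 2 * N (w l) - 4 * N (mid (w k) (w l)) < \<epsilon>"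
    by blast
  have w_meas[measurable]: "w k \<in> borel_measurable borel" for k by (rule XD(1)[OF wX])
  have cauchy: "\<exists>K. \<forall>k\<ge>K. \<forall>l\<ge>K. (\<integral>\<^sup>+x. ennreal ((w k x - w l x)\<^sup>2) * indicator \<Omega> x \<partial>lborel) < ennreal \<epsilon>"
    if "0 < \<epsilon>" for \<epsilon>
    using wN[OF that] unfolding parallelogram[OF wX wX] by (meson ennreal_lessI that)
  obtain r :: "nat \<Rightarrow> nat" where r: "strict_mono r"
    and conv: "AE x in lborel. x \<in> \<Omega> \<longrightarrow> convergent (\<lambda>j. w (r j) x)"
  proof (rule L2_Cauchy_AE_convergent_subseq[of w lborel \<Omega>])
    show "\<exists>K. \<forall>k\<ge>K. \<forall>l\<ge>K. (\<integral>\<^sup>+x. ennreal ((w k x - w l x)\<^sup>2) * indicator \<Omega> x \<partial>lborel) < ennreal \<epsilon>"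
      if "0 < \<epsilon>" for \<epsilon> by (rule cauchy[OF that])
  qed (simp_all add: domain_emeasure_finite[unfolded infinity_ennreal_def])
  \<comment> \<open>The limit is clamped so that the bound holds at every point, also where the sequence diverges.\<close>
  define u where "u x = (if x \<in> \<Omega> then max (- M) (min M (lim (\<lambda>j. w (r j) x))) else \<phi> x)" for x
  have u_meas[measurable]: "u \<in> borel_measurable borel"
  proof -
    have [measurable]: "(\<lambda>x. lim (\<lambda>j. w (r j) x)) \<in> borel_measurable borel"
      by (rule borel_measurable_lim_metric) measurable
    show ?thesis unfolding u_def[abs_def] by measurable
  qed
  have u_bound: "\<bar>u x\<bar> \<le> M" if "x \<in> \<Omega>" for x using that M by (auto simp: u_def)
  have u_lim: "AE x in lborel. (\<lambda>j. w (r j) x) \<longlonglongrightarrow> u x"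
    using conv
  proof eventually_elim
    case (elim x)
    show ?case
    proof (cases "x \<in> \<Omega>")
      case True
      then have l: "(\<lambda>j. w (r j) x) \<longlonglongrightarrow> lim (\<lambda>j. w (r j) x)"
        using elim by (simp add: convergent_LIMSEQ_iff)
      have "w (r j) x \<le> M" "- M \<le> w (r j) x" for j using XD(5)[OF wX True, of "r j"] by auto
      then have "lim (\<lambda>j. w (r j) x) \<le> M" "- M \<le> lim (\<lambda>j. w (r j) x)"
        by (auto intro: LIMSEQ_le_const2[OF l] LIMSEQ_le_const[OF l])
      then show ?thesis using l True by (simp add: u_def)
    next
      case False
      then have "w (r j) x = u x" for j using XD(3)[OF wX False] by (simp add: u_def)
      then show ?thesis by simp
    qed
  qed
  have "AE x in lborel. \<forall>j. x \<in> A \<longrightarrow> \<psi> x \<le> w (r j) x"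
    unfolding AE_all_countable using XD(4)[OF wX] by blast
  then have u_obst: "AE x in lborel. x \<in> A \<longrightarrow> \<psi> x \<le> u x"
    using u_lim by eventually_elim (auto intro: LIMSEQ_le_const)
  define E where "E v z = ennreal (energy_diff s v c z + h z)" for v z
  have E_meas: "E v \<in> borel_measurable lborel" if "v \<in> borel_measurable borel" for v
    unfolding E_def using borel_measurable_energy_diff[OF that c_meas, of s] h_meas by measurable
  have E_int: "(\<integral>\<^sup>+z. E v z \<partial>lborel) = ennreal (J v + H)" if "v \<in> X" for v
  proof -
    have "(\<integral>\<^sup>+z. E v z \<partial>lborel) = ennreal (LINT z|lborel. energy_diff s v c z + h z)"
      unfolding E_def using int[OF that] h_int lower[OF that]
      by (intro nn_integral_eq_integral Bochner_Integration.integrable_add) auto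
    then show ?thesis using int[OF that] h_int by (simp add: J_def H_def)
  qed
  have "(\<integral>\<^sup>+z. E u z \<partial>lborel) \<le> (\<integral>\<^sup>+z. liminf (\<lambda>j. E (w (r j)) z) \<partial>lborel)"
  proof (rule nn_integral_mono_AE)
    show "AE z in lborel. E u z \<le> liminf (\<lambda>j. E (w (r j)) z)"
      using AE_lborel_pair[OF u_lim]
    proof eventually_elim
      case (elim z)
      have "(\<lambda>j. E (w (r j)) z) \<longlonglongrightarrow> E u z"
        unfolding E_def using elim by (intro tendsto_ennrealI tendsto_intros tendsto_energy_diff) auto
      then have "liminf (\<lambda>j. E (w (r j)) z) = E u z" by (intro lim_imp_Liminf) auto
      then show ?case by simp
    qed
  qed
  also have "\<dots> \<le> liminf (\<lambda>j. \<integral>\<^sup>+z. E (w (r j)) z \<partial>lborel)"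
    by (intro nn_integral_liminf E_meas w_meas)
  also have "\<dots> \<le> liminf (\<lambda>j. ennreal (I + 1 / (real j + 1) + H))"
  proof (rule Liminf_mono, rule always_eventually, rule allI)
    fix j
    have "1 / (real (r j) + 1) \<le> 1 / (real j + 1)"
      using seq_suble[OF r, of j] by (intro divide_left_mono) auto
    then show "(\<integral>\<^sup>+z. E (w (r j)) z \<partial>lborel) \<le> ennreal (I + 1 / (real j + 1) + H)"
      unfolding E_int[OF wX] using wJ[of "r j"] by (intro ennreal_leI) simp
  qed
  also have "\<dots> = ennreal (I + H)"
  proof (rule lim_imp_Liminf)
    have "(\<lambda>j. 1 / (real j + 1)) \<longlonglongrightarrow> 0" using LIMSEQ_inverse_real_of_nat by (simp add: inverse_eq_divide add.commute)
    then have "(\<lambda>j. I + 1 / (real j + 1) + H) \<longlonglongrightarrow> I + 0 + H" by (intro tendsto_intros)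
    then show "(\<lambda>j. ennreal (I + 1 / (real j + 1) + H)) \<longlonglongrightarrow> ennreal (I + H)"
      by (intro tendsto_ennrealI) simp
  qed simp
  finally have Fatou: "(\<integral>\<^sup>+z. E u z \<partial>lborel) \<le> ennreal (I + H)" .
  have "u \<in> W_s s \<Omega>"
  proof (rule W_s_of_finite_energy[OF u_meas u_bound _ c_meas h_meas h0])
    show "(\<integral>\<^sup>+z. ennreal (energy_diff s u c z + h z) \<partial>lborel) < \<infinity>"
      using Fatou unfolding E_def by (rule order_le_less_trans) simp
  qed (simp_all add: c_def)
  then have uX: "u \<in> X" using u_bound u_obst u_meas by (auto simp: X_def competitors_def u_def)
  have "0 \<le> I + H"
  proof -
    have "- H \<le> I" unfolding I_def using cX J_lower by (intro cInf_greatest) force+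
    then show ?thesis by simp
  qed
  then have J_le: "J u \<le> I" using Fatou E_int[OF uX] J_lower[OF uX] by simp
  show ?thesis
  proof (rule that)
    show "u \<in> competitors A \<phi> \<psi>" by (rule XD(6)[OF uX])
    show "\<bar>u x\<bar> \<le> M" if "x \<in> \<Omega>" for x by (rule u_bound[OF that])
    fix v assume "v \<in> competitors A \<phi> \<psi>" "\<And>x. x \<in> \<Omega> \<Longrightarrow> \<bar>v x\<bar> \<le> M"
    then have vX: "v \<in> X" by (simp add: X_def)
    have "J u = integral\<^sup>L lborel (energy_diff s u v) + J v"
      unfolding J_def by (rule competitors_energy_add[OF XD(6)[OF uX] XD(6)[OF vX] XD(6)[OF cX]])
    then show "integral\<^sup>L lborel (energy_diff s u v) \<le> 0" using J_le I_le[OF vX] by simp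
  qed
qed

end

section \<open>The obstacle problem for Lebesgue measurable data\<close>

context fractional_domain begin

text \<open>A bounded minimiser also beats an unbounded competitor, because truncating the latter does not
increase its energy and respects the obstacle, which lies below \<open>M\<close>.\<close>

lemma minimizer_among_competitors_exists:
  fixes A :: "(real ^ 'n) set" and \<phi> \<psi> :: "real ^ 'n \<Rightarrow> real" and M \<Theta> :: real
  assumes \<phi>: "\<phi> \<in> borel_measurable borel" and A: "A \<subseteq> \<Omega>" and M: "0 \<le> M" and \<Theta>: "2 \<le> \<Theta>"
    and \<psi>: "AE x in lborel. x \<in> A \<longrightarrow> \<psi> x \<le> M"
    and ext: "AE x in lborel. x \<in> enlargement \<Omega> (\<Theta> * diameter \<Omega>) - \<Omega> \<longrightarrow> \<bar>\<phi> x\<bar> \<le> M - diameter \<Omega>"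
    and ker_int: "\<And>d. 0 < d \<Longrightarrow> integrable lborel (truncation_kernel s \<Theta> d :: real ^ 'n \<Rightarrow> real)"
    and ker_le: "\<And>d. 0 < d \<Longrightarrow> integral\<^sup>L lborel (truncation_kernel s \<Theta> d :: real ^ 'n \<Rightarrow> real) \<le> 0"
  obtains u where "u \<in> competitors A \<phi> \<psi>" "\<And>x. x \<in> \<Omega> \<Longrightarrow> \<bar>u x\<bar> \<le> M"
    "\<And>v. v \<in> competitors A \<phi> \<psi> \<Longrightarrow> integral\<^sup>L lborel (energy_diff s u v) \<le> 0"
proof (rule bounded_minimizer_exists[OF \<phi> A M \<psi>])
  fix u assume u: "u \<in> competitors A \<phi> \<psi>" "\<And>x. x \<in> \<Omega> \<Longrightarrow> \<bar>u x\<bar> \<le> M"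
    "\<And>v. v \<in> competitors A \<phi> \<psi> \<Longrightarrow> (\<And>x. x \<in> \<Omega> \<Longrightarrow> \<bar>v x\<bar> \<le> M) \<Longrightarrow>
      integral\<^sup>L lborel (energy_diff s u v) \<le> 0"
  have min: "integral\<^sup>L lborel (energy_diff s u v) \<le> 0" if v: "v \<in> competitors A \<phi> \<psi>" for v
  proof -
    let ?T = "truncate_on \<Omega> M v"
    have v': "v \<in> borel_measurable borel" "v \<in> W_s s \<Omega>" "\<And>x. x \<notin> \<Omega> \<Longrightarrow> v x = \<phi> x"
      "AE x in lborel. x \<in> A \<longrightarrow> \<psi> x \<le> v x" using v by (auto simp: competitors_def)
    have "AE x in lborel. x \<in> A \<longrightarrow> \<psi> x \<le> ?T x"
      using v'(4) \<psi> by eventually_elim (use A in \<open>auto simp: truncate_on_def\<close>)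
    then have T: "?T \<in> competitors A \<phi> \<psi>"
      using v' truncate_on_in_W_s[OF v'(1,2) M] borel_measurable_truncate_on[OF v'(1)]
      by (simp add: competitors_def truncate_on_def[of _ _ _ "_ :: real ^ 'n"])
    have "AE x in lborel. x \<in> enlargement \<Omega> (\<Theta> * diameter \<Omega>) - \<Omega> \<longrightarrow> \<bar>v x\<bar> \<le> M - diameter \<Omega>"
      using ext by eventually_elim (simp add: v'(3))
    then have "integral\<^sup>L lborel (energy_diff s ?T v) \<le> 0"
      by (intro energy_truncation_le[OF v'(1,2) M \<Theta>] ker_int ker_le)
    moreover have "integral\<^sup>L lborel (energy_diff s u ?T) \<le> 0"
      using M by (intro u(3) T) (auto simp: truncate_on_def)
    ultimately show ?thesis using competitors_energy_add[OF u(1) T v] by simp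
  qed
  show thesis
  proof (rule that[OF u(1)])
    show "\<bar>u x\<bar> \<le> M" if "x \<in> \<Omega>" for x by (rule u(2)[OF that])
    show "integral\<^sup>L lborel (energy_diff s u v) \<le> 0" if "v \<in> competitors A \<phi> \<psi>" for v by (rule min[OF that])
  qed
qed

text \<open>Both functions have at most the energy of their midpoint, so strict convexity forces equal
differences \<open>u x - u y = v x - v y\<close> for almost all pairs. As \<open>\<Omega>\<close> has finite measure, almost every \<open>x\<close>
has an exterior partner \<open>y\<close> with this property, and there \<open>u y = v y\<close>.\<close>

lemma minimizers_eq_AE:
  fixes A :: "(real ^ 'n) set" and \<phi> \<psi> u v :: "real ^ 'n \<Rightarrow> real"
  assumes uv: "u \<in> competitors A \<phi> \<psi>" "v \<in> competitors A \<phi> \<psi>"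
    and min: "\<And>w. w \<in> competitors A \<phi> \<psi> \<Longrightarrow> integral\<^sup>L lborel (energy_diff s u w) \<le> 0"
      "\<And>w. w \<in> competitors A \<phi> \<psi> \<Longrightarrow> integral\<^sup>L lborel (energy_diff s v w) \<le> 0"
  shows "AE x in lborel. u x = v x"
proof -
  define m where "m = (\<lambda>x. (u x + v x) / 2)"
  have m: "m \<in> competitors A \<phi> \<psi>" unfolding m_def by (rule competitors_midpoint[OF uv])
  note i = competitors_energy_integrable[OF uv(1) m] competitors_energy_integrable[OF uv(2) m]
  define F where "F z = energy_diff s u m z + energy_diff s v m z" for z
  have F_int: "integrable lborel F" unfolding F_def by (intro Bochner_Integration.integrable_add i)
  have F0: "0 \<le> F z" for z
    using energy_diff_midpoint[of s u v m z] by (simp add: F_def m_def[symmetric])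
  have "integral\<^sup>L lborel F \<le> 0" using min(1)[OF m] min(2)[OF m] i by (simp add: F_def[abs_def])
  moreover have "0 \<le> integral\<^sup>L lborel F" by (intro integral_nonneg_AE AE_I2 F0)
  ultimately have "integral\<^sup>L lborel F = 0" by simp
  then have "AE z in lborel. F z = 0"
    using integral_nonneg_eq_0_iff_AE[OF F_int] F0 by simp
  then have "AE z in lborel. u (fst z) - u (snd z) = v (fst z) - v (snd z)"
  proof eventually_elim
    case (elim z)
    obtain x y where z: "z = (x, y)" by (cases z)
    show ?case
    proof (rule ccontr)
      assume ne: "\<not> ?case"
      let ?n = "CARD('n)"
      define r where "r = norm (x - y)"
      have "x \<noteq> y" using ne z by auto
      then have r: "0 < r" by (simp add: r_def)
      have arg: "(m x - m y) / r = ((u x - u y) / r + (v x - v y) / r) / 2"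
        by (simp add: m_def diff_divide_distrib add_divide_distrib)
      have "(u x - u y) / r \<noteq> (v x - v y) / r" using ne r z by simp
      then have "2 * calG_s ?n s ((m x - m y) / r) < calG_s ?n s ((u x - u y) / r) + calG_s ?n s ((v x - v y) / r)"
        unfolding arg by (rule calG_s_midpoint_strict)
      then have "0 < ((calG_s ?n s ((u x - u y) / r) - calG_s ?n s ((m x - m y) / r))
          + (calG_s ?n s ((v x - v y) / r) - calG_s ?n s ((m x - m y) / r))) / r powr (real ?n - 1 + s)"
        using r by (intro divide_pos_pos) auto
      then have "0 < F z" by (simp only: F_def z energy_diff_def r_def add_divide_distrib prod.case)
      then show False using elim by simp
    qed
  qed
  then have "AE x in lborel. AE y in lborel. u x - u y = v x - v y"
    using lborel_pair.AE_pair[of "\<lambda>z. u (fst z) - u (snd z) = v (fst z) - v (snd z)"]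
    unfolding lborel_prod by simp
  then show ?thesis
  proof eventually_elim
    case (elim x)
    have "\<exists>y. y \<notin> \<Omega> \<and> u x - u y = v x - v y"
    proof (rule ccontr)
      assume no: "\<not> ?thesis"
      have "AE y in lborel. y \<in> \<Omega>" using elim by eventually_elim (use no in auto)
      then have "emeasure lborel (UNIV :: (real ^ 'n) set) \<le> emeasure lborel \<Omega>"
        by (intro emeasure_mono_AE) auto
      then show False using domain_emeasure_finite by (simp add: top_unique)
    qed
    then obtain y where "y \<notin> \<Omega>" "u x - u y = v x - v y" by blast
    then show ?case using uv by (simp add: competitors_def)
  qed
qed

lemma W_s_cong_AE:
  fixes u v :: "real ^ 'n \<Rightarrow> real"
  assumes ae: "AE x in lborel. u x = v x" and v: "v \<in> borel_measurable lebesgue" and u: "u \<in> W_s s \<Omega>"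
  shows "v \<in> W_s s \<Omega>"
proof -
  have "W_s_norm s \<Omega> u = W_s_norm s \<Omega> v"
    unfolding W_s_norm_def
  proof (rule arg_cong2[where f="(+)"]; rule nn_integral_cong_AE)
    show "AE x in lebesgue. ennreal \<bar>u x\<bar> * indicator \<Omega> x = ennreal \<bar>v x\<bar> * indicator \<Omega> x"
      using AE_completion[OF ae] by eventually_elim simp
    show "AE z in lebesgue.
        (case z of (x, y) \<Rightarrow> ennreal (\<bar>u x - u y\<bar> / norm (x - y) powr (real CARD('n) + s))) * indicator (\<Omega> \<times> \<Omega>) z =
        (case z of (x, y) \<Rightarrow> ennreal (\<bar>v x - v y\<bar> / norm (x - y) powr (real CARD('n) + s))) * indicator (\<Omega> \<times> \<Omega>) z"
      using AE_completion[OF AE_lborel_pair[OF ae]] by eventually_elim (simp add: case_prod_unfold)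
  qed
  then show ?thesis using u v unfolding W_s_def by simp
qed

lemma W_s_obst_borel_representative:
  fixes v \<phi> \<phi>' :: "real ^ 'n \<Rightarrow> real"
  assumes v: "v \<in> W_s_obst s \<Omega> A \<phi> \<psi>" and \<phi>': "\<phi>' \<in> borel_measurable borel" and eq: "AE x in lborel. \<phi> x = \<phi>' x"
  obtains v' where "v' \<in> competitors A \<phi>' \<psi>" "AE x in lborel. v x = v' x"
proof -
  have v_meas: "v \<in> borel_measurable lebesgue" and vW: "v \<in> W_s s \<Omega>"
    and off: "AE x in lborel. x \<notin> \<Omega> \<longrightarrow> v x = \<phi> x" and obst: "AE x in lborel. x \<in> A \<longrightarrow> \<psi> x \<le> v x"
    using v by (auto simp: W_s_obst_def W_s_def AE_completion_iff)
  obtain v0 where v0: "v0 \<in> borel_measurable borel" and ae0: "AE x in lborel. v x = v0 x"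
    using completion_ex_borel_measurable_real[OF v_meas] by auto
  \<comment> \<open>The exterior values are reset, so that they agree everywhere with the Borel data.\<close>
  define v' where "v' x = (if x \<in> \<Omega> then v0 x else \<phi>' x)" for x
  have v'_meas: "v' \<in> borel_measurable borel"
    unfolding v'_def[abs_def] using v0 \<phi>' by measurable
  have ae: "AE x in lborel. v x = v' x"
    using ae0 off eq by eventually_elim (auto simp: v'_def)
  have "v' \<in> W_s s \<Omega>"
    by (rule W_s_cong_AE[OF ae _ vW]) (simp add: v'_meas measurable_completion)
  moreover have "AE x in lborel. x \<in> A \<longrightarrow> \<psi> x \<le> v' x"
    using ae obst by eventually_elim simp
  ultimately have "v' \<in> competitors A \<phi>' \<psi>" using v'_meas by (simp add: competitors_def v'_def)
  then show ?thesis using ae by (rule that)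
qed

lemma competitors_in_W_s_obst:
  fixes \<phi> \<phi>' :: "real ^ 'n \<Rightarrow> real"
  assumes "u \<in> competitors A \<phi>' \<psi>" and eq: "AE x in lborel. \<phi> x = \<phi>' x"
  shows "u \<in> W_s_obst s \<Omega> A \<phi> \<psi>"
proof -
  have "AE x in lborel. x \<notin> \<Omega> \<longrightarrow> u x = \<phi> x"
    using eq by eventually_elim (use assms(1) in \<open>simp add: competitors_def\<close>)
  then show ?thesis using assms(1) by (simp add: competitors_def W_s_obst_def AE_completion_iff)
qed

lemma energy_diff_representatives:
  fixes u v u' v' :: "real ^ 'n \<Rightarrow> real"
  assumes "AE x in lborel. u x = u' x" "AE x in lborel. v x = v' x"
    and c: "u' \<in> competitors A \<phi> \<psi>" "v' \<in> competitors A \<phi> \<psi>"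
  shows "set_integrable lebesgue (Q_region \<Omega>) (energy_diff s u v)"
    and "set_lebesgue_integral lebesgue (Q_region \<Omega>) (energy_diff s u v) = integral\<^sup>L lborel (energy_diff s u' v')"
proof -
  have u': "u' \<in> borel_measurable borel" and v': "v' \<in> borel_measurable borel"
    and off: "\<And>x. x \<notin> \<Omega> \<Longrightarrow> u' x = v' x"
    using c by (auto simp: competitors_def)
  let ?F = "\<lambda>u v z. indicator (Q_region \<Omega>) z *\<^sub>R energy_diff s u v z"
  note Q = set_integral_energy_diff[OF u' v' off]
  have ae: "AE z in lebesgue. ?F u' v' z = ?F u v z"
    using AE_completion[OF AE_lborel_pair[OF assms(1)]] AE_completion[OF AE_lborel_pair[OF assms(2)]]
    by eventually_elim (simp add: energy_diff_def case_prod_unfold)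
  have int: "integrable lebesgue (?F u' v')"
    using Q(1) competitors_energy_integrable[OF c] by (simp add: set_integrable_def)
  have m: "(?F u v) \<in> borel_measurable lebesgue"
    by (rule borel_measurable_AE[OF borel_measurable_integrable[OF int] ae])
  show "set_integrable lebesgue (Q_region \<Omega>) (energy_diff s u v)"
    unfolding set_integrable_def using int integrable_cong_AE[OF borel_measurable_integrable[OF int] m ae] by simp
  show "set_lebesgue_integral lebesgue (Q_region \<Omega>) (energy_diff s u v) = integral\<^sup>L lborel (energy_diff s u' v')"
  proof -
    have "set_lebesgue_integral lebesgue (Q_region \<Omega>) (energy_diff s u' v')
        = set_lebesgue_integral lebesgue (Q_region \<Omega>) (energy_diff s u v)"
      unfolding set_lebesgue_integral_def
      by (rule integral_cong_AE[OF borel_measurable_integrable[OF int] m ae])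
    then show ?thesis using Q(2) by simp
  qed
qed

end

lemma open_enlargement:
  fixes \<Omega> :: "'a::euclidean_space set"
  shows "open (enlargement \<Omega> \<delta>)"
proof -
  have "continuous_on UNIV (signed_dist \<Omega>)"
    unfolding signed_dist_def[abs_def] by (intro continuous_intros)
  then have "open (signed_dist \<Omega> -` {..<\<delta>})"
    by (intro open_vimage) auto
  then show ?thesis by (simp add: enlargement_def vimage_def)
qed

lemma Linf_norm_AE_bound:
  fixes f :: "'a::euclidean_space \<Rightarrow> real"
  assumes S: "S \<in> sets borel" and f: "Linf_norm S f \<le> ennreal m" and m: "0 \<le> m"
  shows "AE x in lborel. x \<in> S \<longrightarrow> \<bar>f x\<bar> \<le> m"
proof -
  have "AE x in lebesgue_on S. ennreal \<bar>f x\<bar> \<le> Linf_norm S f"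
    unfolding Linf_norm_def by (rule esssup_AE)
  then have "AE x in lebesgue_on S. \<bar>f x\<bar> \<le> m"
  proof eventually_elim
    case (elim x)
    then have "ennreal \<bar>f x\<bar> \<le> ennreal m" using f by (rule order_trans)
    then show ?case using m by simp
  qed
  then show ?thesis using S by (subst (asm) AE_restrict_space_iff) (auto simp: AE_completion_iff)
qed

theorem theorem2p3:
  fixes s :: real
  assumes "0 < s" and "s < 1"
  shows "\<exists>\<Theta>>1. \<forall>(\<Omega> :: (real ^ 'n) set) A \<psi>.
    bounded \<Omega> \<and> open \<Omega> \<and> lipschitz_boundary \<Omega> \<and> open A \<and> A \<subseteq> \<Omega> \<and> \<psi> \<in> Linf A \<longrightarrow>
    (\<forall>\<phi>. \<phi> \<in> borel_measurable lebesgue \<and> \<phi> \<in> Linf (enlargement \<Omega> (\<Theta> * diameter \<Omega>) - \<Omega>) \<longrightarrow>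
      (\<exists>u. solves_obstacle s \<Omega> A \<phi> \<psi> u \<and>
           (\<forall>v. solves_obstacle s \<Omega> A \<phi> \<psi> v \<longrightarrow> (AE x in lebesgue. v x = u x)) \<and>
           Linf_norm \<Omega> u \<le> ennreal (diameter \<Omega>) +
             max (Linf_norm (enlargement \<Omega> (\<Theta> * diameter \<Omega>) - \<Omega>) \<phi>) (Linf_norm A \<psi>)))"
proof -
  obtain \<Theta> where \<Theta>: "2 \<le> \<Theta>"
    and ker_int: "\<And>d. 0 < d \<Longrightarrow> integrable lborel (truncation_kernel s \<Theta> d :: real ^ 'n \<Rightarrow> real)"
    and ker_le: "\<And>d. 0 < d \<Longrightarrow> integral\<^sup>L lborel (truncation_kernel s \<Theta> d :: real ^ 'n \<Rightarrow> real) \<le> 0"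
    by (rule exists_truncation_radius[OF assms(1)]) (rule that, assumption, blast, blast)
  show ?thesis
  proof (intro exI[of _ \<Theta>] conjI allI impI)
    show "1 < \<Theta>" using \<Theta> by simp
    fix \<Omega> A :: "(real ^ 'n) set" and \<psi> \<phi> :: "real ^ 'n \<Rightarrow> real"
    let ?S = "enlargement \<Omega> (\<Theta> * diameter \<Omega>) - \<Omega>"
    assume H1: "bounded \<Omega> \<and> open \<Omega> \<and> lipschitz_boundary \<Omega> \<and> open A \<and> A \<subseteq> \<Omega> \<and> \<psi> \<in> Linf A"
      and H2: "\<phi> \<in> borel_measurable lebesgue \<and> \<phi> \<in> Linf ?S"
    then have A: "open A" "A \<subseteq> \<Omega>" and \<Omega>: "open \<Omega>" "bounded \<Omega>" by auto
    interpret fractional_domain s \<Omega> using H1 assms by unfold_locales auto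
    define mx where "mx = max (Linf_norm ?S \<phi>) (Linf_norm A \<psi>)"
    define m where "m = enn2real mx"
    have mx: "mx = ennreal m" "0 \<le> m"
      using H1 H2 by (auto simp: m_def mx_def Linf_def max_def)
    define M where "M = diameter \<Omega> + m"
    have d0: "0 \<le> diameter \<Omega>" by (rule diameter_ge_0[OF \<Omega>(2)])
    have M: "0 \<le> M" using d0 mx by (simp add: M_def)
    obtain \<phi>' where \<phi>': "\<phi>' \<in> borel_measurable borel" and eq: "AE x in lborel. \<phi> x = \<phi>' x"
      using completion_ex_borel_measurable_real[of \<phi> lborel] H2 by auto
    have le: "Linf_norm ?S \<phi> \<le> ennreal m" "Linf_norm A \<psi> \<le> ennreal m"
      unfolding mx(1)[symmetric] by (auto simp: mx_def)
    have "?S \<in> sets borel" by (intro sets.Diff borel_open open_enlargement \<Omega>(1))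
    from Linf_norm_AE_bound[OF this le(1) mx(2)]
    have \<phi>_bd: "AE x in lborel. x \<in> ?S \<longrightarrow> \<bar>\<phi> x\<bar> \<le> m" .
    have "A \<in> sets borel" using A(1) by simp
    from Linf_norm_AE_bound[OF this le(2) mx(2)]
    have \<psi>_bd: "AE x in lborel. x \<in> A \<longrightarrow> \<bar>\<psi> x\<bar> \<le> m" .
    have ext: "AE x in lborel. x \<in> ?S \<longrightarrow> \<bar>\<phi>' x\<bar> \<le> M - diameter \<Omega>"
      using \<phi>_bd eq by eventually_elim (simp add: M_def)
    have \<psi>: "AE x in lborel. x \<in> A \<longrightarrow> \<psi> x \<le> M"
      using \<psi>_bd by eventually_elim (use d0 in \<open>auto simp: M_def\<close>)
    obtain u where u: "u \<in> competitors A \<phi>' \<psi>" and u_bd: "\<And>x. x \<in> \<Omega> \<Longrightarrow> \<bar>u x\<bar> \<le> M"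
      and u_min: "\<And>v. v \<in> competitors A \<phi>' \<psi> \<Longrightarrow> integral\<^sup>L lborel (energy_diff s u v) \<le> 0"
      by (rule minimizer_among_competitors_exists[OF \<phi>' A(2) M \<Theta> \<psi> ext ker_int ker_le])
        (assumption, assumption, rule that, assumption, blast, blast)
    have u_sol: "solves_obstacle s \<Omega> A \<phi> \<psi> u"
      unfolding solves_obstacle_def
    proof (intro conjI ballI)
      show "u \<in> W_s_obst s \<Omega> A \<phi> \<psi>" by (rule competitors_in_W_s_obst[OF u eq])
      fix v assume "v \<in> W_s_obst s \<Omega> A \<phi> \<psi>"
      from W_s_obst_borel_representative[OF this \<phi>' eq]
      obtain v' where v': "v' \<in> competitors A \<phi>' \<psi>" "AE x in lborel. v x = v' x" .
      have refl: "AE x in lborel. u x = u x" by simp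
      note rep = energy_diff_representatives[OF refl v'(2) u v'(1)]
      show "set_integrable lebesgue (Q_region \<Omega>) (energy_diff s u v)" by (rule rep(1))
      show "set_lebesgue_integral lebesgue (Q_region \<Omega>) (energy_diff s u v) \<le> 0"
        unfolding rep(2) by (rule u_min[OF v'(1)])
    qed
    have unique: "AE x in lebesgue. v x = u x" if v: "solves_obstacle s \<Omega> A \<phi> \<psi> v" for v
    proof -
      have vW: "v \<in> W_s_obst s \<Omega> A \<phi> \<psi>"
        and vm: "\<And>w. w \<in> W_s_obst s \<Omega> A \<phi> \<psi> \<Longrightarrow> set_lebesgue_integral lebesgue (Q_region \<Omega>) (energy_diff s v w) \<le> 0"
        using v by (auto simp: solves_obstacle_def)
      from W_s_obst_borel_representative[OF vW \<phi>' eq]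
      obtain v' where v': "v' \<in> competitors A \<phi>' \<psi>" "AE x in lborel. v x = v' x" .
      have "integral\<^sup>L lborel (energy_diff s v' w) \<le> 0" if w: "w \<in> competitors A \<phi>' \<psi>" for w
      proof -
        have refl: "AE x in lborel. w x = w x" by simp
        show ?thesis
          using vm[OF competitors_in_W_s_obst[OF w eq]]
          unfolding energy_diff_representatives(2)[OF v'(2) refl v'(1) w] .
      qed
      then have "AE x in lborel. v' x = u x" by (rule minimizers_eq_AE[OF v'(1) u _ u_min])
      with v'(2) have "AE x in lborel. v x = u x" by eventually_elim simp
      then show ?thesis by (rule AE_completion)
    qed
    have "Linf_norm \<Omega> u \<le> ennreal M"
      unfolding Linf_norm_def
    proof (rule esssup_I)
      have "u \<in> borel_measurable lebesgue" using u by (simp add: competitors_def measurable_completion)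
      then show "(\<lambda>x. ennreal \<bar>u x\<bar>) \<in> borel_measurable (lebesgue_on \<Omega>)"
        by (intro measurable_restrict_space1) measurable
      show "AE x in lebesgue_on \<Omega>. ennreal \<bar>u x\<bar> \<le> ennreal M"
        using u_bd by (intro AE_I2 ennreal_leI) (auto simp: space_restrict_space)
    qed
    also have "ennreal M = ennreal (diameter \<Omega>) + mx"
      unfolding mx(1) M_def by (rule ennreal_plus[OF d0 mx(2)])
    finally have bound: "Linf_norm \<Omega> u \<le> ennreal (diameter \<Omega>) + max (Linf_norm ?S \<phi>) (Linf_norm A \<psi>)"
      by (simp only: mx_def)
    show "\<exists>u. solves_obstacle s \<Omega> A \<phi> \<psi> u \<and>
           (\<forall>v. solves_obstacle s \<Omega> A \<phi> \<psi> v \<longrightarrow> (AE x in lebesgue. v x = u x)) \<and>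
           Linf_norm \<Omega> u \<le> ennreal (diameter \<Omega>) + max (Linf_norm ?S \<phi>) (Linf_norm A \<psi>)"
      using u_sol unique bound by blast
  qed
qed

end
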